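(* DiTGR is NP-complete, even when restricted to instances $(G,D,\Delta)$ in which the period is $\Delta=2$, the edge set $E$ of $G$ is bidirected (i.e. $(u,v)\in E$ if and only if $(v,u)\in E$), the matrix $D$ is symmetric, and the only odd cycle in (the undirected graph underlying) $G$ is a triangle.
   Context: All graphs are finite. A $\Delta$-periodic labeling of a directed graph $G=(V,E)$ is a map $\lambda:E\to\{0,1,\dots,\Delta-1\}$; edge $e$ is then active exactly at the times $\lambda(e)+i\Delta$, $i\in\mathbb{N}_0$. A temporal $s$-$z$-path is a sequence $(v_{i-1},v_i,t_i)_{i=1}^{\ell}$ with $v_0=s$, $v_\ell=z$, pairwise distinct vertices $v_0,\dots,v_\ell$, $(v_{i-1},v_i)\in E$ active at time $t_i$ for every $i$, and $t_1<t_2<\dots<t_\ell$ (strictly increasing). Its duration is $t_\ell+1-t_1$. A fastest temporal path is one of minimum duration. $\hat d(u,v)$ is the distance from $u$ to $v$ in the static graph $G$ (all edges have unit length). DiTGR: The input is a directed, strongly connected graph $G=(V,E)$, a matrix $D$ indexed by $V\times V$ with entries positive integers or $\infty$ (no restriction) such that $D_{u,v}\ge\hat d(u,v)$ for all $u,v$, and a positive integer $\Delta$. The question is whether there is a $\Delta$-periodic labeling $\lambda$ of $E$ such that, for all $u,v\in V$, the duration of a fastest temporal path from $u$ to $v$ is at most $D_{u,v}$. Diagonal entries of $D$ play no role; all conditions on $D$ are for distinct vertices. Antiparallel edges $(u,v)$ and $(v,u)$ may get different labels. *)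

theory Defs
  imports
    "HOL-Library.Extended_Nat"
    "HOL-Library.Extended_Real"
    "HOL-Computational_Algebra.Polynomial"
    "Graph_Theory.Graph_Theory"
begin

section \<open>Deterministic multi-tape Turing machines\<close>

text \<open>
  Tapes are infinite in both directions. Symbols and states are natural numbers: symbol 0 is the
  blank, 1 and 2 stand for the bits. Each step reads all tapes, and then writes and moves
  on each of them.
\<close>

datatype move = Left | Stay | Right

record tm =
  num_tapes :: nat
  num_states :: nat
  num_symbols :: nat
  start :: nat
  halt :: nat
  delta :: "nat \<Rightarrow> nat list \<Rightarrow> nat \<times> (nat \<times> move) list"

definition wf_tm :: "tm \<Rightarrow> bool" where
  "wf_tm M \<longleftrightarrow>
     num_tapes M \<ge> 1 \<and> num_symbols M \<ge> 3 \<and> start M < num_states M \<and> halt M < num_states M \<and>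
     (\<forall>q < num_states M. \<forall>rs. length rs = num_tapes M \<and> set rs \<subseteq> {..<num_symbols M} \<longrightarrow>
        (case delta M q rs of (q', as) \<Rightarrow>
           q' < num_states M \<and> length as = num_tapes M \<and> fst ` set as \<subseteq> {..<num_symbols M}))"

type_synonym tape = "(int \<Rightarrow> nat) \<times> int"  \<comment> \<open>contents and head position\<close>
type_synonym config = "nat \<times> tape list"

fun read :: "tape \<Rightarrow> nat" where
  "read (c, h) = c h"

fun offset :: "move \<Rightarrow> int" where
  "offset Left = -1" | "offset Stay = 0" | "offset Right = 1"

fun act :: "nat \<times> move \<Rightarrow> tape \<Rightarrow> tape" where
  "act (a, m) (c, h) = (c(h := a), h + offset m)"

fun step :: "tm \<Rightarrow> config \<Rightarrow> config" where
  "step M (q, ts) =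
     (if q = halt M then (q, ts)
      else case delta M q (map read ts) of (q', as) \<Rightarrow> (q', map2 act as ts))"

definition string_contents :: "bool list \<Rightarrow> int \<Rightarrow> nat" where
  "string_contents x i =
     (if 0 \<le> i \<and> i < int (length x) then (if x ! nat i then 2 else 1) else 0)"

definition init :: "tm \<Rightarrow> bool list \<Rightarrow> config" where
  "init M x =
     (start M, (string_contents x, 0) # replicate (num_tapes M - 1) (string_contents [], 0))"

text \<open>The input is on the first tape; the output is the contents of the last tape on halting.\<close>

definition computes_in_time :: "tm \<Rightarrow> (bool list \<Rightarrow> bool list) \<Rightarrow> (nat \<Rightarrow> nat) \<Rightarrow> bool" where
  "computes_in_time M f T \<longleftrightarrow>
     (\<forall>x. \<exists>t \<le> T (length x). \<exists>ts.
        (step M ^^ t) (init M x) = (halt M, ts) \<and> fst (last ts) = string_contents (f x))"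

definition polytime_computable :: "(bool list \<Rightarrow> bool list) \<Rightarrow> bool" where
  "polytime_computable f \<longleftrightarrow> (\<exists>M (p :: nat poly). wf_tm M \<and> computes_in_time M f (poly p))"

definition polytime_decidable :: "bool list set \<Rightarrow> bool" where
  "polytime_decidable A \<longleftrightarrow> polytime_computable (\<lambda>x. [x \<in> A])"


section \<open>NP-completeness\<close>

text \<open>
  A self-delimiting code: each bit is preceded by \<open>True\<close>, and \<open>False\<close> marks the end.
\<close>

definition delimit :: "bool list \<Rightarrow> bool list" where
  "delimit x = concat (map (\<lambda>b. [True, b]) x) @ [False]"

definition encode_pair :: "bool list \<Rightarrow> bool list \<Rightarrow> bool list" where
  "encode_pair x u = delimit x @ u"

text \<open>
  The set \<open>X\<close> is the set of admissible inputs, i.e. the problem is to decide \<open>x \<in> A\<close> for given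
  \<open>x \<in> X\<close>. A reduction to the problem \<open>A\<close> restricted to \<open>X\<close> must always produce
  elements of \<open>X\<close>. For \<open>X = UNIV\<close> these are the usual notions for languages.
\<close>

definition NP_on :: "bool list set \<Rightarrow> bool list set \<Rightarrow> bool" where
  "NP_on X A \<longleftrightarrow>
     (\<exists>V (p :: nat poly). polytime_decidable V \<and>
        (\<forall>x \<in> X. x \<in> A \<longleftrightarrow> (\<exists>u. length u \<le> poly p (length x) \<and> encode_pair x u \<in> V)))"

abbreviation in_NP :: "bool list set \<Rightarrow> bool" where
  "in_NP \<equiv> NP_on UNIV"

definition NP_hard_on :: "bool list set \<Rightarrow> bool list set \<Rightarrow> bool" where
  "NP_hard_on X A \<longleftrightarrow>
     (\<forall>B. in_NP B \<longrightarrow>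
        (\<exists>f. polytime_computable f \<and> (\<forall>x. f x \<in> X \<and> (x \<in> B \<longleftrightarrow> f x \<in> A))))"

definition NP_complete_on :: "bool list set \<Rightarrow> bool list set \<Rightarrow> bool" where
  "NP_complete_on X A \<longleftrightarrow> NP_on X A \<and> NP_hard_on X A"

abbreviation NP_complete :: "bool list set \<Rightarrow> bool" where
  "NP_complete \<equiv> NP_complete_on UNIV"


section \<open>Periodic temporal graphs\<close>

definition periodic_labeling :: "'a pair_pre_digraph \<Rightarrow> nat \<Rightarrow> ('a \<times> 'a \<Rightarrow> nat) \<Rightarrow> bool" where
  "periodic_labeling G \<Delta> lab \<longleftrightarrow> (\<forall>e \<in> parcs G. lab e < \<Delta>)"

definition active :: "nat \<Rightarrow> ('a \<times> 'a \<Rightarrow> nat) \<Rightarrow> 'a \<times> 'a \<Rightarrow> nat \<Rightarrow> bool" where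
  "active \<Delta> lab e t \<longleftrightarrow> (\<exists>i. t = lab e + i * \<Delta>)"

text \<open>
  A temporal path is the list of its arcs, each paired with its time. It has at least one arc,
  so that its duration is defined.
\<close>

definition temporal_path ::
  "'a pair_pre_digraph \<Rightarrow> nat \<Rightarrow> ('a \<times> 'a \<Rightarrow> nat) \<Rightarrow> 'a \<Rightarrow> (('a \<times> 'a) \<times> nat) list \<Rightarrow> 'a \<Rightarrow> bool" where
  "temporal_path G \<Delta> lab s p z \<longleftrightarrow>
     p \<noteq> [] \<and> pre_digraph.apath G s (map fst p) z \<and>
     (\<forall>(e, t) \<in> set p. active \<Delta> lab e t) \<and> sorted_wrt (<) (map snd p)"

definition duration :: "(('a \<times> 'a) \<times> nat) list \<Rightarrow> nat" where
  "duration p = snd (last p) + 1 - snd (hd p)"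

definition fastest_duration ::
  "'a pair_pre_digraph \<Rightarrow> nat \<Rightarrow> ('a \<times> 'a \<Rightarrow> nat) \<Rightarrow> 'a \<Rightarrow> 'a \<Rightarrow> enat" where
  "fastest_duration G \<Delta> lab u v =
     (INF p \<in> {p. temporal_path G \<Delta> lab u p v}. enat (duration p))"

definition static_dist :: "'a pair_pre_digraph \<Rightarrow> 'a \<Rightarrow> 'a \<Rightarrow> ereal" where
  "static_dist G = wf_digraph.\<mu> (with_proj G) (\<lambda>_. 1)"


section \<open>The problem DiTGR\<close>

type_synonym 'a ditgr = "'a pair_pre_digraph \<times> ('a \<Rightarrow> 'a \<Rightarrow> enat) \<times> nat"

fun ditgr_instance :: "'a ditgr \<Rightarrow> bool" where
  "ditgr_instance (G, D, \<Delta>) \<longleftrightarrow>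
     pair_digraph G \<and> strongly_connected G \<and> \<Delta> > 0 \<and>
     (\<forall>u \<in> pverts G. \<forall>v \<in> pverts G. u \<noteq> v \<longrightarrow>
        D u v > 0 \<and> static_dist G u v \<le> ereal_of_enat (D u v))"

fun ditgr_yes :: "'a ditgr \<Rightarrow> bool" where
  "ditgr_yes (G, D, \<Delta>) \<longleftrightarrow>
     (\<exists>lab. periodic_labeling G \<Delta> lab \<and>
        (\<forall>u \<in> pverts G. \<forall>v \<in> pverts G. u \<noteq> v \<longrightarrow> fastest_duration G \<Delta> lab u v \<le> D u v))"

text \<open>
  A cycle of the underlying undirected graph is identified with its set of edges. Since \<open>G\<close> has
  no loops, the odd directed cycles of the symmetric closure of \<open>G\<close> are exactly the odd undirected
  cycles of \<open>G\<close>, each with an orientation and a starting point.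
\<close>

definition odd_cycles :: "'a pair_pre_digraph \<Rightarrow> 'a set set set" where
  "odd_cycles G =
     {(\<lambda>(u, v). {u, v}) ` set p | p. pre_digraph.cycle (mk_symmetric G) p \<and> odd (length p)}"

definition only_odd_cycle_is_triangle :: "'a pair_pre_digraph \<Rightarrow> bool" where
  "only_odd_cycle_is_triangle G \<longleftrightarrow> (\<exists>C. odd_cycles G = {C} \<and> card C = 3)"

fun ditgr_restricted :: "'a ditgr \<Rightarrow> bool" where
  "ditgr_restricted (G, D, \<Delta>) \<longleftrightarrow>
     \<Delta> = 2 \<and> symmetric G \<and>
     (\<forall>u \<in> pverts G. \<forall>v \<in> pverts G. u \<noteq> v \<longrightarrow> D u v = D v u) \<and>
     only_odd_cycle_is_triangle G"


section \<open>Instances as bit strings\<close>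

text \<open>
  Numbers are in binary, least significant bit first. Only graphs with vertex set
  \<open>{..<n}\<close> are encoded: \<open>n\<close> in unary, the adjacency matrix, the matrix \<open>D\<close> row by row, and the
  period in binary.
\<close>

fun binary :: "nat \<Rightarrow> bool list" where
  "binary n = (if n = 0 then [] else odd n # binary (n div 2))"

declare binary.simps [simp del]

definition encode_nat :: "nat \<Rightarrow> bool list" where
  "encode_nat n = delimit (binary n)"

definition encode_enat :: "enat \<Rightarrow> bool list" where
  "encode_enat d = (case d of enat k \<Rightarrow> True # encode_nat k | \<infinity> \<Rightarrow> [False])"

fun encode :: "nat ditgr \<Rightarrow> bool list" where
  "encode (G, D, \<Delta>) =
     (let n = card (pverts G); ps = List.product [0..<n] [0..<n] in
        replicate n True @ [False] @
        map (\<lambda>uv. uv \<in> parcs G) ps @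
        concat (map (\<lambda>(u, v). encode_enat (D u v)) ps) @
        encode_nat \<Delta>)"

definition encodable :: "nat ditgr \<Rightarrow> bool" where
  "encodable I \<longleftrightarrow> (\<exists>n. pverts (fst I) = {..<n}) \<and> ditgr_instance I"

definition DiTGR :: "bool list set" where
  "DiTGR = encode ` {I. encodable I \<and> ditgr_yes I}"

definition DiTGR_restricted_instances :: "bool list set" where
  "DiTGR_restricted_instances = encode ` {I. encodable I \<and> ditgr_restricted I}"

end

theory Submission
  imports Defs
begin

text \<open>
  Hardness: with period 2, a path of duration 2 or 3 alternates the labels of its arcs. In the graph below,
  a triangle with a pendant vertex at each corner and bounds 2 between each pendant vertex and the two
  farther corners forces all six arcs of the triangle to have the same label \<open>c\<close>. For each vertex \<open>l\<close>
  of a hypergraph, three vertices attached to the corner 0 with pairwise bounds 2 are forced to send all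
  their arcs to 0 at one time and to receive all arcs from 0 at the other time; this gives the colour of \<open>l\<close>.
  For each hyperedge, a vertex \<open>e\<close> attached to the first of the three vertices for each of its members
  has bound 3 to and from the corner 1. The path from \<open>e\<close> exists iff some member has an arc to 0 with label
  different from \<open>c\<close>, and the path to \<open>e\<close> exists iff some member has an arc from 0 with label different from
  \<open>c\<close>. Thus the instance is a yes-instance iff the hypergraph has a 2-colouring without monochromatic edge.

  An arbitrary NP problem is reduced to hypergraph 2-colouring by a tableau of the verifier.

  Membership: a certificate contains a labeling and one path for each pair of vertices. The best times on
  a given path are the greedy ones, for which the duration is 1 plus the difference of the last and the first
  label plus \<open>\<Delta>\<close> times the number of positions at which the label does not increase.

  All machines come from one construction: functions of unary numbers and of the bits of the input that are
  closed under composition and polynomially bounded iteration, each realised by a program with counters.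
  The period, the labels and the matrix entries are binary, hence they are only compared digit by digit.
\<close>

section \<open>Counter programs on Turing machines\<close>

text \<open>Comparison with the arcs of a pendant vertex only yields equal labels for arcs of the
  triangle that leave a common corner, or that enter one. In a bipartite graph such equalities would
  never relate an arc to its reverse. The odd cycle joins the two classes: a chain of these
  equalities passes twice around the triangle and meets all six arcs. That (0,1) and (1,0) share the
  label \<open>c\<close> is essential, since it makes the two bounds at a hyperedge refer to the
  same label. As the matrix is symmetric, each bound acts in both directions, and reversing a path
  exchanges the arcs to 0 with the arcs from 0. Since these carry opposite labels, the reversed
  condition is the original one for the complementary colouring. So a hyperedge expresses, instead
  of a clause, that its members are not all coloured alike; this is why 2-colouring is the natural
  source. Ordinary clauses are recovered by one vertex common to all clause edges, which acts as the
  constant false.\<close>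

lemma poly_nat_mono: "m \<le> n \<Longrightarrow> poly (p :: nat poly) m \<le> poly p n"
  by (induct p) (auto intro!: add_mono mult_mono)

definition bit_sym :: "bool list \<Rightarrow> nat \<Rightarrow> nat" where
  "bit_sym x i = (if i < length x then (if x ! i then 2 else 1) else 0)"

lemma string_contents_bit_sym: "string_contents x (int i) = bit_sym x i"
  by (auto simp: string_contents_def bit_sym_def)

definition tape_sym :: "bool list \<Rightarrow> nat \<Rightarrow> nat \<Rightarrow> nat" where
  "tape_sym x j p = (if j = 0 then bit_sym x p else of_bool (p = 0))"

text \<open>\<open>Inc\<close> and \<open>Dec\<close> move a head by one cell.
  \<open>While j a c\<close> runs until the symbol under head \<open>j\<close> is \<open>a\<close>,
  and \<open>Branch j a c d\<close> takes \<open>c\<close> in case of equality; on a counter tape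
  the test against 1 is a zero test.\<close>

datatype com = Inc nat | Dec nat | Out bool | Seq com com (infixr \<open>;;\<close> 60)
  | While nat nat com | Branch nat nat com com

type_synonym store = "(nat \<Rightarrow> nat) \<times> bool list"

text \<open>The time is the exact number of machine steps, with one step for each test and one for
  splitting a sequence. \<open>Dec\<close> is blocked at 0, so no head moves left of cell 0.\<close>

inductive exec :: "bool list \<Rightarrow> com \<Rightarrow> store \<Rightarrow> nat \<Rightarrow> store \<Rightarrow> bool" for x where
  Inc: "exec x (Inc j) (s, o') 1 (s(j := Suc (s j)), o')"
| Dec: "s j > 0 \<Longrightarrow> exec x (Dec j) (s, o') 1 (s(j := s j - 1), o')"
| Out: "exec x (Out b) (s, o') 1 (s, o' @ [b])"
| Seq: "\<lbrakk>exec x c \<sigma> t \<sigma>'; exec x d \<sigma>' t' \<sigma>''\<rbrakk> \<Longrightarrow> exec x (c ;; d) \<sigma> (Suc (t + t')) \<sigma>''"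
| While_stop: "tape_sym x j (fst \<sigma> j) = a \<Longrightarrow> exec x (While j a c) \<sigma> 1 \<sigma>"
| While_loop: "\<lbrakk>tape_sym x j (fst \<sigma> j) \<noteq> a; exec x c \<sigma> t \<sigma>'; exec x (While j a c) \<sigma>' t' \<sigma>''\<rbrakk>
    \<Longrightarrow> exec x (While j a c) \<sigma> (Suc (t + t')) \<sigma>''"
| Branch_eq: "\<lbrakk>tape_sym x j (fst \<sigma> j) = a; exec x c \<sigma> t \<sigma>'\<rbrakk> \<Longrightarrow> exec x (Branch j a c d) \<sigma> (Suc t) \<sigma>'"
| Branch_neq: "\<lbrakk>tape_sym x j (fst \<sigma> j) \<noteq> a; exec x d \<sigma> t \<sigma>'\<rbrakk> \<Longrightarrow> exec x (Branch j a c d) \<sigma> (Suc t) \<sigma>'"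

fun max_reg :: "com \<Rightarrow> nat" where
  "max_reg (Inc j) = j"
| "max_reg (Dec j) = j"
| "max_reg (Out b) = 0"
| "max_reg (c ;; d) = max (max_reg c) (max_reg d)"
| "max_reg (While j a c) = max j (max_reg c)"
| "max_reg (Branch j a c d) = max j (max (max_reg c) (max_reg d))"

text \<open>A control state is the stack of the commands still to be run. These are the stacks that
  occur while \<open>c\<close> runs on top of \<open>K\<close>; a loop puts itself back below its
  body, hence there are only finitely many.\<close>

fun control :: "com \<Rightarrow> com list \<Rightarrow> com list set" where
  "control (c ;; d) K = insert ((c ;; d) # K) (control c (d # K) \<union> control d K)"
| "control (While j a c) K = insert (While j a c # K) (control c (While j a c # K))"
| "control (Branch j a c d) K = insert (Branch j a c d # K) (control c K \<union> control d K)"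
| "control c K = {c # K}"

lemma finite_control: "finite (control c K)"
  by (induct c arbitrary: K) auto

lemma control_start: "c # K \<in> control c K"
  by (cases c) auto

abbreviation stay :: "nat list \<Rightarrow> (nat \<times> move) list" where
  "stay rs \<equiv> map (\<lambda>r. (r, Stay)) rs"

fun next_control :: "com list \<Rightarrow> nat list \<Rightarrow> com list \<times> (nat \<times> move) list" where
  "next_control [] rs = ([], stay rs)"
| "next_control (Inc j # K) rs = (K, (stay rs)[j := (rs ! j, Right)])"
| "next_control (Dec j # K) rs = (K, (stay rs)[j := (rs ! j, Left)])"
| "next_control (Out b # K) rs = (K, (stay rs)[length rs - 1 := (if b then 2 else 1, Right)])"
| "next_control ((c ;; d) # K) rs = (c # d # K, stay rs)"
| "next_control (While j a c # K) rs = (if rs ! j = a then K else c # While j a c # K, stay rs)"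
| "next_control (Branch j a c d # K) rs = (if rs ! j = a then c # K else d # K, stay rs)"

lemma next_control_closed:
  "L \<in> control c K \<Longrightarrow> fst (next_control L rs) \<in> insert K (control c K)"
proof (induct c arbitrary: K L)
  case (Seq c d)
  then show ?case using control_start[of d K] control_start[of c "d # K"] by fastforce
next
  case (While j a c)
  then show ?case using control_start[of c "While j a c # K"] While.hyps[of L "While j a c # K"] by (auto split: if_splits)
next
  case (Branch j a c d)
  then show ?case using control_start[of c K] control_start[of d K]
    Branch.hyps(1)[of L K] Branch.hyps(2)[of L K] by auto
qed auto

lemma next_control_actions:
  assumes "set rs \<subseteq> {..<3}" "rs \<noteq> []" "\<forall>c \<in> set L. max_reg c < length rs"
  shows "length (snd (next_control L rs)) = length rs"
    and "fst ` set (snd (next_control L rs)) \<subseteq> {..<3}"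
proof -
  show "length (snd (next_control L rs)) = length rs"
    by (cases "(L, rs)" rule: next_control.cases) auto
  have stay: "fst ` set (stay rs) \<subseteq> {..<3}" using assms(1) by auto
  have upd: "b < 3" if "a < 3" "(b, m') \<in> set ((stay rs)[i := (a, m)])" for i a b m m'
    using stay that set_update_subset_insert[of "stay rs" i "(a, m)"] by fastforce
  have "rs ! j < 3" if "j < length rs" for j using assms(1) nth_mem[OF that] by blast
  then show "fst ` set (snd (next_control L rs)) \<subseteq> {..<3}"
    using assms(3) stay by (cases "(L, rs)" rule: next_control.cases) (auto dest!: upd[rotated])
qed

lemma control_max_reg:
  "L \<in> control c K \<Longrightarrow> d \<in> set L \<Longrightarrow> max_reg d \<le> max_reg c \<or> d \<in> set K"
  by (induct c arbitrary: K L) (fastforce simp: le_max_iff_disj)+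

section \<open>Compilation of counter programs into multi-tape machines\<close>

locale compile =
  fixes prog :: com and k :: nat and g :: "com list \<Rightarrow> nat"
  assumes g: "bij_betw g (insert [] (control prog [])) {0..<card (insert [] (control prog []))}"
    and k: "max_reg prog \<le> k"
begin

definition "states = insert [] (control prog [])"

text \<open>The extra state \<open>card states\<close> writes the marker 1 in cell 0 of the counter tapes.\<close>

definition machine :: tm where
  "machine = \<lparr>num_tapes = k + 2, num_states = Suc (card states), num_symbols = 3,
     start = card states, halt = g [],
     delta = (\<lambda>q rs. if q = card states
       then (g [prog], map (\<lambda>j. (if 0 < j \<and> j \<le> k then 1 else rs ! j, Stay)) [0..<k + 2])
       else case next_control (inv_into states g q) rs of (L, as) \<Rightarrow> (g L, as))\<rparr>"

definition tapes :: "bool list \<Rightarrow> store \<Rightarrow> tape list" where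
  "tapes x \<sigma> = map (\<lambda>j. if j = Suc k then (string_contents (snd \<sigma>), int (length (snd \<sigma>)))
     else (if j = 0 then string_contents x else (\<lambda>i. of_bool (i = 0)), int (fst \<sigma> j))) [0..<k + 2]"

lemma g_less: "L \<in> states \<Longrightarrow> g L < card states"
  using g by (auto simp: bij_betw_def states_def)

lemma inv_g: "L \<in> states \<Longrightarrow> inv_into states g (g L) = L"
  using g by (simp add: bij_betw_def states_def inv_into_f_f)

lemma inv_g_mem: "q < card states \<Longrightarrow> inv_into states g q \<in> states"
  using g inv_into_into[of q g states] by (simp add: bij_betw_def states_def)

lemma next_in_states: "L \<in> states \<Longrightarrow> fst (next_control L rs) \<in> states"
  using next_control_closed[of L prog "[]" rs] by (auto simp: states_def)

lemma states_max_reg: "L \<in> states \<Longrightarrow> d \<in> set L \<Longrightarrow> max_reg d \<le> k"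
  using control_max_reg[of L prog "[]" d] k by (auto simp: states_def)

lemma wf_machine: "wf_tm machine"
proof -
  have init: "g [prog] < Suc (card states)"
    using g_less[of "[prog]"] control_start[of prog "[]"] by (simp add: states_def)
  have nil: "g [] < Suc (card states)" using g_less[of "[]"] by (simp add: states_def)
  have "case delta machine q rs of (q', as) \<Rightarrow> q' < Suc (card states) \<and> length as = k + 2 \<and> fst ` set as \<subseteq> {..<3}"
    if q: "q < Suc (card states)" and rs: "length rs = k + 2" "set rs \<subseteq> {..<3}" for q rs
  proof (cases "q = card states")
    case True
    have "rs ! j < 3" if "j < k + 2" for j using subsetD[OF rs(2), of "rs ! j"] rs(1) that by simp
    then show ?thesis using True init by (auto simp: machine_def)
  next
    case False
    then have "q < card states" using q by simp
    then have L: "inv_into states g q \<in> states" by (rule inv_g_mem)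
    have regs: "\<forall>c \<in> set (inv_into states g q). max_reg c < length rs"
      using states_max_reg[OF L] rs(1) by (auto simp: less_Suc_eq_le intro: le_SucI)
    obtain L' as where n: "next_control (inv_into states g q) rs = (L', as)" by fastforce
    have "rs \<noteq> []" using rs(1) by auto
    from next_control_actions[OF rs(2) this regs] have "length as = k + 2" "fst ` set as \<subseteq> {..<3}"
      using n rs(1) by auto
    moreover have "g L' < Suc (card states)" using g_less[OF next_in_states[OF L, of rs]] n by simp
    ultimately show ?thesis using False n by (simp add: machine_def)
  qed
  then show ?thesis using init nil by (simp add: wf_tm_def machine_def)
qed

lemma reads_nth: "j \<le> k \<Longrightarrow> map read (tapes x \<sigma>) ! j = tape_sym x j (fst \<sigma> j)"
  by (simp add: tapes_def tape_sym_def string_contents_bit_sym del: upt_Suc)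

lemma length_tapes [simp]: "length (tapes x \<sigma>) = k + 2"
  by (simp add: tapes_def)

lemma step_machine:
  assumes "L \<in> states" "L \<noteq> []" "next_control L (map read (tapes x \<sigma>)) = (L', as)"
  shows "step machine (g L, tapes x \<sigma>) = (g L', map2 act as (tapes x \<sigma>))"
proof -
  have "g L \<noteq> g []" using inv_g[OF assms(1)] inv_g[of "[]"] assms(2) by (auto simp: states_def)
  moreover have "g L \<noteq> card states" using g_less[OF assms(1)] by simp
  ultimately show ?thesis using assms(3) inv_g[OF assms(1)] by (simp add: machine_def)
qed

lemma act_stay: "map2 act (stay (map read ts)) ts = ts"
proof -
  have "act (read t, Stay) t = t" for t by (cases t) auto
  then show ?thesis by (induct ts) auto
qed

lemma step_stay:
  assumes "L \<in> states" "L \<noteq> []"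
    "next_control L (map read (tapes x \<sigma>)) = (L', stay (map read (tapes x \<sigma>)))"
  shows "step machine (g L, tapes x \<sigma>) = (g L', tapes x \<sigma>)"
  using step_machine[OF assms] act_stay by metis

lemma act_move:
  assumes "j \<le> k" "int (s j) + offset m = int n"
  shows "map2 act ((stay (map read (tapes x (s, o'))))[j := (map read (tapes x (s, o')) ! j, m)]) (tapes x (s, o'))
    = tapes x (s(j := n), o')"
  using assms
  by (intro nth_equalityI) (auto simp: tapes_def nth_list_update simp del: upt_Suc split: if_splits)

lemma act_out:
  "map2 act ((stay (map read (tapes x (s, o'))))[Suc k := (if b then 2 else 1, Right)]) (tapes x (s, o'))
    = tapes x (s, o' @ [b])"
proof -
  have "(string_contents o')(int (length o') := if b then 2 else 1) = string_contents (o' @ [b])"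
    by (rule ext) (auto simp: string_contents_def nth_append)
  then show ?thesis
    by (intro nth_equalityI) (auto simp: tapes_def nth_list_update simp del: upt_Suc split: if_splits)
qed

text \<open>The rest \<open>K\<close> of the stack is arbitrary in the induction: running
  \<open>c\<close> consumes the top of the stack and touches nothing below it.\<close>

lemma simulation:
  assumes "exec x c \<sigma> t \<sigma>'" "control c K \<subseteq> states" "K \<in> states" "max_reg c \<le> k"
  shows "(step machine ^^ t) (g (c # K), tapes x \<sigma>) = (g K, tapes x \<sigma>')"
  using assms
proof (induct arbitrary: K)
  case (Inc j s o')
  then show ?case using step_machine[of "com.Inc j # K"] act_move[of j s Right "Suc (s j)" x o'] by simp
next
  case (Dec s j o')
  then show ?case using step_machine[of "com.Dec j # K"] act_move[of j s Left "s j - 1" x o'] by simp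
next
  case (Out b s o')
  then show ?case using step_machine[of "com.Out b # K"] act_out[of x s o' b] by simp
next
  case (Seq c \<sigma> t \<sigma>' d t' \<sigma>'')
  have d: "d # K \<in> states" using Seq.prems control_start[of d K] by auto
  have c: "(c ;; d) # K \<in> states" using Seq.prems by auto
  have "step machine (g ((c ;; d) # K), tapes x \<sigma>) = (g (c # d # K), tapes x \<sigma>)"
    by (rule step_stay[OF c]) auto
  moreover have "(step machine ^^ t) (g (c # d # K), tapes x \<sigma>) = (g (d # K), tapes x \<sigma>')"
    using Seq.prems d by (intro Seq.hyps) auto
  moreover have "(step machine ^^ t') (g (d # K), tapes x \<sigma>') = (g K, tapes x \<sigma>'')"
    using Seq.prems by (intro Seq.hyps) auto
  ultimately show ?case by (simp add: funpow_swap1 add.commute[of t] funpow_add del: step.simps)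
next
  case (While_stop j \<sigma> a c)
  have "While j a c # K \<in> states" using While_stop.prems by auto
  from step_stay[OF this] show ?case
    using While_stop by (simp add: reads_nth del: step.simps nth_map)
next
  case (While_loop j \<sigma> a c t \<sigma>' t' \<sigma>'')
  have w: "While j a c # K \<in> states" using While_loop.prems by auto
  have "step machine (g (While j a c # K), tapes x \<sigma>) = (g (c # While j a c # K), tapes x \<sigma>)"
    using While_loop by (intro step_stay[OF w]) (simp_all add: reads_nth del: step.simps nth_map)
  moreover have "(step machine ^^ t) (g (c # While j a c # K), tapes x \<sigma>) = (g (While j a c # K), tapes x \<sigma>')"
    using While_loop.prems w by (intro While_loop.hyps) auto
  moreover have "(step machine ^^ t') (g (While j a c # K), tapes x \<sigma>') = (g K, tapes x \<sigma>'')"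
    using While_loop.prems by (intro While_loop.hyps) auto
  ultimately show ?case by (simp add: funpow_swap1 add.commute[of t] funpow_add del: step.simps)
next
  case (Branch_eq j \<sigma> a c t \<sigma>' d)
  have w: "Branch j a c d # K \<in> states" using Branch_eq.prems by auto
  have "step machine (g (Branch j a c d # K), tapes x \<sigma>) = (g (c # K), tapes x \<sigma>)"
    using Branch_eq by (intro step_stay[OF w]) (simp_all add: reads_nth del: step.simps nth_map)
  moreover have "(step machine ^^ t) (g (c # K), tapes x \<sigma>) = (g K, tapes x \<sigma>')"
    using Branch_eq.prems by (intro Branch_eq.hyps) auto
  ultimately show ?case by (simp add: funpow_swap1 del: step.simps)
next
  case (Branch_neq j \<sigma> a d t \<sigma>' c)
  have w: "Branch j a c d # K \<in> states" using Branch_neq.prems by auto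
  have "step machine (g (Branch j a c d # K), tapes x \<sigma>) = (g (d # K), tapes x \<sigma>)"
    using Branch_neq by (intro step_stay[OF w]) (simp_all add: reads_nth del: step.simps nth_map)
  moreover have "(step machine ^^ t) (g (d # K), tapes x \<sigma>) = (g K, tapes x \<sigma>')"
    using Branch_neq.prems by (intro Branch_neq.hyps) auto
  ultimately show ?case by (simp add: funpow_swap1 del: step.simps)
qed

text \<open>The additional step is the first one, which writes the markers on the counter
  tapes.\<close>

lemma machine_computes:
  assumes "exec x prog (\<lambda>_. 0, []) t (s, y)"
  shows "\<exists>ts. (step machine ^^ Suc t) (init machine x) = (halt machine, ts) \<and> fst (last ts) = string_contents y"
proof -
  have p: "[prog] \<in> states" "[] \<in> states" using control_start[of prog "[]"] by (auto simp: states_def)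
  have ne: "card states \<noteq> g []" using g_less[OF p(2)] by simp
  have "snd (init machine x) = map (\<lambda>j. if j = 0 then (string_contents x, 0) else (string_contents [], 0)) [0..<k + 2]"
    by (intro nth_equalityI) (auto simp: init_def machine_def nth_Cons nth_append simp del: upt_Suc split: nat.splits)
  then have i: "init machine x = (card states, map (\<lambda>j. (if j = 0 then string_contents x else string_contents [], 0)) [0..<k + 2])"
    by (simp add: init_def machine_def if_distrib[of "\<lambda>c. (c, 0)"] cong: if_cong)
  have blank: "(string_contents [])(0 := Suc 0) = (\<lambda>i. of_bool (i = 0))"
    by (auto simp: string_contents_def)
  have "step machine (init machine x) = (g [prog], tapes x (\<lambda>_. 0, []))"
    unfolding i using ne
    by (auto simp: machine_def tapes_def blank intro!: nth_equalityI simp del: upt_Suc)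
  then have "(step machine ^^ Suc t) (init machine x) = (g [], tapes x (s, y))"
    using simulation[OF assms, of "[]"] p k by (auto simp: funpow_swap1 states_def simp del: step.simps)
  moreover have "last (tapes x (s, y)) = (string_contents y, int (length y))"
    by (simp add: tapes_def)
  ultimately show ?thesis by (simp add: machine_def)
qed

end

theorem exec_imp_polytime:
  assumes "\<And>x. \<exists>t s. exec x c (\<lambda>_. 0, []) t (s, f x) \<and> t \<le> poly p (length x)"
  shows "polytime_computable f"
proof -
  let ?S = "insert [] (control c [])"
  have "finite ?S" by (simp add: finite_control)
  from ex_bij_betw_finite_nat[OF this] obtain g where "bij_betw g ?S {0..<card ?S}" ..
  then interpret compile c "max_reg c" g by unfold_locales auto
  have "computes_in_time machine f (poly (p + 1))"
    unfolding computes_in_time_def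
  proof
    fix x
    from assms[of x] obtain t s where t: "exec x c (\<lambda>_. 0, []) t (s, f x)" "t \<le> poly p (length x)" by auto
    from machine_computes[OF t(1)] t(2)
    show "\<exists>t\<le>poly (p + 1) (length x). \<exists>ts. (step machine ^^ t) (init machine x) = (halt machine, ts) \<and> fst (last ts) = string_contents (f x)"
      by (intro exI[of _ "Suc t"]) simp
  qed
  then show ?thesis using wf_machine polytime_computable_def by auto
qed

section \<open>Basic counter programs and their running times\<close>

text \<open>An upper bound replaces the exact time, so that both branches of a test and all rounds
  of a loop can share one bound.\<close>

definition runs :: "bool list \<Rightarrow> com \<Rightarrow> store \<Rightarrow> nat \<Rightarrow> store \<Rightarrow> bool" where
  "runs x c \<sigma> n \<sigma>' \<longleftrightarrow> (\<exists>t\<le>n. exec x c \<sigma> t \<sigma>')"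

lemma runs_Inc: "n = Suc (s j) \<Longrightarrow> runs x (Inc j) (s, o') 1 (s(j := n), o')"
  unfolding runs_def using exec.Inc by blast

lemma runs_Dec: "s j = Suc n \<Longrightarrow> runs x (Dec j) (s, o') 1 (s(j := n), o')"
  unfolding runs_def using exec.Dec[of s j x o'] by auto

lemma runs_Out: "runs x (Out b) (s, o') 1 (s, o' @ [b])"
  unfolding runs_def using exec.Out by blast

lemma runs_Seq: "runs x c \<sigma> n \<sigma>' \<Longrightarrow> runs x d \<sigma>' m \<sigma>'' \<Longrightarrow> runs x (c ;; d) \<sigma> (Suc (n + m)) \<sigma>''"
  unfolding runs_def using exec.Seq by (meson Suc_le_mono add_mono)

lemma runs_While_stop: "tape_sym x j (fst \<sigma> j) = a \<Longrightarrow> runs x (While j a c) \<sigma> 1 \<sigma>"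
  unfolding runs_def using exec.While_stop by blast

lemma runs_While_loop: "tape_sym x j (fst \<sigma> j) \<noteq> a \<Longrightarrow> runs x c \<sigma> n \<sigma>' \<Longrightarrow> runs x (While j a c) \<sigma>' m \<sigma>''
  \<Longrightarrow> runs x (While j a c) \<sigma> (Suc (n + m)) \<sigma>''"
  unfolding runs_def using exec.While_loop by (meson Suc_le_mono add_mono)

lemma runs_Branch: "(if tape_sym x j (fst \<sigma> j) = a then runs x c \<sigma> n \<sigma>' else runs x d \<sigma> n \<sigma>') \<Longrightarrow>
  runs x (Branch j a c d) \<sigma> (Suc n) \<sigma>'"
  unfolding runs_def using exec.Branch_eq exec.Branch_neq by (metis Suc_le_mono)

lemma runs_mono: "runs x c \<sigma> n \<sigma>' \<Longrightarrow> n \<le> m \<Longrightarrow> runs x c \<sigma> m \<sigma>'"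
  unfolding runs_def by (meson order_trans)

text \<open>A counter is the head position of its tape, and the marker in cell 0 permits the zero test.\<close>

lemma tape_sym_counter [simp]: "j > 0 \<Longrightarrow> tape_sym x j n = of_bool (n = 0)"
  by (simp add: tape_sym_def)

text \<open>The stores before the rounds are indexed by the value of the counter, so the family
  \<open>\<sigma>\<close> is passed through from \<open>n\<close> down to 0.\<close>

lemma runs_counter_loop:
  assumes "j > 0" "\<And>i. i < n \<Longrightarrow> runs x c (\<sigma> (Suc i)) K (\<sigma> i)" "\<And>i. i \<le> n \<Longrightarrow> fst (\<sigma> i) j = i"
  shows "runs x (While j 1 c) (\<sigma> n) (Suc (n * Suc K)) (\<sigma> 0)"
  using assms(2,3)
proof (induct n)
  case 0
  then show ?case using runs_While_stop[of x j "\<sigma> 0" 1 c] assms(1) by simp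
next
  case (Suc n)
  have "runs x (While j 1 c) (\<sigma> n) (Suc (n * Suc K)) (\<sigma> 0)" using Suc by auto
  then have "runs x (While j 1 c) (\<sigma> (Suc n)) (Suc (K + Suc (n * Suc K))) (\<sigma> 0)"
    using Suc.prems assms(1) by (intro runs_While_loop) auto
  then show ?case by (rule runs_mono) simp
qed

definition clear :: "nat \<Rightarrow> com" where
  "clear j = While j 1 (Dec j)"

lemma runs_clear: "j > 0 \<Longrightarrow> runs x (clear j) (s, o') (Suc (2 * s j)) (s(j := 0), o')"
  unfolding clear_def
  using runs_counter_loop[of j "s j" x "Dec j" "\<lambda>i. (s(j := i), o')" 1] runs_Dec[of "s(j := Suc i)" j i x o' for i]
  by (simp add: mult_2 mult_2_right)

definition transfer :: "nat \<Rightarrow> nat \<Rightarrow> com" where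
  "transfer j i = While j 1 (Dec j ;; Inc i)"

lemma runs_transfer:
  assumes "j > 0" "i \<noteq> j"
  shows "runs x (transfer j i) (s, o') (Suc (4 * s j)) (s(i := s i + s j, j := 0), o')"
proof -
  let ?\<sigma> = "\<lambda>n. (s(i := s i + (s j - n), j := n), o')"
  have "runs x (Dec j ;; Inc i) (?\<sigma> (Suc n)) (Suc (1 + 1)) (?\<sigma> n)" if "n < s j" for n
  proof (rule runs_Seq)
    show "runs x (Dec j) (?\<sigma> (Suc n)) 1 ((s(i := s i + (s j - Suc n), j := Suc n))(j := n), o')"
      by (rule runs_Dec) simp
    have "?\<sigma> n = ((s(i := s i + (s j - Suc n), j := Suc n, j := n))(i := s i + (s j - n)), o')"
      using assms by (auto simp: fun_eq_iff)
    then show "runs x (Inc i) ((s(i := s i + (s j - Suc n), j := Suc n))(j := n), o') 1 (?\<sigma> n)"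
      using that assms by (simp only:) (rule runs_Inc, auto)
  qed
  from runs_counter_loop[of j "s j" x _ ?\<sigma>, OF assms(1) this]
  show ?thesis by (simp add: transfer_def eval_nat_numeral algebra_simps)
qed

definition transfer2 :: "nat \<Rightarrow> nat \<Rightarrow> nat \<Rightarrow> com" where
  "transfer2 j i b = While j 1 (Dec j ;; Inc i ;; Inc b)"

lemma runs_transfer2:
  assumes "j > 0" "distinct [i, j, b]"
  shows "runs x (transfer2 j i b) (s, o') (Suc (6 * s j)) (s(i := s i + s j, b := s b + s j, j := 0), o')"
proof -
  let ?\<sigma> = "\<lambda>n. (s(i := s i + (s j - n), b := s b + (s j - n), j := n), o')"
  have "runs x (Dec j ;; Inc i ;; Inc b) (?\<sigma> (Suc n)) (Suc (1 + Suc (1 + 1))) (?\<sigma> n)" if "n < s j" for n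
  proof -
    let ?s = "s(i := s i + (s j - n), b := s b + (s j - Suc n), j := n)"
    let ?s1 = "s(i := s i + (s j - Suc n), b := s b + (s j - Suc n), j := n)"
    have 1: "?s = ?s1(i := s i + (s j - n))" using assms by (auto simp: fun_eq_iff)
    have 2: "?\<sigma> n = (?s(b := s b + (s j - n)), o')" using assms by (auto simp: fun_eq_iff)
    have i: "runs x (Inc i ;; Inc b) (?s1, o') (Suc (1 + 1)) (?\<sigma> n)"
    proof (rule runs_Seq)
      show "runs x (Inc i) (?s1, o') 1 (?s, o')"
        using that assms unfolding 1 by (intro runs_Inc) auto
      show "runs x (Inc b) (?s, o') 1 (?\<sigma> n)"
        using that assms unfolding 2 by (intro runs_Inc) auto
    qed
    have "runs x (Dec j) (?\<sigma> (Suc n)) 1 (?s1, o')"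
      using runs_Dec[of "fst (?\<sigma> (Suc n))" j n x o'] by simp
    from runs_Seq[OF this i] show ?thesis .
  qed
  from runs_counter_loop[of j "s j" x _ ?\<sigma>, OF assms(1) this] assms(2)
  show ?thesis by (simp add: transfer2_def eval_nat_numeral algebra_simps)
qed

text \<open>Reading a counter destroys it. It is therefore moved to two places at once, and the
  scratch copy \<open>b\<close> is moved back.\<close>

definition copy :: "nat \<Rightarrow> nat \<Rightarrow> nat \<Rightarrow> com" where
  "copy j i b = transfer2 j i b ;; transfer b j"

lemma runs_copy:
  assumes "j > 0" "b > 0" "distinct [i, j, b]" "s b = 0"
  shows "runs x (copy j i b) (s, o') (10 * s j + 3) (s(i := s i + s j), o')"
proof -
  let ?s = "s(i := s i + s j, b := s b + s j, j := 0)"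
  have "?s(j := ?s j + ?s b, b := 0) = s(i := s i + s j)"
    using assms by (auto simp: fun_eq_iff)
  then have "runs x (transfer b j) (?s, o') (Suc (4 * ?s b)) (s(i := s i + s j), o')"
    using runs_transfer[of b j x ?s o'] assms by simp
  from runs_Seq[OF runs_transfer2[OF assms(1,3)] this]
  have "runs x (copy j i b) (s, o') (Suc (Suc (6 * s j) + Suc (4 * ?s b))) (s(i := s i + s j), o')"
    unfolding copy_def .
  then show ?thesis by (rule runs_mono) (use assms in simp)
qed

text \<open>The start of the input carries no marker, so the head can only be brought back by a
  counter that has recorded its position.\<close>

definition rewind :: "nat \<Rightarrow> com" where
  "rewind j = While j 1 (Dec j ;; Dec 0)"

lemma runs_rewind:
  assumes "j > 0" "s 0 = s j"
  shows "runs x (rewind j) (s, o') (Suc (4 * s j)) (s(0 := 0, j := 0), o')"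
proof -
  let ?\<sigma> = "\<lambda>n. (s(0 := n, j := n), o')"
  have "runs x (Dec j ;; Dec 0) (?\<sigma> (Suc n)) (Suc (1 + 1)) (?\<sigma> n)" for n
  proof (rule runs_Seq)
    show "runs x (Dec j) (?\<sigma> (Suc n)) 1 (s(0 := Suc n, j := n), o')"
      using runs_Dec[of "s(0 := Suc n, j := Suc n)" j n] by simp
    have "s(0 := n, j := n) = (s(0 := Suc n, j := n))(0 := n)" using assms by (auto simp: fun_eq_iff)
    then show "runs x (Dec 0) (s(0 := Suc n, j := n), o') 1 (?\<sigma> n)"
      using assms runs_Dec[of "s(0 := Suc n, j := n)" 0 n x o'] by simp
  qed
  moreover have "s(0 := s j, j := s j) = s" using assms by (auto simp: fun_eq_iff)
  ultimately show ?thesis using runs_counter_loop[of j "s j" x "Dec j ;; Dec 0" ?\<sigma> "Suc (1 + 1)", OF assms(1)]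
    by (simp add: rewind_def eval_nat_numeral algebra_simps)
qed

section \<open>Tuples of unary numbers and polynomial bounds\<close>

text \<open>The values of such a type are tuples of numbers whose arity depends on the type only.
  Nested pairs serve as environments in which a bound variable is appended on the right.\<close>

class env =
  fixes regs :: "'a \<Rightarrow> nat list"
  assumes length_regs: "length (regs a) = length (regs b)"

instantiation unit :: env begin
definition "regs (u :: unit) = []"
instance by standard (simp add: regs_unit_def)
end

instantiation nat :: env begin
definition "regs (n :: nat) = [n]"
instance by standard (simp add: regs_nat_def)
end

instantiation prod :: (env, env) env begin
definition "regs p = regs (fst p) @ regs (snd p)"
instance by standard (metis length_append length_regs regs_prod_def)
end

lemma regs_pair [simp]: "regs (a, b) = regs a @ regs b"
  by (simp add: regs_prod_def)

lemma regs_nat [simp]: "regs (n :: nat) = [n]"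
  by (simp add: regs_nat_def)

lemma regs_unit [simp]: "regs (u :: unit) = []"
  by (simp add: regs_unit_def)

definition input_size :: "bool list \<Rightarrow> 'e::env \<Rightarrow> nat" where
  "input_size x e = length x + sum_list (regs e)"

definition poly_bounded :: "(bool list \<Rightarrow> 'e::env \<Rightarrow> nat) \<Rightarrow> bool" where
  "poly_bounded T \<longleftrightarrow> (\<exists>p :: nat poly. \<forall>x e. T x e \<le> poly p (input_size x e))"

lemma poly_bounded_le: "poly_bounded T \<Longrightarrow> (\<And>x e. S x e \<le> T x e) \<Longrightarrow> poly_bounded S"
  unfolding poly_bounded_def by (meson order_trans)

lemma poly_bounded_const: "poly_bounded (\<lambda>x e. c)"
  unfolding poly_bounded_def by (rule exI[of _ "[:c:]"]) simp

lemma poly_bounded_size: "poly_bounded input_size"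
  unfolding poly_bounded_def by (rule exI[of _ "[:0, 1:]"]) simp

lemma poly_bounded_add:
  assumes "poly_bounded S" "poly_bounded T"
  shows "poly_bounded (\<lambda>x e. S x e + T x e)"
proof -
  from assms obtain p q where "\<And>x e. S x e \<le> poly p (input_size x e)" "\<And>x e. T x e \<le> poly q (input_size x e)"
    by (metis poly_bounded_def)
  then show ?thesis unfolding poly_bounded_def by (intro exI[of _ "p + q"]) (simp add: add_mono)
qed

lemma poly_bounded_mult:
  assumes "poly_bounded S" "poly_bounded T"
  shows "poly_bounded (\<lambda>x e. S x e * T x e)"
proof -
  from assms obtain p q where "\<And>x e. S x e \<le> poly p (input_size x e)" "\<And>x e. T x e \<le> poly q (input_size x e)"
    by (metis poly_bounded_def)
  then show ?thesis unfolding poly_bounded_def by (intro exI[of _ "p * q"]) (simp add: mult_mono)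
qed

lemma poly_bounded_Suc: "poly_bounded T \<Longrightarrow> poly_bounded (\<lambda>x e. Suc (T x e))"
  using poly_bounded_add[OF _ poly_bounded_const[of 1], of T] by simp

lemma poly_bounded_comp:
  assumes "poly_bounded T" "poly_bounded G" "\<And>x e. input_size x (g x e) \<le> G x e"
  shows "poly_bounded (\<lambda>x e. T x (g x e))"
proof -
  from assms(1,2) obtain p q where p: "\<And>x e. T x e \<le> poly p (input_size x e)"
    and q: "\<And>x e. G x e \<le> poly q (input_size x e)"
    by (metis poly_bounded_def)
  have "T x (g x e) \<le> poly (pcompose p q) (input_size x e)" for x e
  proof -
    have "T x (g x e) \<le> poly p (input_size x (g x e))" by (rule p)
    also have "\<dots> \<le> poly p (poly q (input_size x e))"
      by (rule poly_nat_mono) (rule order_trans[OF assms(3) q])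
    finally show ?thesis by (simp add: poly_pcompose)
  qed
  then show ?thesis unfolding poly_bounded_def by blast
qed

lemma poly_bounded_pair:
  assumes "poly_bounded T" "poly_bounded F"
  shows "poly_bounded (\<lambda>x e. T x (e, F x e :: nat))"
  using assms(1) poly_bounded_add[OF poly_bounded_size assms(2)]
  by (rule poly_bounded_comp) (simp add: input_size_def)

section \<open>Functions of unary numbers in polynomial time\<close>

text \<open>
  Polynomial time with respect to \<^emph>\<open>unary\<close> arguments and values; the string \<open>x\<close> is an additional
  argument that is available bit by bit.
\<close>

definition implements :: "(nat list \<Rightarrow> nat \<Rightarrow> com) \<Rightarrow> (bool list \<Rightarrow> 'e::env \<Rightarrow> nat) \<Rightarrow> (bool list \<Rightarrow> 'e \<Rightarrow> nat) \<Rightarrow> bool" where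
  "implements C T F \<longleftrightarrow> (\<forall>as D x e s o'. map s as = regs e \<and> (\<forall>a \<in> set as. 0 < a \<and> a \<le> D) \<and> (\<forall>j>D. s j = 0) \<and> s 0 = 0 \<longrightarrow>
     runs x (C as D) (s, o') (T x e) (s(Suc D := F x e), o'))"

text \<open>The value needs a polynomial bound of its own, since it becomes an argument, measured in
  unary, of the next function.\<close>

definition pf :: "(bool list \<Rightarrow> 'e::env \<Rightarrow> nat) \<Rightarrow> bool" where
  "pf F \<longleftrightarrow> poly_bounded F \<and> (\<exists>C T. poly_bounded T \<and> implements C T F)"

text \<open>The calling convention makes programs composable: registers above \<open>D\<close> are
  free and zero, the head of the input is at its start, and apart from the result in
  \<open>Suc D\<close> everything is restored. A nested call uses a larger \<open>D\<close>.\<close>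

lemma implementsI:
  assumes "\<And>as D x e s o'. \<lbrakk>map s as = regs e; \<And>a. a \<in> set as \<Longrightarrow> 0 < a \<and> a \<le> D; \<And>j. j > D \<Longrightarrow> s j = 0; s 0 = 0\<rbrakk>
    \<Longrightarrow> runs x (C as D) (s, o') (T x e) (s(Suc D := F x e), o')"
  shows "implements C T F"
  unfolding implements_def by (intro allI impI, elim conjE, rule assms) auto

lemma implementsD:
  assumes "implements C T F" "map s as = regs e" "\<And>a. a \<in> set as \<Longrightarrow> 0 < a \<and> a \<le> D" "\<And>j. j > D \<Longrightarrow> s j = 0" "s 0 = 0"
  shows "runs x (C as D) (s, o') (T x e) (s(Suc D := F x e), o')"
  by (rule assms(1)[unfolded implements_def, rule_format]) (use assms(2-) in simp)

lemma pfI: "poly_bounded F \<Longrightarrow> poly_bounded T \<Longrightarrow> implements C T F \<Longrightarrow> pf F"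
  unfolding pf_def by blast

lemma pfE:
  assumes "pf F"
  obtains C T where "poly_bounded F" "poly_bounded T" "implements C T F"
  using assms unfolding pf_def by blast

lemma pf_bounded: "pf F \<Longrightarrow> poly_bounded F"
  by (simp add: pf_def)

text \<open>Selection and rearrangement of registers at positions that do not depend on their
  values. It accounts for a change of environment at no cost in time, since only the register names
  in the program change.\<close>

definition proj :: "('e::env \<Rightarrow> 'f::env) \<Rightarrow> bool" where
  "proj g \<longleftrightarrow> (\<exists>ks. \<forall>e. regs (g e) = map ((!) (regs e)) ks \<and> (\<forall>i \<in> set ks. i < length (regs e)))"

lemma regs_arity:
  obtains n where "\<And>a :: 'a::env. length (regs a) = n"
  using length_regs by blast

lemma proj_id: "proj (\<lambda>e :: 'a::env. e)"
proof -
  obtain n where n: "\<And>a :: 'a. length (regs a) = n" using regs_arity by blast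
  have "regs e = map ((!) (regs e)) [0..<n]" for e :: 'a using map_nth[of "regs e"] by (simp add: n)
  then show ?thesis unfolding proj_def by (intro exI[of _ "[0..<n]"]) (simp add: n)
qed

lemma proj_comp:
  assumes "proj f" "proj g"
  shows "proj (\<lambda>e. f (g e))"
proof -
  from assms obtain fs gs where f: "\<And>e. regs (f e) = map ((!) (regs e)) fs \<and> (\<forall>i \<in> set fs. i < length (regs e))"
    and g: "\<And>e. regs (g e) = map ((!) (regs e)) gs \<and> (\<forall>i \<in> set gs. i < length (regs e))"
    unfolding proj_def by metis
  have "i < length gs" if "i \<in> set fs" for i
  proof -
    have "length (regs (g undefined)) = length gs" using g[of undefined] by simp
    then show ?thesis using f[of "g undefined"] that by simp
  qed
  then show ?thesis unfolding proj_def
    using f g by (intro exI[of _ "map ((!) gs) fs"]) auto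
qed

lemma proj_fst:
  fixes g :: "'c::env \<Rightarrow> 'a::env \<times> 'b::env"
  assumes "proj g"
  shows "proj (\<lambda>e. fst (g e))"
proof -
  obtain n where n: "\<And>a :: 'a. length (regs a) = n" using regs_arity by blast
  have "proj (fst :: 'a \<times> 'b \<Rightarrow> 'a)" unfolding proj_def
    by (intro exI[of _ "[0..<n]"]) (auto simp: n nth_append intro!: nth_equalityI)
  then show ?thesis using assms by (rule proj_comp)
qed

lemma proj_snd:
  fixes g :: "'c::env \<Rightarrow> 'a::env \<times> 'b::env"
  assumes "proj g"
  shows "proj (\<lambda>e. snd (g e))"
proof -
  obtain n where n: "\<And>a :: 'a. length (regs a) = n" using regs_arity by blast
  obtain m where m: "\<And>b :: 'b. length (regs b) = m" using regs_arity by blast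
  have "proj (snd :: 'a \<times> 'b \<Rightarrow> 'b)" unfolding proj_def
    by (intro exI[of _ "map ((+) n) [0..<m]"]) (auto simp: n m nth_append intro!: nth_equalityI)
  then show ?thesis using assms by (rule proj_comp)
qed

lemma pf_weaken:
  assumes "pf F" "proj g"
  shows "pf (\<lambda>x e. F x (g e))"
proof -
  from assms(1) obtain C T where F: "poly_bounded F" and T: "poly_bounded T" and C: "implements C T F" by (rule pfE)
  from assms(2) obtain ks where
    ks0: "\<forall>e. regs (g e) = map ((!) (regs e)) ks \<and> (\<forall>i \<in> set ks. i < length (regs e))"
    unfolding proj_def by (rule exE)
  have ks: "regs (g e) = map ((!) (regs e)) ks" "i \<in> set ks \<Longrightarrow> i < length (regs e)" for e i
    using ks0[rule_format, of e] by simp_all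
  have size0: "sum_list (regs (g e)) \<le> length ks * sum_list (regs e)" for e
  proof -
    have "sum_list (map ((!) (regs e)) ks) \<le> sum_list (map (\<lambda>_. sum_list (regs e)) ks)"
      by (intro sum_list_mono member_le_sum_list nth_mem ks(2) zero_le)
    then show ?thesis unfolding ks(1) by (simp add: sum_list_triv)
  qed
  have size: "input_size x (g e) \<le> Suc (length ks) * input_size x e" for x e
  proof -
    have "input_size x (g e) \<le> length x + length ks * sum_list (regs e)"
      using size0 by (simp add: input_size_def)
    also have "\<dots> \<le> Suc (length ks) * input_size x e"
      unfolding input_size_def mult_Suc distrib_left by simp
    finally show ?thesis .
  qed
  have b: "poly_bounded (\<lambda>x e. Suc (length ks) * input_size x e)"
    by (intro poly_bounded_mult poly_bounded_const poly_bounded_size)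
  have "implements (\<lambda>as D. C (map ((!) as) ks) D) (\<lambda>x e. T x (g e)) (\<lambda>x e. F x (g e))"
  proof (rule implementsI)
    fix as :: "nat list" and D x and e :: 'b and s :: "nat \<Rightarrow> nat" and o'
    assume as: "map s as = regs e" "\<And>a. a \<in> set as \<Longrightarrow> 0 < a \<and> a \<le> D"
    have l: "length as = length (regs e)" unfolding as(1)[symmetric] by simp
    assume z: "\<And>j. j > D \<Longrightarrow> s j = 0" "s 0 = 0"
    have "s (as ! i) = regs e ! i" if "i \<in> set ks" for i
    proof -
      have "i < length as" using ks(2)[OF that, of e] l by simp
      then show ?thesis unfolding as(1)[symmetric] by simp
    qed
    then have m: "map s (map ((!) as) ks) = regs (g e)" unfolding ks(1) by simp
    have le: "0 < a \<and> a \<le> D" if a: "a \<in> set (map ((!) as) ks)" for a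
    proof -
      from a obtain i where i: "i \<in> set ks" "a = as ! i" by auto
      with ks(2)[of i e] l show ?thesis using as(2)[of a] by simp
    qed
    show "runs x (C (map ((!) as) ks) D) (s, o') (T x (g e)) (s(Suc D := F x (g e)), o')"
      by (rule implementsD[OF C m le z])
  qed
  moreover have "poly_bounded (\<lambda>x e. F x (g e))" by (rule poly_bounded_comp[OF F b size])
  moreover have "poly_bounded (\<lambda>x e. T x (g e))" by (rule poly_bounded_comp[OF T b size])
  ultimately show ?thesis by (intro pfI)
qed

lemma pf_identity: "pf (\<lambda>x (n::nat). n)"
proof (rule pfI)
  have "poly_bounded (\<lambda>x (n::nat). input_size x n)" by (rule poly_bounded_size)
  then show b: "poly_bounded (\<lambda>x (n::nat). n)" by (rule poly_bounded_le) (simp add: input_size_def)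
  show "poly_bounded (\<lambda>x (n::nat). 10 * n + 3)"
    by (intro poly_bounded_add poly_bounded_mult poly_bounded_const b)
  show "implements (\<lambda>as D. copy (hd as) (Suc D) (Suc (Suc D))) (\<lambda>x (n::nat). 10 * n + 3) (\<lambda>x n. n)"
  proof (rule implementsI)
    fix as :: "nat list" and D x and s :: "nat \<Rightarrow> nat" and o' and n :: nat
    assume as: "map s as = regs n" "\<And>a. a \<in> set as \<Longrightarrow> 0 < a \<and> a \<le> D" and z: "\<And>j. j > D \<Longrightarrow> s j = 0"
    then obtain a where "as = [a]" "s a = n" by auto
    then show "runs x (copy (hd as) (Suc D) (Suc (Suc D))) (s, o') (10 * n + 3) (s(Suc D := n), o')"
      using runs_copy[of a "Suc (Suc D)" "Suc D" s x o'] z[of "Suc D"] z[of "Suc (Suc D)"] as(2) by auto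
  qed
qed

lemma pf_var: "proj g \<Longrightarrow> pf (\<lambda>x e. g e :: nat)"
  by (rule pf_weaken[OF pf_identity])

lemma pf_const: "pf (\<lambda>x e. c)"
proof (rule pfI)
  \<comment> \<open>There is no empty command; clearing a register that is 0 already closes the
    chain of increments.\<close>
  show "implements (\<lambda>as D. ((;;) (Inc (Suc D)) ^^ c) (clear (Suc (Suc D)))) (\<lambda>x e. 2 * c + 1) (\<lambda>x e. c)"
  proof (rule implementsI)
    fix D x and s :: "nat \<Rightarrow> nat" and o' assume z: "\<And>j. j > D \<Longrightarrow> s j = (0::nat)"
    have "runs x (((;;) (Inc (Suc D)) ^^ c) (clear (Suc (Suc D)))) (s, o') (2 * c + 1) (s(Suc D := s (Suc D) + c), o')"
      if "s (Suc (Suc D)) = 0" for s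
      using that
    proof (induct c arbitrary: s)
      case 0
      then show ?case using runs_clear[of "Suc (Suc D)" x s o'] by (simp add: fun_upd_idem)
    next
      case (Suc c)
      have inc: "runs x (Inc (Suc D)) (s, o') 1 (s(Suc D := Suc (s (Suc D))), o')" by (rule runs_Inc) simp
      have e: "s(Suc D := s (Suc D) + Suc c) = (s(Suc D := Suc (s (Suc D))))(Suc D := (s(Suc D := Suc (s (Suc D)))) (Suc D) + c)"
        by simp
      have "runs x (Inc (Suc D) ;; ((;;) (Inc (Suc D)) ^^ c) (clear (Suc (Suc D)))) (s, o') (Suc (1 + (2 * c + 1)))
        (s(Suc D := s (Suc D) + Suc c), o')"
        unfolding e by (rule runs_Seq[OF inc], rule Suc.hyps) (simp add: Suc.prems)
      then show ?case by (simp add: fun_upd_def)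
    qed
    from this[of s] show "runs x (((;;) (Inc (Suc D)) ^^ c) (clear (Suc (Suc D)))) (s, o') (2 * c + 1) (s(Suc D := c), o')"
      using z by simp
  qed
qed (rule poly_bounded_const)+

lemma pf_Suc:
  assumes "pf F"
  shows "pf (\<lambda>x e. Suc (F x e))"
proof -
  from assms obtain C T where F: "poly_bounded F" and T: "poly_bounded T" and C: "implements C T F" by (rule pfE)
  have "implements (\<lambda>as D. C as D ;; Inc (Suc D)) (\<lambda>x e. Suc (T x e + 1)) (\<lambda>x e. Suc (F x e))"
  proof (rule implementsI)
    fix as :: "nat list" and D x and s :: "nat \<Rightarrow> nat" and o' and e :: 'a
    assume "map s as = regs e" "\<And>a. a \<in> set as \<Longrightarrow> 0 < a \<and> a \<le> D" "\<And>j. j > D \<Longrightarrow> s j = 0" "s 0 = 0"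
    from runs_Seq[OF implementsD[OF C this, of x o'] runs_Inc[of "Suc (F x e)" "s(Suc D := F x e)" "Suc D"]]
    show "runs x (C as D ;; Inc (Suc D)) (s, o') (Suc (T x e + 1)) (s(Suc D := Suc (F x e)), o')"
      by simp
  qed
  then show ?thesis by (rule pfI[rotated 2]) (intro poly_bounded_Suc poly_bounded_add poly_bounded_const F T)+
qed

text \<open>The value of \<open>G\<close> becomes the last register of the environment of
  \<open>H\<close>. Afterwards it is erased, and the result moves down to the place that the calling
  convention requires.\<close>

lemma pf_let:
  assumes "pf (\<lambda>x p. H x (fst p) (snd p))" "pf G"
  shows "pf (\<lambda>x e. H x e (G x e))"
proof -
  let ?H = "\<lambda>x p. H x (fst p) (snd p)"
  from assms(1) obtain C T where H: "poly_bounded ?H" and T: "poly_bounded T" and C: "implements C T ?H" by (rule pfE)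
  from assms(2) obtain C' T' where G: "poly_bounded G" and T': "poly_bounded T'" and C': "implements C' T' G" by (rule pfE)
  note b = poly_bounded_pair[OF H G, simplified]
  let ?C = "\<lambda>as D. C' as D ;; C (as @ [Suc D]) (Suc D) ;; clear (Suc D) ;; transfer (Suc (Suc D)) (Suc D)"
  let ?T = "\<lambda>x e. Suc (T' x e + Suc (T x (e, G x e) + Suc (Suc (2 * G x e) + Suc (4 * H x e (G x e)))))"
  have "poly_bounded ?T"
    by (intro poly_bounded_Suc poly_bounded_add poly_bounded_mult poly_bounded_const b G T' poly_bounded_pair[OF T G])
  moreover have "implements ?C ?T (\<lambda>x e. H x e (G x e))"
  proof (rule implementsI)
    fix as :: "nat list" and D x and s :: "nat \<Rightarrow> nat" and o' and e :: 'a
    assume as: "map s as = regs e" "\<And>a. a \<in> set as \<Longrightarrow> 0 < a \<and> a \<le> D" and z: "\<And>j. j > D \<Longrightarrow> s j = 0" "s 0 = 0"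
    let ?s1 = "s(Suc D := G x e)" let ?s2 = "s(Suc D := G x e, Suc (Suc D) := H x e (G x e))"
    let ?s3 = "s(Suc (Suc D) := H x e (G x e))" let ?s4 = "s(Suc D := H x e (G x e))"
    note r1 = implementsD[OF C' as z, of x o']
    have D: "Suc D \<notin> set as" using as(2) by fastforce
    then have m: "map ?s1 (as @ [Suc D]) = regs (e, G x e)" using as(1) by simp
    have le: "0 < a \<and> a \<le> Suc D" if "a \<in> set (as @ [Suc D])" for a using that as(2)[of a] by auto
    have r2: "runs x (C (as @ [Suc D]) (Suc D)) (?s1, o') (T x (e, G x e)) (?s2, o')"
      using implementsD[OF C, of ?s1 "as @ [Suc D]" "(e, G x e)" "Suc D" x o', OF m le] z by simp
    have "?s2(Suc D := 0) = ?s3" using z by (auto simp: fun_eq_iff)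
    then have r3: "runs x (clear (Suc D)) (?s2, o') (Suc (2 * G x e)) (?s3, o')"
      using runs_clear[of "Suc D" x ?s2 o'] by simp
    have "?s3(Suc D := ?s3 (Suc D) + ?s3 (Suc (Suc D)), Suc (Suc D) := 0) = ?s4"
      using z by (auto simp: fun_eq_iff)
    then have r4: "runs x (transfer (Suc (Suc D)) (Suc D)) (?s3, o') (Suc (4 * H x e (G x e))) (?s4, o')"
      using runs_transfer[of "Suc (Suc D)" "Suc D" x ?s3 o'] by simp
    show "runs x (?C as D) (s, o') (?T x e) (?s4, o')"
      by (intro runs_Seq[OF r1 runs_Seq[OF r2 runs_Seq[OF r3 r4]]])
  qed
  ultimately show ?thesis using b by (intro pfI)
qed

text \<open>\<open>foldr\<close> over an increasing list begins with the last index, so the loop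
  counter, which runs down, is itself the index. The bound \<open>B\<close> on all intermediate
  values is essential: polynomial growth in each single round could still accumulate to exponential
  growth.\<close>

lemma pf_foldr:
  assumes N: "pf N" and Z: "pf Z" and S: "pf (\<lambda>x p. S x (fst (fst p)) (snd (fst p)) (snd p))"
    and B: "poly_bounded B" "\<And>x e j. j \<le> N x e \<Longrightarrow> foldr (S x e) [j..<N x e] (Z x e) \<le> B x e"
  shows "pf (\<lambda>x e. foldr (S x e) [0..<N x e] (Z x e))"
proof -
  let ?S = "\<lambda>x p. S x (fst (fst p)) (snd (fst p)) (snd p)"
  from N obtain CN TN where N: "poly_bounded N" and TN: "poly_bounded TN" and CN: "implements CN TN N" by (rule pfE)
  from Z obtain CZ TZ where Z: "poly_bounded Z" and TZ: "poly_bounded TZ" and CZ: "implements CZ TZ Z" by (rule pfE)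
  from S obtain CS TS where TS: "poly_bounded TS" and CS: "implements CS TS ?S" by (rule pfE)
  from TS obtain p where p: "\<And>x e. TS x e \<le> poly p (input_size x e)" by (metis poly_bounded_def)
  define R where "R x e j = foldr (S x e) [j..<N x e] (Z x e)" for x e j
  \<comment> \<open>One time bound for all rounds: the index stays below \<open>N x e\<close> and
    the accumulator never exceeds \<open>B x e\<close>.\<close>
  define K where "K x e = poly p (input_size x e + N x e + B x e)" for x e
  have K: "poly_bounded K"
  proof -
    have "poly_bounded (\<lambda>x (n::nat). poly p n)"
      unfolding poly_bounded_def by (rule exI[of _ p]) (auto simp: input_size_def intro: poly_nat_mono)
    then have "poly_bounded (\<lambda>x e. poly p (input_size x e + N x e + B x e))"
    proof (rule poly_bounded_comp)
      show "poly_bounded (\<lambda>x e. input_size x e + (input_size x e + N x e + B x e))"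
        by (intro poly_bounded_add poly_bounded_size N B)
    qed (simp add: input_size_def)
    then show ?thesis by (simp add: K_def[abs_def])
  qed
  let ?K = "\<lambda>x e. Suc (1 + Suc (K x e + Suc (Suc (2 * B x e) + Suc (4 * B x e))))"
  let ?body = "\<lambda>as D. Dec (Suc D) ;; CS (as @ [Suc D, Suc (Suc D)]) (Suc (Suc D)) ;; clear (Suc (Suc D)) ;;
    transfer (Suc (Suc (Suc D))) (Suc (Suc D))"
  let ?C = "\<lambda>as D. CN as D ;; CZ as (Suc D) ;; While (Suc D) 1 (?body as D) ;; transfer (Suc (Suc D)) (Suc D)"
  let ?T = "\<lambda>x e. Suc (TN x e + Suc (TZ x e + Suc (Suc (N x e * Suc (?K x e)) + Suc (4 * B x e))))"
  have "poly_bounded ?T"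
    by (intro poly_bounded_Suc poly_bounded_add poly_bounded_mult poly_bounded_const N TN TZ K B)
  moreover have "implements ?C ?T (\<lambda>x e. R x e 0)"
  proof (rule implementsI)
    fix as :: "nat list" and D x and s :: "nat \<Rightarrow> nat" and o' and e :: 'a
    assume as: "map s as = regs e" "\<And>a. a \<in> set as \<Longrightarrow> 0 < a \<and> a \<le> D" and z: "\<And>j. j > D \<Longrightarrow> s j = 0" "s 0 = 0"
    have D: "Suc D \<notin> set as" "Suc (Suc D) \<notin> set as" using as(2) by fastforce+
    let ?s = "\<lambda>j. s(Suc D := j, Suc (Suc D) := R x e j)"
    note r1 = implementsD[OF CN as z, of x o']
    have r2: "runs x (CZ as (Suc D)) (s(Suc D := N x e), o') (TZ x e) (?s (N x e), o')"
    proof -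
      have "map (s(Suc D := N x e)) as = regs e" using as(1) D by simp
      then show ?thesis using implementsD[OF CZ, of "s(Suc D := N x e)" as e "Suc D" x o'] as(2) z
        by (simp add: R_def le_SucI)
    qed
    have r3: "runs x (While (Suc D) 1 (?body as D)) (?s (N x e), o') (Suc (N x e * Suc (?K x e))) (?s 0, o')"
    proof (rule runs_counter_loop)
      fix j assume j: "j < N x e"
      then have R: "R x e j = S x e j (R x e (Suc j))" by (simp add: R_def upt_conv_Cons)
      have le: "R x e i \<le> B x e" if "i \<le> N x e" for i using B(2) that by (simp add: R_def)
      let ?s1 = "s(Suc D := j, Suc (Suc D) := R x e (Suc j))"
      let ?s2 = "s(Suc D := j, Suc (Suc D) := R x e (Suc j), Suc (Suc (Suc D)) := R x e j)"
      let ?s3 = "s(Suc D := j, Suc (Suc (Suc D)) := R x e j)"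
      have "?s1 = (?s (Suc j))(Suc D := j)" by (auto simp: fun_eq_iff)
      then have r1: "runs x (Dec (Suc D)) (?s (Suc j), o') 1 (?s1, o')"
        using runs_Dec[of "?s (Suc j)" "Suc D" j x o'] by simp
      have r2: "runs x (CS (as @ [Suc D, Suc (Suc D)]) (Suc (Suc D))) (?s1, o') (K x e) (?s2, o')"
      proof (rule runs_mono)
        have m: "map ?s1 (as @ [Suc D, Suc (Suc D)]) = regs ((e, j), R x e (Suc j))" using as(1) D by simp
        have a: "0 < a \<and> a \<le> Suc (Suc D)" if "a \<in> set (as @ [Suc D, Suc (Suc D)])" for a
          using that as(2)[of a] by auto
        show "runs x (CS (as @ [Suc D, Suc (Suc D)]) (Suc (Suc D))) (?s1, o') (TS x ((e, j), R x e (Suc j))) (?s2, o')"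
          using implementsD[OF CS, of ?s1 "as @ [Suc D, Suc (Suc D)]" "((e, j), R x e (Suc j))" "Suc (Suc D)" x o', OF m a] z
          by (simp add: R)
        have "TS x ((e, j), R x e (Suc j)) \<le> poly p (input_size x ((e, j), R x e (Suc j)))" by (rule p)
        also have "\<dots> \<le> K x e"
          unfolding K_def by (rule poly_nat_mono) (use j le[of "Suc j"] in \<open>auto simp: input_size_def\<close>)
        finally show "TS x ((e, j), R x e (Suc j)) \<le> K x e" .
      qed
      have "?s2(Suc (Suc D) := 0) = ?s3" using z by (auto simp: fun_eq_iff)
      then have r3: "runs x (clear (Suc (Suc D))) (?s2, o') (Suc (2 * B x e)) (?s3, o')"
        using runs_clear[of "Suc (Suc D)" x ?s2 o'] le[of "Suc j"] j by (auto intro: runs_mono)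
      have "?s3(Suc (Suc D) := ?s3 (Suc (Suc D)) + ?s3 (Suc (Suc (Suc D))), Suc (Suc (Suc D)) := 0) = ?s j"
        using z by (auto simp: fun_eq_iff)
      then have r4: "runs x (transfer (Suc (Suc (Suc D))) (Suc (Suc D))) (?s3, o') (Suc (4 * B x e)) (?s j, o')"
        using runs_transfer[of "Suc (Suc (Suc D))" "Suc (Suc D)" x ?s3 o'] le[of j] j by (auto intro: runs_mono)
      show "runs x (?body as D) (?s (Suc j), o') (?K x e) (?s j, o')"
        by (intro runs_Seq[OF r1 runs_Seq[OF r2 runs_Seq[OF r3 r4]]])
    qed auto
    have "(?s 0)(Suc D := ?s 0 (Suc D) + ?s 0 (Suc (Suc D)), Suc (Suc D) := 0) = s(Suc D := R x e 0)"
      using z by (auto simp: fun_eq_iff)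
    then have r4: "runs x (transfer (Suc (Suc D)) (Suc D)) (?s 0, o') (Suc (4 * B x e)) (s(Suc D := R x e 0), o')"
      using runs_transfer[of "Suc (Suc D)" "Suc D" x "?s 0" o'] B(2)[of 0 x e] by (auto simp: R_def intro: runs_mono)
    show "runs x (?C as D) (s, o') (?T x e) (s(Suc D := R x e 0), o')"
      by (intro runs_Seq[OF r1 runs_Seq[OF r2 runs_Seq[OF r3 r4]]])
  qed
  moreover have "poly_bounded (\<lambda>x e. R x e 0)"
    by (rule poly_bounded_le[OF B(1)]) (simp add: R_def B(2))
  ultimately have "pf (\<lambda>x e. R x e 0)" by (intro pfI)
  then show ?thesis by (simp add: R_def)
qed

lemma bit_sym_eq_0: "bit_sym x i = 0 \<longleftrightarrow> length x \<le> i"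
  by (auto simp: bit_sym_def)

lemma pf_length: "pf (\<lambda>x e. length x)"
proof (rule pfI)
  show b: "poly_bounded (\<lambda>x e. length x)"
    by (rule poly_bounded_le[OF poly_bounded_size]) (simp add: input_size_def)
  let ?T = "\<lambda>x e. Suc (Suc (length x * 6) + Suc (4 * length x))"
  show "poly_bounded ?T"
    by (intro poly_bounded_Suc poly_bounded_add poly_bounded_mult poly_bounded_const b)
  \<comment> \<open>Two counters record the position of the head; one is the result, and the other
    is used up by \<open>rewind\<close>.\<close>
  let ?c = "\<lambda>D. Inc 0 ;; Inc (Suc D) ;; Inc (Suc (Suc D))"
  show "implements (\<lambda>as D. While 0 0 (?c D) ;; rewind (Suc (Suc D))) ?T (\<lambda>x e. length x)"
  proof (rule implementsI)
    fix D x and s :: "nat \<Rightarrow> nat" and o' assume z: "\<And>j. j > D \<Longrightarrow> s j = (0::nat)" "s 0 = 0"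
    let ?s = "\<lambda>i. s(0 := i, Suc D := i, Suc (Suc D) := i)"
    have body: "runs x (?c D) (?s i, o') (Suc (1 + Suc (1 + 1))) (?s (Suc i), o')" for i
    proof -
      have 1: "runs x (Inc 0) (?s i, o') 1 ((?s i)(0 := Suc i), o')" by (rule runs_Inc) simp
      have 2: "runs x (Inc (Suc D)) ((?s i)(0 := Suc i), o') 1 ((?s i)(0 := Suc i, Suc D := Suc i), o')"
        by (rule runs_Inc) simp
      have 3: "runs x (Inc (Suc (Suc D))) ((?s i)(0 := Suc i, Suc D := Suc i), o') 1
        ((?s i)(0 := Suc i, Suc D := Suc i, Suc (Suc D) := Suc i), o')"
        by (rule runs_Inc) simp
      have "(?s i)(0 := Suc i, Suc D := Suc i, Suc (Suc D) := Suc i) = ?s (Suc i)" by (auto simp: fun_eq_iff)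
      with runs_Seq[OF 1 runs_Seq[OF 2 3]] show ?thesis by (simp only:)
    qed
    have "runs x (While 0 0 (?c D)) (?s i, o') (Suc ((length x - i) * 6)) (?s (length x), o')" if "i \<le> length x" for i
      using that
    proof (induct i rule: inc_induct)
      case base
      show ?case using runs_While_stop[of x 0 "(?s (length x), o')" 0] by (simp add: tape_sym_def bit_sym_def fun_upd_def)
    next
      case (step i)
      have "runs x (While 0 0 (?c D)) (?s i, o') (Suc (Suc (1 + Suc (1 + 1)) + Suc ((length x - Suc i) * 6))) (?s (length x), o')"
        by (rule runs_While_loop[OF _ body step(3)]) (use step(2) in \<open>simp add: tape_sym_def bit_sym_eq_0\<close>)
      then show ?case by (rule runs_mono) (use step(2) in simp)
    qed
    from this[of 0] have r1: "runs x (While 0 0 (?c D)) (s, o') (Suc (length x * 6)) (?s (length x), o')"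
      using z by (simp add: fun_upd_idem)
    have "(?s (length x))(0 := 0, Suc (Suc D) := 0) = s(Suc D := length x)" using z by (auto simp: fun_eq_iff)
    with runs_rewind[of "Suc (Suc D)" "?s (length x)" x o']
    have "runs x (rewind (Suc (Suc D))) (?s (length x), o') (Suc (4 * length x)) (s(Suc D := length x), o')" by simp
    from runs_Seq[OF r1 this]
    show "runs x (While 0 0 (?c D) ;; rewind (Suc (Suc D))) (s, o') (Suc (Suc (length x * 6) + Suc (4 * length x)))
      (s(Suc D := length x), o')" .
  qed
qed

text \<open>The head of the input is moved by \<open>n\<close> cells, a case distinction turns the
  symbol found there into the value of a counter, and a copy of \<open>n\<close> brings the head
  back. For a blank, \<open>clear\<close> acts on a register that is 0 and does nothing.\<close>

lemma pf_bit_sym_identity: "pf (\<lambda>x (n::nat). bit_sym x n)"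
proof (rule pfI)
  show "poly_bounded (\<lambda>x (n::nat). bit_sym x n)"
    by (rule poly_bounded_le[OF poly_bounded_const[of 2]]) (simp add: bit_sym_def)
  have b: "poly_bounded (\<lambda>x (n::nat). n)" using pf_identity by (rule pf_bounded)
  let ?T = "\<lambda>x n. Suc ((10 * n + 3) + Suc (Suc (6 * n) + Suc (Suc (Suc (Suc (1 + 1))) + Suc (4 * n))))"
  show "poly_bounded ?T"
    by (intro poly_bounded_Suc poly_bounded_add poly_bounded_mult poly_bounded_const b)
  let ?B = "\<lambda>D. Branch 0 0 (clear (Suc D)) (Branch 0 1 (Inc (Suc D)) (Inc (Suc D) ;; Inc (Suc D)))"
  let ?C = "\<lambda>as D. copy (hd as) (Suc D) (Suc (Suc D)) ;; transfer2 (Suc D) 0 (Suc (Suc D)) ;; ?B D ;; rewind (Suc (Suc D))"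
  show "implements ?C ?T (\<lambda>x n. bit_sym x n)"
  proof (rule implementsI)
    fix as :: "nat list" and D x and s :: "nat \<Rightarrow> nat" and o' and n :: nat
    assume as: "map s as = regs n" "\<And>a. a \<in> set as \<Longrightarrow> 0 < a \<and> a \<le> D" and z: "\<And>j. j > D \<Longrightarrow> s j = 0" "s 0 = 0"
    then obtain a where a: "as = [a]" "s a = n" by auto
    have r1: "runs x (copy (hd as) (Suc D) (Suc (Suc D))) (s, o') (10 * n + 3) (s(Suc D := n), o')"
      using runs_copy[of a "Suc (Suc D)" "Suc D" s x o'] z as(2) a by auto
    let ?s = "s(0 := n, Suc (Suc D) := n)"
    let ?s' = "s(0 := n, Suc (Suc D) := n, Suc D := bit_sym x n)"
    have "(s(Suc D := n))(0 := s 0 + n, Suc (Suc D) := s (Suc (Suc D)) + n, Suc D := 0) = ?s"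
      using z by (auto simp: fun_eq_iff)
    then have r2: "runs x (transfer2 (Suc D) 0 (Suc (Suc D))) (s(Suc D := n), o') (Suc (6 * n)) (?s, o')"
      using runs_transfer2[of "Suc D" 0 "Suc (Suc D)" x "s(Suc D := n)" o'] by simp
    have s0: "?s (Suc D) = 0" using z by simp
    have r3: "runs x (?B D) (?s, o') (Suc (Suc (Suc (1 + 1)))) (?s', o')"
    proof (intro runs_Branch)
      have c0: "runs x (clear (Suc D)) (?s, o') 1 (?s', o')" if "bit_sym x n = 0"
        using runs_clear[of "Suc D" x ?s o'] s0 that by simp
      have i1: "runs x (Inc (Suc D)) (?s, o') 1 (?s(Suc D := 1), o')" by (rule runs_Inc) (simp add: z)
      have c2: "runs x (Inc (Suc D) ;; Inc (Suc D)) (?s, o') (Suc (1 + 1)) (?s(Suc D := 1, Suc D := 2), o')"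
        by (rule runs_Seq[OF i1]) (rule runs_Inc, simp)
      have "bit_sym x n = 0 \<or> bit_sym x n = 1 \<or> bit_sym x n = 2" by (simp add: bit_sym_def)
      then show "if tape_sym x 0 (fst (?s, o') 0) = 0 then runs x (clear (Suc D)) (?s, o') (Suc (Suc (1 + 1))) (?s', o')
        else runs x (Branch 0 1 (Inc (Suc D)) (Inc (Suc D) ;; Inc (Suc D))) (?s, o') (Suc (Suc (1 + 1))) (?s', o')"
        using c0 i1 c2 by (auto simp: tape_sym_def intro!: runs_Branch intro: runs_mono)
    qed
    have "?s'(0 := 0, Suc (Suc D) := 0) = s(Suc D := bit_sym x n)" using z by (auto simp: fun_eq_iff)
    then have r4: "runs x (rewind (Suc (Suc D))) (?s', o') (Suc (4 * n)) (s(Suc D := bit_sym x n), o')"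
      using runs_rewind[of "Suc (Suc D)" ?s' x o'] by simp
    show "runs x (?C as D) (s, o') (?T x n) (s(Suc D := bit_sym x n), o')"
      by (intro runs_Seq[OF r1 runs_Seq[OF r2 runs_Seq[OF r3 r4]]])
  qed
qed

lemma proj_pair:
  assumes "proj g" "proj h"
  shows "proj (\<lambda>e. (g e, h e))"
proof -
  from assms obtain ks ls where "\<forall>e. regs (g e) = map ((!) (regs e)) ks \<and> (\<forall>i \<in> set ks. i < length (regs e))"
    "\<forall>e. regs (h e) = map ((!) (regs e)) ls \<and> (\<forall>i \<in> set ls. i < length (regs e))"
    unfolding proj_def by blast
  then show ?thesis unfolding proj_def by (intro exI[of _ "ks @ ls"]) auto
qed

section \<open>Closure under arithmetic, bounded quantifiers and bounded search\<close>

named_theorems pf_intros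

lemma pf_fst: "proj g \<Longrightarrow> pf (\<lambda>x e. fst (g e) :: nat)"
  by (rule pf_var, rule proj_fst)

lemma pf_snd: "proj g \<Longrightarrow> pf (\<lambda>x e. snd (g e) :: nat)"
  by (rule pf_var, rule proj_snd)

lemmas [pf_intros] = proj_id proj_fst proj_snd proj_pair pf_fst pf_snd pf_identity pf_const pf_Suc pf_length

lemma pf_comp1:
  assumes "pf (\<lambda>x (n::nat). f x n)" "pf F"
  shows "pf (\<lambda>x e. f x (F x e))"
  by (rule pf_let[OF pf_weaken[OF assms(1)] assms(2)]) (intro pf_intros)

lemma pf_comp2:
  assumes f: "pf (\<lambda>x p. f x (fst p) (snd p))" and F: "pf F" and G: "pf G"
  shows "pf (\<lambda>x (e :: 'e::env). f x (F x e) (G x e))"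
proof -
  have "pf (\<lambda>x (p :: ('e \<times> nat) \<times> nat). f x (fst (snd p, snd (fst p))) (snd (snd p, snd (fst p))))"
    by (rule pf_weaken[OF f]) (intro pf_intros)
  then have "pf (\<lambda>x (p :: ('e \<times> nat) \<times> nat). f x (snd p) (snd (fst p)))" by simp
  then have "pf (\<lambda>x (p :: 'e \<times> nat). f x (F x (fst p)) (snd p))"
    by (rule pf_let[of "\<lambda>x e v. f x v (snd e)"]) (rule pf_weaken[OF F], intro pf_intros)
  then show ?thesis by (rule pf_let[of "\<lambda>x e v. f x (F x e) v"]) (rule G)
qed

lemma poly_bounded_poly:
  assumes "poly_bounded G"
  shows "poly_bounded (\<lambda>x e. poly p (G x e))"
proof -
  from assms obtain q where "\<And>x e. G x e \<le> poly q (input_size x e)" by (auto simp: poly_bounded_def)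
  then have "poly p (G x e) \<le> poly (pcompose p q) (input_size x e)" for x e
    unfolding poly_pcompose by (rule poly_nat_mono)
  then show ?thesis unfolding poly_bounded_def by blast
qed

lemma pf_add [pf_intros]:
  assumes "pf F" "pf G"
  shows "pf (\<lambda>x e. F x e + G x e)"
proof -
  have eq: "foldr (\<lambda>i. Suc) [j..<n] a = a + (n - j)" for j n a :: nat
    by (induct "n - j" arbitrary: a j) (auto simp: upt_rec)
  have "pf (\<lambda>x e. foldr (\<lambda>i. Suc) [0..<G x e] (F x e))"
    by (rule pf_foldr[OF assms(2,1), of _ "\<lambda>x e. F x e + G x e"])
       (intro pf_intros poly_bounded_add pf_bounded assms | simp add: eq)+
  then show ?thesis by (simp add: eq)
qed

lemma pf_positive [pf_intros]:
  assumes "pf F"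
  shows "pf (\<lambda>x e. of_bool (0 < F x e))"
proof -
  have eq: "foldr (\<lambda>i a. 1) [j..<n] 0 = (of_bool (j < n) :: nat)" for j n :: nat
    by (auto simp: upt_conv_Cons)
  have "pf (\<lambda>x e. foldr (\<lambda>i a. 1) [0..<F x e] 0)"
    by (rule pf_foldr[OF assms, of _ _ "\<lambda>x e. 1"])
       (intro pf_intros poly_bounded_const | simp add: eq[unfolded One_nat_def])+
  then show ?thesis unfolding eq .
qed

text \<open>A conditional is a loop with at most one round, whose body ignores the
  accumulator.\<close>

lemma pf_If [pf_intros]:
  assumes P: "pf (\<lambda>x (e :: 'e::env). of_bool (P x e))" and "pf F" "pf G"
  shows "pf (\<lambda>x e. if P x e then F x e else G x e)"
proof -
  have "foldr (\<lambda>i a. c) [j..<n] d = (if j < n then c else d)" for j n :: nat and c d :: nat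
    by (auto simp: upt_conv_Cons)
  note eq = this
  have "pf (\<lambda>x e. foldr (\<lambda>i a. F x e) [0..<of_bool (P x e)] (G x e))"
  proof (rule pf_foldr[OF P assms(3), of _ "\<lambda>x e. F x e + G x e"])
    show "pf (\<lambda>x (p :: ('e \<times> nat) \<times> nat). F x (fst (fst p)))"
      by (rule pf_weaken[OF assms(2)]) (intro pf_intros)
  qed (auto simp: eq poly_bounded_add[OF pf_bounded[OF assms(2)] pf_bounded[OF assms(3)]])
  then show ?thesis by (simp add: eq)
qed

lemma pf_sum [pf_intros]:
  assumes N: "pf N" and S: "pf (\<lambda>x p. S x (fst p) (snd p))"
  shows "pf (\<lambda>x (e :: 'e::env). \<Sum>i<N x e. S x e i)"
proof -
  have eq: "j \<le> n \<Longrightarrow> foldr (\<lambda>i a. f i + a) [j..<n] 0 = (\<Sum>i=j..<n. f i)" for f and j n :: nat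
    by (induct rule: inc_induct) (auto simp: upt_conv_Cons sum.atLeast_Suc_lessThan)
  from pf_bounded[OF S] obtain p where p: "S x (fst e) (snd e) \<le> poly p (input_size x e)" for x e
    unfolding poly_bounded_def by blast
  have "pf (\<lambda>x e. foldr (\<lambda>i a. S x e i + a) [0..<N x e] 0)"
  proof (rule pf_foldr[OF N, of _ _ "\<lambda>x e. N x e * poly p (input_size x e + N x e)"])
    have "pf (\<lambda>x (p :: ('e \<times> nat) \<times> nat). S x (fst (fst p)) (snd (fst p)))"
      by (rule pf_weaken[OF S]) (intro pf_intros)
    then show "pf (\<lambda>x (p :: ('e \<times> nat) \<times> nat). S x (fst (fst p)) (snd (fst p)) + snd p)"
      by (intro pf_intros)
    show "poly_bounded (\<lambda>x e. N x e * poly p (input_size x e + N x e))"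
      by (intro poly_bounded_mult poly_bounded_poly poly_bounded_add poly_bounded_size pf_bounded N)
    fix x e j assume j: "j \<le> N x e"
    have "(\<Sum>i=j..<N x e. S x e i) \<le> (\<Sum>i=j..<N x e. poly p (input_size x e + N x e))"
    proof (rule sum_mono)
      fix i assume "i \<in> {j..<N x e}"
      then have "poly p (input_size x (e, i)) \<le> poly p (input_size x e + N x e)"
        by (intro poly_nat_mono) (auto simp: input_size_def)
      then show "S x e i \<le> poly p (input_size x e + N x e)" using p[of x "(e, i)"] by simp
    qed
    also have "\<dots> \<le> N x e * poly p (input_size x e + N x e)" by simp
    finally show "foldr (\<lambda>i a. S x e i + a) [j..<N x e] 0 \<le> N x e * poly p (input_size x e + N x e)"
      by (simp add: eq j)
  qed (rule pf_const)
  then show ?thesis by (simp add: eq lessThan_atLeast0)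
qed

lemma pf_mult [pf_intros]:
  assumes "pf F" "pf G"
  shows "pf (\<lambda>x e. F x e * G x e)"
proof -
  have "pf (\<lambda>x e. \<Sum>i<F x e. G x e)"
    by (rule pf_sum[OF assms(1)], rule pf_weaken[OF assms(2)]) (intro pf_intros)
  then show ?thesis by simp
qed

lemma pf_not [pf_intros]: "pf (\<lambda>x e. of_bool (P x e)) \<Longrightarrow> pf (\<lambda>x e. of_bool (\<not> P x e))"
proof -
  assume "pf (\<lambda>x e. of_bool (P x e))"
  then have "pf (\<lambda>x e. if P x e then 0 else 1)" by (intro pf_intros)
  moreover have "(if b then 0 else 1) = (of_bool (\<not> b) :: nat)" for b by simp
  ultimately show ?thesis by simp
qed

lemma pf_diff [pf_intros]:
  assumes "pf F" "pf G"
  shows "pf (\<lambda>x e. F x e - G x e)"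
proof -
  \<comment> \<open>The predecessor counts the positive numbers below \<open>n\<close>; truncated
    subtraction is its iteration.\<close>
  have pred: "(\<Sum>i<n. of_bool (0 < i)) = n - 1" for n :: nat by (induct n) auto
  have eq: "foldr (\<lambda>i a. a - 1) [j..<n] a = a - (n - j)" for j n a :: nat
    by (induct "n - j" arbitrary: a j) (auto simp: upt_rec)
  have "pf (\<lambda>x (p :: ('a \<times> nat) \<times> nat). \<Sum>i<snd p. of_bool (0 < i))"
    by (intro pf_intros)
  then have "pf (\<lambda>x e. foldr (\<lambda>i a. a - 1) [0..<G x e] (F x e))"
    by (intro pf_foldr[OF assms(2,1), of _ F]) (simp_all only: pred eq pf_bounded[OF assms(1)] diff_le_self)
  then show ?thesis by (simp only: eq minus_nat.diff_0)
qed

lemma pf_less [pf_intros]: "pf F \<Longrightarrow> pf G \<Longrightarrow> pf (\<lambda>x e. of_bool (F x e < G x e))"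
proof -
  assume "pf F" "pf G"
  then have "pf (\<lambda>x e. of_bool (0 < G x e - F x e))" by (intro pf_intros)
  then show ?thesis by simp
qed

lemma pf_le [pf_intros]: "pf F \<Longrightarrow> pf G \<Longrightarrow> pf (\<lambda>x e. of_bool (F x e \<le> G x e))"
  unfolding not_less[symmetric] by (intro pf_intros)

lemma pf_conj [pf_intros]:
  "pf (\<lambda>x e. of_bool (P x e)) \<Longrightarrow> pf (\<lambda>x e. of_bool (Q x e)) \<Longrightarrow> pf (\<lambda>x e. of_bool (P x e \<and> Q x e))"
  unfolding of_bool_conj by (intro pf_intros)

lemma pf_disj [pf_intros]:
  "pf (\<lambda>x e. of_bool (P x e)) \<Longrightarrow> pf (\<lambda>x e. of_bool (Q x e)) \<Longrightarrow> pf (\<lambda>x e. of_bool (P x e \<or> Q x e))"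
proof -
  assume "pf (\<lambda>x e. of_bool (P x e))" "pf (\<lambda>x e. of_bool (Q x e))"
  then have "pf (\<lambda>x e. of_bool (\<not> (\<not> P x e \<and> \<not> Q x e)))" by (intro pf_intros)
  then show ?thesis by simp
qed

lemma pf_imp [pf_intros]:
  "pf (\<lambda>x e. of_bool (P x e)) \<Longrightarrow> pf (\<lambda>x e. of_bool (Q x e)) \<Longrightarrow> pf (\<lambda>x e. of_bool (P x e \<longrightarrow> Q x e))"
  unfolding imp_conv_disj by (intro pf_intros)

lemma pf_if_bool [pf_intros]:
  "pf (\<lambda>x e. of_bool (P x e)) \<Longrightarrow> pf (\<lambda>x e. of_bool (Q x e)) \<Longrightarrow> pf (\<lambda>x e. of_bool (R x e)) \<Longrightarrow>
    pf (\<lambda>x e. of_bool (if P x e then Q x e else R x e))"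
  unfolding if_bool_eq_conj by (intro pf_intros)

lemma pf_eq [pf_intros]: "pf F \<Longrightarrow> pf G \<Longrightarrow> pf (\<lambda>x e. of_bool (F x e = G x e))"
  unfolding eq_iff by (intro pf_intros)

lemma pf_Ex [pf_intros]:
  "pf N \<Longrightarrow> pf (\<lambda>x p. of_bool (P x (fst p) (snd p))) \<Longrightarrow> pf (\<lambda>x e. of_bool (\<exists>i<N x e. P x e i))"
proof -
  assume "pf N" "pf (\<lambda>x p. of_bool (P x (fst p) (snd p)))"
  then have "pf (\<lambda>x e. of_bool (0 < (\<Sum>i<N x e. of_bool (P x e i) :: nat)))" by (intro pf_intros)
  moreover have "(0 < (\<Sum>i<n. of_bool (Q i) :: nat)) = (\<exists>i<n. Q i)" for n :: nat and Q
    by (induct n) (auto simp: less_Suc_eq)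
  ultimately show ?thesis by (simp only:)
qed

lemma pf_All [pf_intros]:
  "pf N \<Longrightarrow> pf (\<lambda>x p. of_bool (P x (fst p) (snd p))) \<Longrightarrow> pf (\<lambda>x e. of_bool (\<forall>i<N x e. P x e i))"
proof -
  assume "pf N" "pf (\<lambda>x p. of_bool (P x (fst p) (snd p)))"
  then have "pf (\<lambda>x e. of_bool (\<not> (\<exists>i<N x e. \<not> P x e i)))" by (intro pf_intros)
  then show ?thesis by simp
qed

text \<open>The indices up to which \<open>P\<close> fails throughout are counted, so sums and
  bounded quantifiers suffice. Without a witness below \<open>n\<close> the value is
  \<open>n\<close>, which later serves as an out-of-range value.\<close>

definition bounded_least :: "nat \<Rightarrow> (nat \<Rightarrow> bool) \<Rightarrow> nat" where
  "bounded_least n P = (\<Sum>i<n. of_bool (\<forall>j<Suc i. \<not> P j))"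

lemma bounded_least_eq:
  assumes "m \<le> n" "\<And>i. i < m \<Longrightarrow> \<not> P i" "m < n \<Longrightarrow> P m"
  shows "bounded_least n P = m"
proof -
  have "(\<forall>j<Suc i. \<not> P j) \<longleftrightarrow> i < m" if "i < n" for i
    using assms that by (metis linorder_not_less less_Suc_eq_le order.strict_trans1 less_Suc_eq)
  then have "bounded_least n P = (\<Sum>i<n. of_bool (i < m))" unfolding bounded_least_def by (intro sum.cong) auto
  also have "\<dots> = (\<Sum>i\<in>{..<m}. 1)" using assms(1) by (intro sum.mono_neutral_cong_right) auto
  finally show ?thesis by simp
qed

lemma bounded_least_eq_Least:
  assumes "P k" "k < n"
  shows "bounded_least n P = (LEAST i. P i)"
  using assms Least_le[of P k] by (intro bounded_least_eq) (auto dest: not_less_Least intro: LeastI)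

lemma pf_bounded_least [pf_intros]:
  "pf N \<Longrightarrow> pf (\<lambda>x p. of_bool (P x (fst p) (snd p))) \<Longrightarrow> pf (\<lambda>x e. bounded_least (N x e) (P x e))"
proof -
  assume N: "pf N" and P: "pf (\<lambda>x p. of_bool (P x (fst p) (snd p)))"
  have "pf (\<lambda>x (p :: ('a \<times> nat) \<times> nat). of_bool (P x (fst (fst (fst p), snd p)) (snd (fst (fst p), snd p))))"
    by (rule pf_weaken[OF P]) (intro pf_intros)
  then show ?thesis unfolding bounded_least_def by (intro pf_intros N) simp_all
qed

lemma pf_div [pf_intros]: "pf F \<Longrightarrow> pf G \<Longrightarrow> pf (\<lambda>x e. F x e div G x e)"
proof -
  assume F: "pf F" and G: "pf G"
  \<comment> \<open>The search below \<open>F x e\<close> finds no witness for the divisor 1; then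
    the default \<open>F x e\<close> is the quotient.\<close>
  have "pf (\<lambda>x e. if 0 < G x e then bounded_least (F x e) (\<lambda>i. F x e < Suc i * G x e) else 0)"
    by (intro pf_intros pf_weaken[OF F] pf_weaken[OF G])
  moreover have "(if 0 < b then bounded_least a (\<lambda>i. a < Suc i * b) else 0) = a div b" for a b :: nat
  proof (cases "b = 0")
    case False
    have "bounded_least a (\<lambda>i. a < Suc i * b) = a div b"
    proof (rule bounded_least_eq)
      show "\<not> a < Suc i * b" if "i < a div b" for i
        using that mult_le_mono1[of "Suc i" "a div b" b] by (simp add: not_less) (meson div_times_less_eq_dividend order_trans)
      show "a < Suc (a div b) * b" using False dividend_less_div_times[of b a] by (simp add: mult.commute)
    qed simp
    then show ?thesis using False by simp
  qed simp
  ultimately show ?thesis by simp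
qed

lemma pf_mod [pf_intros]: "pf F \<Longrightarrow> pf G \<Longrightarrow> pf (\<lambda>x e. F x e mod G x e)"
  unfolding minus_div_mult_eq_mod[symmetric] by (intro pf_intros)

lemma pf_poly [pf_intros]: "pf F \<Longrightarrow> pf (\<lambda>x e. poly p (F x e))"
  by (induct p) (auto intro!: pf_intros)

text \<open>A function that is constant from \<open>c\<close> on is a finite table, hence a nested
  case distinction of fixed size. The transition table of a fixed machine is evaluated in this
  way.\<close>

lemma pf_table:
  assumes "\<And>n. n \<ge> c \<Longrightarrow> f n = d" "pf F"
  shows "pf (\<lambda>x e. f (F x e))"
  using assms(1)
proof (induct c arbitrary: f)
  case 0
  then show ?case by (simp add: pf_const)
next
  case (Suc c)
  have "pf (\<lambda>x e. (f(c := d)) (F x e))"     by (rule Suc.hyps) (use Suc.prems in \<open>simp add: Suc_le_eq\<close>)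
  then have "pf (\<lambda>x e. if F x e = c then f c else (f(c := d)) (F x e))" by (intro pf_intros assms(2))
  moreover have "(if n = c then f c else (f(c := d)) n) = f n" for n by simp
  ultimately show ?case by (simp only:)
qed

lemma pf_table2:
  assumes "\<And>n m. n \<ge> c \<or> m \<ge> c \<Longrightarrow> f n m = d" "pf F" "pf G"
  shows "pf (\<lambda>x e. f (F x e) (G x e))"
proof -
  have "pf (\<lambda>x e. if b \<le> F x e then d else f (F x e) (G x e))" for b
  proof (induct b)
    case 0
    then show ?case by (simp add: pf_const)
  next
    case (Suc b)
    have "pf (\<lambda>x e. f b (G x e))" by (rule pf_table[where c = c and d = d]) (use assms in auto)
    from pf_If[OF pf_eq[OF assms(2) pf_const[of b]] this Suc]
    have "pf (\<lambda>x e. if F x e = b then f b (G x e) else if b \<le> F x e then d else f (F x e) (G x e))" .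
    moreover have "(if n = b then f b m else if b \<le> n then d else f n m) = (if Suc b \<le> n then d else f n m)" for n m
      by auto
    ultimately show ?case by (simp only:)
  qed
  from this[of c] have "pf (\<lambda>x e. if c \<le> F x e then d else f (F x e) (G x e))" .
  moreover have "(if c \<le> n then d else f n m) = f n m" for n m using assms(1) by simp
  ultimately show ?thesis by (simp only:)
qed

lemma pf_bit_sym [pf_intros]: "pf F \<Longrightarrow> pf (\<lambda>x e. bit_sym x (F x e))"
  by (rule pf_comp1[OF pf_bit_sym_identity])

section \<open>String-valued functions\<close>

text \<open>A string is represented by its length and by access to each symbol. It is never stored;
  symbols are recomputed whenever they are needed.\<close>

definition pf_list :: "(bool list \<Rightarrow> 'e::env \<Rightarrow> bool list) \<Rightarrow> bool" where
  "pf_list f \<longleftrightarrow> pf (\<lambda>x e. length (f x e)) \<and> pf (\<lambda>x p. bit_sym (f x (fst p)) (snd p))"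

lemma pf_list_length: "pf_list f \<Longrightarrow> pf (\<lambda>x e. length (f x e))"
  by (simp add: pf_list_def)

lemma pf_list_weaken:
  assumes "pf_list f" "proj g"
  shows "pf_list (\<lambda>x e. f x (g e))"
proof -
  have "proj (\<lambda>p. g (fst p))" by (rule proj_comp[OF assms(2) proj_fst[OF proj_id]])
  then have "proj (\<lambda>p. (g (fst p), snd p))" by (rule proj_pair) (rule proj_snd[OF proj_id])
  from pf_weaken[OF assms(1)[unfolded pf_list_def, THEN conjunct2] this]
    pf_weaken[OF pf_list_length[OF assms(1)] assms(2)]
  show ?thesis by (simp add: pf_list_def)
qed

lemma pf_list_bit_sym:
  assumes "pf_list f" "pf F"
  shows "pf (\<lambda>x e. bit_sym (f x e) (F x e))"
  using assms pf_let[of "\<lambda>x e i. bit_sym (f x e) i"] by (simp add: pf_list_def)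

lemma pf_list_Nil [pf_intros]: "pf_list (\<lambda>x e. [])"
  by (simp add: pf_list_def bit_sym_def pf_const)

lemma pf_list_single [pf_intros]:
  assumes P: "pf (\<lambda>x e. of_bool (P x e))"
  shows "pf_list (\<lambda>x e. [P x e])"
proof -
  have "bit_sym [b] i = (if i = 0 then Suc (of_bool b) else 0)" for b i
    by (simp add: bit_sym_def)
  then show ?thesis unfolding pf_list_def
    by (simp only: list.size) (intro conjI pf_intros pf_weaken[OF P])
qed

lemma pf_list_append [pf_intros]:
  assumes f: "pf_list f" and g: "pf_list g"
  shows "pf_list (\<lambda>x e. f x e @ g x e)"
proof -
  have "bit_sym (xs @ ys) i = (if i < length xs then bit_sym xs i else bit_sym ys (i - length xs))" for xs ys i
    by (auto simp: bit_sym_def nth_append)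
  then show ?thesis unfolding pf_list_def
    by (simp only: length_append)
       (intro conjI pf_intros pf_list_bit_sym pf_list_length[OF f] pf_list_length[OF g]
         pf_weaken[OF pf_list_length[OF f]] pf_list_weaken[OF f] pf_list_weaken[OF g])
qed

lemma pf_list_Cons [pf_intros]:
  assumes "pf (\<lambda>x e. of_bool (P x e))" "pf_list f"
  shows "pf_list (\<lambda>x e. P x e # f x e)"
  using pf_list_append[OF pf_list_single[OF assms(1)] assms(2)] by simp

lemma pf_list_If [pf_intros]:
  assumes P: "pf (\<lambda>x e. of_bool (P x e))" and f: "pf_list f" and g: "pf_list g"
  shows "pf_list (\<lambda>x e. if P x e then f x e else g x e)"
  unfolding pf_list_def if_distrib[of length] if_distribR if_distrib[of bit_sym]
  by (intro conjI pf_intros pf_list_bit_sym pf_list_length[OF f] pf_list_length[OF g] P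
     pf_weaken[OF P] pf_list_weaken[OF f] pf_list_weaken[OF g])

text \<open>Position \<open>k\<close> of a concatenation lies in the first block whose end exceeds \<open>k\<close>.\<close>

lemma bit_sym_concat:
  "bit_sym (concat (map g [0..<n])) k =
    (if k < (\<Sum>i<n. length (g i))
     then let j = bounded_least n (\<lambda>j. k < (\<Sum>i<Suc j. length (g i)))
       in bit_sym (g j) (k - (\<Sum>i<j. length (g i)))
     else 0)"
proof (induct n)
  case 0
  then show ?case by (simp add: bit_sym_def)
next
  case (Suc n)
  let ?S = "\<lambda>n. \<Sum>i<n. length (g i)"
  have len: "length (concat (map g [0..<n])) = ?S n" for n by (induct n) auto
  have app: "bit_sym (concat (map g [0..<Suc n])) k =
    (if k < ?S n then bit_sym (concat (map g [0..<n])) k else bit_sym (g n) (k - ?S n))"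
    by (auto simp: bit_sym_def nth_append len)
  have mono: "?S i \<le> ?S j" if "i \<le> j" for i j using that by (intro sum_mono2) auto
  consider "k < ?S n" | "?S n \<le> k" "k < ?S (Suc n)" | "?S (Suc n) \<le> k" by linarith
  then show ?case
  proof cases
    case 1
    let ?m = "LEAST j. k < ?S (Suc j)"
    have "0 < n" using 1 by (cases n) auto
    then have k: "k < ?S (Suc (n - 1))" using 1 by simp
    have "bounded_least n (\<lambda>j. k < ?S (Suc j)) = ?m" "bounded_least (Suc n) (\<lambda>j. k < ?S (Suc j)) = ?m"
      by (rule bounded_least_eq_Least[of "\<lambda>j. k < ?S (Suc j)", OF k], use \<open>0 < n\<close> in simp)+
    then show ?thesis using 1 Suc app by (simp add: Let_def)
  next
    case 2
    have "bounded_least (Suc n) (\<lambda>j. k < ?S (Suc j)) = n"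
    proof (rule bounded_least_eq)
      show "\<not> k < ?S (Suc i)" if "i < n" for i using mono[of "Suc i" n] that 2 by simp
    qed (use 2 in auto)
    then show ?thesis using 2 app by (simp add: Let_def)
  next
    case 3
    then show ?thesis using app bit_sym_eq_0[of "g n" "k - ?S n"] by auto
  qed
qed

lemma pf_list_concat [pf_intros]:
  fixes N :: "bool list \<Rightarrow> 'e::env \<Rightarrow> nat"
  assumes N: "pf N" and g: "pf_list (\<lambda>x p. g x (fst p) (snd p))"
  shows "pf_list (\<lambda>x e. concat (map (g x e) [0..<N x e]))"
proof -
  note l = pf_list_length[OF g]
  have l1: "pf (\<lambda>x p. length (g x (h p) (k p)))" if "proj h" "proj k" for h :: "'a::env \<Rightarrow> 'e" and k
    using pf_weaken[OF l proj_pair[OF that]] by simp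
  have len: "length (concat (map g [0..<n])) = (\<Sum>i<n. length (g i))" for g :: "nat \<Rightarrow> bool list" and n
    by (induct n) auto
  have "pf (\<lambda>x (q :: ('e \<times> nat) \<times> nat).
      bit_sym (g x (fst (fst q)) (snd q)) (snd (fst q) - (\<Sum>i<snd q. length (g x (fst (fst q)) i))))"
  proof (rule pf_list_bit_sym)
    have "pf_list (\<lambda>x (q :: ('e \<times> nat) \<times> nat). g x (fst (fst (fst q), snd q)) (snd (fst (fst q), snd q)))"
      by (rule pf_list_weaken[OF g]) (intro pf_intros)
    then show "pf_list (\<lambda>x (q :: ('e \<times> nat) \<times> nat). g x (fst (fst q)) (snd q))" by simp
  qed (intro pf_intros l1)
  then have "pf (\<lambda>x (p :: 'e \<times> nat). let j = bounded_least (N x (fst p)) (\<lambda>j. snd p < (\<Sum>i<Suc j. length (g x (fst p) i)))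
    in bit_sym (g x (fst p) j) (snd p - (\<Sum>i<j. length (g x (fst p) i))))"
    unfolding Let_def
    by (rule pf_let[of "\<lambda>x p j. bit_sym (g x (fst p) j) (snd p - (\<Sum>i<j. length (g x (fst p) i)))"])
       (intro pf_intros pf_weaken[OF N] l1)
  then show ?thesis unfolding pf_list_def len bit_sym_concat
    by (intro conjI pf_intros pf_weaken[OF N] l1)
qed

lemma pf_list_map [pf_intros]:
  assumes "pf N" "pf (\<lambda>x p. of_bool (P x (fst p) (snd p)))"
  shows "pf_list (\<lambda>x e. map (P x e) [0..<N x e])"
proof -
  have "pf_list (\<lambda>x e. concat (map (\<lambda>i. [P x e i]) [0..<N x e]))"
    by (intro pf_intros assms)
  moreover have "concat (map (\<lambda>i. [f i]) xs) = map f xs" for f :: "nat \<Rightarrow> bool" and xs by (induct xs) auto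
  ultimately show ?thesis by simp
qed

lemma list_eq_iff_bit_sym: "xs = ys \<longleftrightarrow> length xs = length ys \<and> (\<forall>i<length xs. bit_sym xs i = bit_sym ys i)"
  by (auto simp: bit_sym_def list_eq_iff_nth_eq split: if_splits)

lemma pf_list_eq:
  assumes f: "pf_list f" and g: "pf_list g"
  shows "pf (\<lambda>x e. of_bool (f x e = g x e))"
  unfolding list_eq_iff_bit_sym
  by (intro pf_intros pf_list_bit_sym pf_list_length[OF f] pf_list_length[OF g]
     pf_list_weaken[OF f] pf_list_weaken[OF g])

text \<open>Register 1 counts the bits still to be written, register 2 is the position of the next
  bit, and register 3 receives its symbol.\<close>

theorem pf_list_polytime:
  assumes "pf_list (\<lambda>x (e :: unit). f x)"
  shows "polytime_computable f"
proof -
  from assms have l: "pf (\<lambda>x (e :: unit). length (f x))" and b: "pf (\<lambda>x (p :: unit \<times> nat). bit_sym (f x) (snd p))"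
    by (simp_all add: pf_list_def)
  from l obtain CL TL where L: "poly_bounded (\<lambda>x (e :: unit). length (f x))" "poly_bounded TL"
    "implements CL TL (\<lambda>x (e :: unit). length (f x))" by (rule pfE)
  from b obtain CB TB where B: "poly_bounded TB" "implements CB TB (\<lambda>x (p :: unit \<times> nat). bit_sym (f x) (snd p))"
    by (rule pfE)
  from L(1) obtain pl where pl: "\<And>x. length (f x) \<le> poly pl (length x)"
    by (auto simp: poly_bounded_def input_size_def)
  from L(2) obtain pt where pt: "\<And>x. TL x () \<le> poly pt (length x)"
    by (auto simp: poly_bounded_def input_size_def)
  from B(1) obtain pb where pb: "\<And>x n. TB x ((), n) \<le> poly pb (length x + n)"
    by (auto simp: poly_bounded_def input_size_def)
  \<comment> \<open>Inside the string the symbol is 1 or 2. After one decrement the zero test tells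
    the two bits apart, and register 3 is left at 0 for the next round.\<close>
  let ?emit = "Dec 3 ;; Branch 3 1 (Out False) (Out True ;; Dec 3)"
  let ?body = "Dec 1 ;; CB [2] 2 ;; ?emit ;; Inc 2"
  let ?prog = "CL [] 0 ;; While 1 1 ?body"
  define s :: "bool list \<Rightarrow> nat \<Rightarrow> store" where "s x i = ((\<lambda>_. 0)(1 := length (f x) - i, 2 := i), take i (f x))" for x i
  define K where "K x = poly pb (length x + length (f x))" for x
  let ?K = "\<lambda>x. Suc (1 + Suc (K x + Suc (Suc (1 + Suc (Suc (1 + 1))) + 1)))"
  have body: "runs x ?body (s x i) (?K x) (s x (Suc i))" if i: "i < length (f x)" for x i
  proof -
    let ?s1 = "(\<lambda>_. 0)(1 := length (f x) - Suc i, 2 := i) :: nat \<Rightarrow> nat"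
    let ?t = "take i (f x)"
    have e0: "fst (s x i) 1 = Suc (length (f x) - Suc i)" "snd (s x i) = ?t" using i by (auto simp: s_def)
    have e1: "(fst (s x i))(1 := length (f x) - Suc i) = ?s1" by (auto simp: s_def fun_eq_iff)
    have r1: "runs x (Dec 1) (s x i) 1 (?s1, ?t)"
      using runs_Dec[of "fst (s x i)" 1, OF e0(1), of x ?t] e0(2) unfolding e1 by (simp add: s_def)
    have r2: "runs x (CB [2] 2) (?s1, ?t) (K x) (?s1(3 := bit_sym (f x) i), ?t)"
    proof (rule runs_mono)
      show "runs x (CB [2] 2) (?s1, ?t) (TB x ((), i)) (?s1(3 := bit_sym (f x) i), ?t)"
        using implementsD[OF B(2), of ?s1 "[2]" "((), i)" 2 x ?t] by simp
      have "TB x ((), i) \<le> poly pb (length x + i)" by (rule pb)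
      also have "\<dots> \<le> K x" unfolding K_def by (rule poly_nat_mono) (use i in simp)
      finally show "TB x ((), i) \<le> K x" .
    qed
    have t: "take (Suc i) (f x) = ?t @ [f x ! i]" using i by (rule take_Suc_conv_app_nth)
    have r3: "runs x ?emit (?s1(3 := bit_sym (f x) i), ?t) (Suc (1 + Suc (Suc (1 + 1)))) (?s1, take (Suc i) (f x))"
    proof -
      let ?b = "of_bool (f x ! i) :: nat"
      have "runs x (Dec 3) (?s1(3 := bit_sym (f x) i), ?t) 1 (?s1(3 := bit_sym (f x) i, 3 := ?b), ?t)"
        by (rule runs_Dec) (use i in \<open>simp add: bit_sym_def\<close>)
      then have 1: "runs x (Dec 3) (?s1(3 := bit_sym (f x) i), ?t) 1 (?s1(3 := ?b), ?t)" by simp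
      have 2: "runs x (Out b) (s', ?t) 1 (s', ?t @ [b])" for b s' by (rule runs_Out)

      have "runs x (Dec 3) (?s1(3 := 1), ?t @ [True]) 1 (?s1(3 := 1, 3 := 0), ?t @ [True])" by (rule runs_Dec) simp
      then have 3: "runs x (Dec 3) (?s1(3 := 1), ?t @ [True]) 1 (?s1, ?t @ [True])" by (simp add: fun_upd_idem)
      have "runs x (Branch 3 1 (Out False) (Out True ;; Dec 3)) (?s1(3 := ?b), ?t) (Suc (Suc (1 + 1))) (?s1, ?t @ [f x ! i])"
      proof (rule runs_Branch, cases "f x ! i")
        case True
        then show "if tape_sym x 3 (fst (?s1(3 := ?b), ?t) 3) = 1 then runs x (Out False) (?s1(3 := ?b), ?t) (Suc (1 + 1)) (?s1, ?t @ [f x ! i])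
          else runs x (Out True ;; Dec 3) (?s1(3 := ?b), ?t) (Suc (1 + 1)) (?s1, ?t @ [f x ! i])"
          using runs_Seq[OF 2 3] by simp
      next
        case False
        then show "if tape_sym x 3 (fst (?s1(3 := ?b), ?t) 3) = 1 then runs x (Out False) (?s1(3 := ?b), ?t) (Suc (1 + 1)) (?s1, ?t @ [f x ! i])
          else runs x (Out True ;; Dec 3) (?s1(3 := ?b), ?t) (Suc (1 + 1)) (?s1, ?t @ [f x ! i])"
          using runs_mono[OF 2[of False ?s1], of "Suc (1 + 1)"] by (simp add: fun_upd_idem)
      qed
      from runs_Seq[OF 1 this] show ?thesis by (simp only: t)
    qed
    have "?s1(2 := Suc i) = fst (s x (Suc i))" by (auto simp: s_def fun_eq_iff)
    then have r4: "runs x (Inc 2) (?s1, take (Suc i) (f x)) 1 (s x (Suc i))"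
      using runs_Inc[of "Suc i" ?s1 2 x "take (Suc i) (f x)"] by (simp add: s_def)
    show ?thesis by (intro runs_Seq[OF r1 runs_Seq[OF r2 runs_Seq[OF r3 r4]]])
  qed
  have loop: "runs x (While 1 1 ?body) (s x 0) (Suc (length (f x) * Suc (?K x))) (s x (length (f x)))" for x
  proof -
    have "runs x (While 1 1 ?body) (s x (length (f x) - length (f x))) (Suc (length (f x) * Suc (?K x))) (s x (length (f x) - 0))"
    proof (rule runs_counter_loop[of 1 "length (f x)" x ?body "\<lambda>i. s x (length (f x) - i)"])
      fix i assume "i < length (f x)"
      then show "runs x ?body (s x (length (f x) - Suc i)) (?K x) (s x (length (f x) - i))"
        using body[of "length (f x) - Suc i" x] by (simp add: Suc_diff_Suc)
    qed (auto simp: s_def)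
    then show ?thesis by simp
  qed
  have start: "runs x (CL [] 0) (\<lambda>_. 0, []) (TL x ()) (s x 0)" for x
  proof -
    have "(\<lambda>_. 0)(Suc 0 := length (f x)) = fst (s x 0)" by (auto simp: s_def fun_eq_iff)
    then show ?thesis using implementsD[OF L(3), of "\<lambda>_. 0" "[]" "()" 0 x "[]"] by (simp add: s_def)
  qed
  \<comment> \<open>The 12 collects the steps of one round apart from \<open>K x\<close>, the time
    for computing the symbol.\<close>
  let ?p = "1 + (pt + (1 + (pl * (12 + pcompose pb ([:0, 1:] + pl)))))"
  show ?thesis
  proof (rule exec_imp_polytime)
    fix x
    let ?n = "Suc (TL x () + Suc (length (f x) * Suc (?K x)))"
    have r: "runs x ?prog (\<lambda>_. 0, []) ?n (s x (length (f x)))" by (rule runs_Seq[OF start loop])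
    have "K x \<le> poly pb (length x + poly pl (length x))"
      unfolding K_def using pl by (intro poly_nat_mono) simp
    then have "length (f x) * Suc (?K x) \<le> poly pl (length x) * (12 + poly pb (length x + poly pl (length x)))"
      using pl by (intro mult_mono) auto
    then have "?n \<le> poly ?p (length x)" using pt[of x] by (simp add: poly_pcompose)
    then show "\<exists>t s. exec x ?prog (\<lambda>_. 0, []) t (s, f x) \<and> t \<le> poly ?p (length x)"
      using r by (auto simp: runs_def s_def intro: order_trans)
  qed
qed

section \<open>Walks, distances and durations\<close>

lemma pawalk_verts_conv: "pcas u p v \<Longrightarrow> pawalk_verts u p = u # map snd p"
  by (induct p arbitrary: u) auto

lemma awalk_pair: "pre_digraph.awalk (with_proj G) u p v \<longleftrightarrow> u \<in> pverts G \<and> set p \<subseteq> parcs G \<and> pcas u p v"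
  by (simp add: pre_digraph.awalk_def cas_with_proj_eq)

lemma apath_pair:
  "pre_digraph.apath (with_proj G) u p v \<longleftrightarrow> u \<in> pverts G \<and> set p \<subseteq> parcs G \<and> pcas u p v \<and> distinct (u # map snd p)"
  by (simp add: pre_digraph.apath_def awalk_pair awalk_verts_with_proj_eq pawalk_verts_conv cong: conj_cong)

lemma cycle_pair:
  "pre_digraph.cycle (with_proj G) p \<longleftrightarrow> (\<exists>u \<in> pverts G. set p \<subseteq> parcs G \<and> pcas u p u \<and> distinct (map snd p) \<and> p \<noteq> [])"
  by (auto simp: pre_digraph.cycle_def awalk_pair awalk_verts_with_proj_eq pawalk_verts_conv)

lemma pcas_append: "pcas u (p @ q) w \<longleftrightarrow> (\<exists>v. pcas u p v \<and> pcas v q w)"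
  by (induct p arbitrary: u) auto

lemma strongly_connected_pairI:
  assumes "pair_digraph G" "pverts G \<noteq> {}"
    "\<And>u v. u \<in> pverts G \<Longrightarrow> v \<in> pverts G \<Longrightarrow> \<exists>p. pre_digraph.awalk (with_proj G) u p v"
  shows "strongly_connected (with_proj G)"
proof -
  interpret pair_digraph G by fact
  show ?thesis using assms(2,3) by (intro strongly_connectedI) (auto simp: reachable_awalk)
qed

text \<open>Durations are natural numbers, so the infimum over a nonempty set of paths is attained,
  while the infimum over no path is infinite.\<close>

lemma fastest_duration_le_iff:
  "fastest_duration G \<Delta> lab u v \<le> enat d \<longleftrightarrow> (\<exists>p. temporal_path G \<Delta> lab u p v \<and> duration p \<le> d)"
proof -
  let ?P = "{p. temporal_path G \<Delta> lab u p v}"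
  have "(INF p \<in> ?P. enat (duration p)) \<le> enat d \<longleftrightarrow> (\<exists>p \<in> ?P. duration p \<le> d)"
  proof (cases "?P = {}")
    case True
    then show ?thesis by (simp add: top_enat_def)
  next
    case False
    then obtain p where "p \<in> ?P" by blast
    then have "(INF p \<in> ?P. enat (duration p)) \<in> (\<lambda>p. enat (duration p)) ` ?P"
      by (intro wellorder_InfI[of "enat (duration p)"]) auto
    then show ?thesis by (auto intro: INF_lower2)
  qed
  then show ?thesis by (simp add: fastest_duration_def)
qed

lemma sorted_wrt_less_diff:
  "sorted_wrt (<) (ts :: nat list) \<Longrightarrow> ts \<noteq> [] \<Longrightarrow> hd ts + length ts \<le> Suc (last ts)"
proof (induct ts rule: rev_induct)
  case (snoc t ts)
  then show ?case by (cases "ts = []") (auto simp: sorted_wrt_append intro: le_trans[OF _ Suc_leI])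
qed simp

text \<open>The times increase strictly, so every arc takes at least one unit of time. A bound on
  the duration thereby limits the number of arcs.\<close>

lemma temporal_path_duration:
  assumes "temporal_path G \<Delta> lab u p v"
  shows "length p \<le> duration p"
proof -
  have "map snd p \<noteq> []" "sorted_wrt (<) (map snd p)" using assms by (auto simp: temporal_path_def)
  from sorted_wrt_less_diff[OF this(2,1)] this(1) show ?thesis
    by (simp add: duration_def hd_map last_map)
qed

lemma static_dist_le:
  assumes "pair_digraph G" "pre_digraph.awalk (with_proj G) u p v"
  shows "static_dist G u v \<le> ereal (real (length p))"
proof -
  interpret pair_digraph G by fact
  have "awalk_cost (\<lambda>_. 1) p = length p" by (induct p) (auto simp: awalk_cost_def)
  then show ?thesis using min_cost_le_walk_cost[of u p v "\<lambda>_. 1"] assms(2) by (simp add: static_dist_def)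
qed

section \<open>Paths of duration 2 and 3 for period 2\<close>

locale two_periodic =
  fixes G :: "'a pair_pre_digraph" and lab :: "'a \<times> 'a \<Rightarrow> nat"
  assumes wf: "pair_digraph G" and labeling: "periodic_labeling G 2 lab"
begin

lemma lab_cases: "e \<in> parcs G \<Longrightarrow> lab e = 0 \<or> lab e = 1"
  using labeling by (fastforce simp: periodic_labeling_def)

lemma active_2: "e \<in> parcs G \<Longrightarrow> active 2 lab e t \<longleftrightarrow> t mod 2 = lab e"
  using lab_cases[of e] by (auto simp: active_def) presburger+

lemma verts: "(u, v) \<in> parcs G \<Longrightarrow> u \<in> pverts G"
proof -
  interpret pair_digraph G by (rule wf)
  show "(u, v) \<in> parcs G \<Longrightarrow> u \<in> pverts G" by (rule in_arcsD1)
qed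

lemma duration_2:
  assumes "(u, w) \<in> parcs G" "(w, v) \<in> parcs G" "distinct [u, w, v]" "lab (u, w) \<noteq> lab (w, v)"
  shows "fastest_duration G 2 lab u v \<le> enat 2"
  unfolding fastest_duration_le_iff
  by (rule exI[of _ "[((u, w), lab (u, w)), ((w, v), Suc (lab (u, w)))]"])
     (use assms verts active_2 lab_cases[OF assms(1)] lab_cases[OF assms(2)] in
       \<open>auto simp: temporal_path_def apath_pair duration_def\<close>)

lemma duration_3:
  assumes "(u, w) \<in> parcs G" "(w, w') \<in> parcs G" "(w', v) \<in> parcs G" "distinct [u, w, w', v]"
    "lab (u, w) \<noteq> lab (w, w')" "lab (w, w') \<noteq> lab (w', v)"
  shows "fastest_duration G 2 lab u v \<le> enat 3"
  unfolding fastest_duration_le_iff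
  by (rule exI[of _ "[((u, w), lab (u, w)), ((w, w'), Suc (lab (u, w))), ((w', v), Suc (Suc (lab (u, w))))]"])
     (use assms verts active_2 lab_cases[OF assms(1)] lab_cases[OF assms(2)] lab_cases[OF assms(3)] in
       \<open>auto simp: temporal_path_def apath_pair duration_def\<close>)

lemma consecutive_labels:
  assumes "e \<in> parcs G" "e' \<in> parcs G" "active 2 lab e t" "active 2 lab e' (Suc t)"
  shows "lab e \<noteq> lab e'"
  using assms(3,4) unfolding active_2[OF assms(1)] active_2[OF assms(2)] by presburger

lemma duration_2D:
  assumes "fastest_duration G 2 lab u v \<le> enat 2" "u \<noteq> v" "(u, v) \<notin> parcs G"
  obtains w where "(u, w) \<in> parcs G" "(w, v) \<in> parcs G" "lab (u, w) \<noteq> lab (w, v)"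
proof -
  from assms(1) obtain p where p: "temporal_path G 2 lab u p v" "duration p \<le> 2"
    unfolding fastest_duration_le_iff by blast
  then have "length p \<le> 2" using temporal_path_duration by fastforce
  moreover have "p \<noteq> []" "length p \<noteq> 1" using p(1) assms(2,3)
    by (auto simp: temporal_path_def apath_pair length_Suc_conv)
  ultimately have "length p = 2" by (simp add: le_Suc_eq numeral_2_eq_2)
  then obtain e1 t1 e2 t2 where pp: "p = [(e1, t1), (e2, t2)]"
    by (auto simp: length_Suc_conv numeral_2_eq_2)
  have "t2 = Suc t1" using p unfolding pp by (auto simp: temporal_path_def duration_def)
  then have "lab e1 \<noteq> lab e2" using p(1) consecutive_labels[of e1 e2 t1]
    unfolding pp by (auto simp: temporal_path_def apath_pair)
  moreover obtain w where "e1 = (u, w)" "e2 = (w, v)" using p(1) unfolding pp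
    by (cases e1; cases e2) (auto simp: temporal_path_def apath_pair)
  ultimately show ?thesis using that[of w] p(1) unfolding pp by (auto simp: temporal_path_def apath_pair)
qed

text \<open>Once the graph rules out one and two arcs, a path of duration at most 3 has three arcs
  and no time to wait, so consecutive labels alternate.\<close>

lemma duration_3D:
  assumes "fastest_duration G 2 lab u v \<le> enat 3" "u \<noteq> v" "(u, v) \<notin> parcs G"
    "\<And>w. (u, w) \<in> parcs G \<Longrightarrow> (w, v) \<notin> parcs G"
  obtains w w' where "(u, w) \<in> parcs G" "(w, w') \<in> parcs G" "(w', v) \<in> parcs G"
    "lab (u, w) \<noteq> lab (w, w')" "lab (w, w') \<noteq> lab (w', v)"
proof -
  from assms(1) obtain p where p: "temporal_path G 2 lab u p v" "duration p \<le> 3"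
    unfolding fastest_duration_le_iff by blast
  then have "length p \<le> 3" using temporal_path_duration by fastforce
  moreover have "p \<noteq> []" "length p \<noteq> 1" using p(1) assms(2,3)
    by (auto simp: temporal_path_def apath_pair length_Suc_conv)
  moreover have "length p \<noteq> 2"
  proof
    assume "length p = 2"
    then obtain a b t1 c d t2 where "p = [((a, b), t1), ((c, d), t2)]"
      by (auto simp: length_Suc_conv numeral_2_eq_2)
    then show False using p(1) assms(4)[of b] by (auto simp: temporal_path_def apath_pair)
  qed
  ultimately have "length p = 3" by (simp add: le_Suc_eq numeral_2_eq_2 numeral_3_eq_3)
  then obtain e1 t1 e2 t2 e3 t3 where pp: "p = [(e1, t1), (e2, t2), (e3, t3)]"
    by (auto simp: length_Suc_conv numeral_3_eq_3)
  have t: "t2 = Suc t1" "t3 = Suc t2" using p unfolding pp by (auto simp: temporal_path_def duration_def)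
  have "lab e1 \<noteq> lab e2" using p(1) consecutive_labels[of e1 e2 t1] t(1)
    unfolding pp by (auto simp: temporal_path_def apath_pair)
  moreover have "lab e2 \<noteq> lab e3" using p(1) consecutive_labels[of e2 e3 t2] t(2)
    unfolding pp by (auto simp: temporal_path_def apath_pair)
  moreover obtain w w' where "e1 = (u, w)" "e2 = (w, w')" "e3 = (w', v)" using p(1) unfolding pp
    by (cases e1; cases e2; cases e3) (auto simp: temporal_path_def apath_pair)
  ultimately show ?thesis using that[of w w'] p(1) unfolding pp by (auto simp: temporal_path_def apath_pair)
qed

end

section \<open>From hypergraph 2-colouring to DiTGR\<close>

text \<open>
  The hypergraph has vertices \<open>l < n\<close> and edges \<open>e < m\<close> with membership relation \<open>mem e l\<close>.
  Vertices 0, 1, 2 are the triangle, 3, 4, 5 are pendant vertices attached to them in this order,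
  \<open>6 + 3 * l + i\<close> with \<open>i < 3\<close> are the vertices for \<open>l\<close>, and \<open>6 + 3 * n + e\<close> is the vertex for \<open>e\<close>.
\<close>

definition half_arc :: "nat \<Rightarrow> nat \<Rightarrow> (nat \<Rightarrow> nat \<Rightarrow> bool) \<Rightarrow> nat \<Rightarrow> nat \<Rightarrow> bool" where
  "half_arc n m mem u v \<longleftrightarrow>
     u = 0 \<and> v = 1 \<or> u = 0 \<and> v = 2 \<or> u = 1 \<and> v = 2 \<or> u = 0 \<and> v = 3 \<or> u = 1 \<and> v = 4 \<or> u = 2 \<and> v = 5 \<or>
     u = 0 \<and> (\<exists>l<n. \<exists>i<3. v = 6 + 3 * l + i) \<or>
     (\<exists>l<n. \<exists>e<m. u = 6 + 3 * l \<and> v = 6 + 3 * n + e \<and> mem e l)"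

text \<open>Arcs and bounds are given by arithmetic conditions with bounded quantifiers; in this
  form \<open>pf_intros\<close> shows that they are computable.\<close>

definition gadget_arc :: "nat \<Rightarrow> nat \<Rightarrow> (nat \<Rightarrow> nat \<Rightarrow> bool) \<Rightarrow> nat \<Rightarrow> nat \<Rightarrow> bool" where
  "gadget_arc n m mem u v \<longleftrightarrow> half_arc n m mem u v \<or> half_arc n m mem v u"

definition half_bound_2 :: "nat \<Rightarrow> nat \<Rightarrow> nat \<Rightarrow> bool" where
  "half_bound_2 n u v \<longleftrightarrow>
     u = 1 \<and> v = 3 \<or> u = 2 \<and> v = 3 \<or> u = 0 \<and> v = 4 \<or> u = 2 \<and> v = 4 \<or> u = 0 \<and> v = 5 \<or> u = 1 \<and> v = 5 \<or>
     (\<exists>l<n. \<exists>i<3. \<exists>j<3. u = 6 + 3 * l + i \<and> v = 6 + 3 * l + j)"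

definition half_bound_3 :: "nat \<Rightarrow> nat \<Rightarrow> nat \<Rightarrow> nat \<Rightarrow> bool" where
  "half_bound_3 n m u v \<longleftrightarrow> (\<exists>e<m. u = 6 + 3 * n + e \<and> v = 1)"

definition gadget_graph :: "nat \<Rightarrow> nat \<Rightarrow> (nat \<Rightarrow> nat \<Rightarrow> bool) \<Rightarrow> nat pair_pre_digraph" where
  "gadget_graph n m mem = \<lparr>pverts = {..<6 + 3 * n + m}, parcs = {(u, v). gadget_arc n m mem u v}\<rparr>"

definition gadget_bound :: "nat \<Rightarrow> nat \<Rightarrow> nat \<Rightarrow> nat \<Rightarrow> enat" where
  "gadget_bound n m u v =
     (if half_bound_2 n u v \<or> half_bound_2 n v u then enat 2
      else if half_bound_3 n m u v \<or> half_bound_3 n m v u then enat 3 else \<infinity>)"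

text \<open>A hyperedge without members would become an isolated vertex, and the instance would not
  be strongly connected.\<close>

locale hypergraph =
  fixes n m :: nat and mem :: "nat \<Rightarrow> nat \<Rightarrow> bool"
  assumes nonempty: "e < m \<Longrightarrow> \<exists>l<n. mem e l"
begin

definition "lit l i = 6 + 3 * l + (i :: nat)"
definition "edge e = 6 + 3 * n + (e :: nat)"
abbreviation "adj \<equiv> gadget_arc n m mem"
abbreviation "G \<equiv> gadget_graph n m mem"
abbreviation "D \<equiv> gadget_bound n m"

lemma lit_eq [simp]: "i < 3 \<Longrightarrow> j < 3 \<Longrightarrow> lit l i = lit k j \<longleftrightarrow> l = k \<and> i = j"
  unfolding lit_def by presburger

lemma lit_ex [simp]: "l < n \<Longrightarrow> i < 3 \<Longrightarrow> \<exists>k<n. \<exists>j<3. lit l i = lit k j"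
  by blast

lemma edge_eq [simp]: "edge e = edge f \<longleftrightarrow> e = f"
  by (simp add: edge_def)

lemma lit_edge [simp]: "l < n \<Longrightarrow> i < 3 \<Longrightarrow> lit l i \<noteq> edge e" "l < n \<Longrightarrow> i < 3 \<Longrightarrow> edge e \<noteq> lit l i"
  by (auto simp: lit_def edge_def)

lemma lit_small [simp]: "k < 6 \<Longrightarrow> lit l i \<noteq> k" "k < 6 \<Longrightarrow> k \<noteq> lit l i"
  "k < 6 \<Longrightarrow> edge e \<noteq> k" "k < 6 \<Longrightarrow> k \<noteq> edge e"
  by (auto simp: lit_def edge_def)

lemma half_arc_conv: "half_arc n m mem u v \<longleftrightarrow>
     (u, v) \<in> {(0, 1), (0, 2), (1, 2), (0, 3), (1, 4), (2, 5)} \<or>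
     u = 0 \<and> (\<exists>l<n. \<exists>i<3. v = lit l i) \<or>
     (\<exists>l<n. \<exists>e<m. u = lit l 0 \<and> v = edge e \<and> mem e l)"
  by (auto simp: half_arc_def lit_def edge_def)

lemma half_bound_2_conv: "half_bound_2 n u v \<longleftrightarrow>
     (u, v) \<in> {(1, 3), (2, 3), (0, 4), (2, 4), (0, 5), (1, 5)} \<or>
     (\<exists>l<n. \<exists>i<3. \<exists>j<3. u = lit l i \<and> v = lit l j)"
  by (auto simp: half_bound_2_def lit_def)

lemma half_bound_3_conv: "half_bound_3 n m u v \<longleftrightarrow> (\<exists>e<m. u = edge e \<and> v = 1)"
  by (auto simp: half_bound_3_def edge_def)

lemma adj_sym: "adj u v \<longleftrightarrow> adj v u"
  by (auto simp: gadget_arc_def)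

lemma adj_0: "adj 0 v \<longleftrightarrow> v \<in> {1, 2, 3} \<or> (\<exists>l<n. \<exists>i<3. v = lit l i)"
  and adj_1: "adj 1 v \<longleftrightarrow> v \<in> {0, 2, 4}"
  and adj_2: "adj 2 v \<longleftrightarrow> v \<in> {0, 1, 5}"
  and adj_3: "adj 3 v \<longleftrightarrow> v = 0"
  and adj_4: "adj 4 v \<longleftrightarrow> v = 1"
  and adj_5: "adj 5 v \<longleftrightarrow> v = 2"
  and adj_edge: "adj (edge e) v \<longleftrightarrow> (\<exists>l<n. e < m \<and> v = lit l 0 \<and> mem e l)"
  by (auto simp: gadget_arc_def half_arc_conv)

lemma adj_lit: "l < n \<Longrightarrow> i < 3 \<Longrightarrow> adj (lit l i) v \<longleftrightarrow> v = 0 \<or> i = 0 \<and> (\<exists>e<m. v = edge e \<and> mem e l)"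
  by (auto simp: gadget_arc_def half_arc_conv)

lemmas adj_simps = adj_0 adj_1[unfolded One_nat_def] adj_1 adj_2 adj_3 adj_4 adj_5 adj_edge adj_lit

lemma adj_to: "adj v 3 \<longleftrightarrow> v = 0" "adj v 4 \<longleftrightarrow> v = 1" "adj v 5 \<longleftrightarrow> v = 2"
  "adj v (edge e) \<longleftrightarrow> (\<exists>l<n. e < m \<and> v = lit l 0 \<and> mem e l)"
  "l < n \<Longrightarrow> i < 3 \<Longrightarrow> adj v (lit l i) \<longleftrightarrow> v = 0 \<or> i = 0 \<and> (\<exists>e<m. v = edge e \<and> mem e l)"
  by (subst adj_sym, rule adj_3 adj_4 adj_5 adj_edge adj_lit; assumption)+

lemma parcs_G [simp]: "(u, v) \<in> parcs G \<longleftrightarrow> adj u v"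
  by (simp add: gadget_graph_def)

lemma pverts_G [simp]: "pverts G = {..<6 + 3 * n + m}"
  by (simp add: gadget_graph_def)

lemma vertex_cases:
  assumes "v < 6 + 3 * n + m"
  obtains "v \<in> {0, 1, 2, 3, 4, 5}" | l i where "l < n" "i < 3" "v = lit l i" | e where "e < m" "v = edge e"
proof -
  consider "v < 6" | "6 \<le> v" "v < 6 + 3 * n" | "6 + 3 * n \<le> v" by linarith
  then show ?thesis
  proof cases
    case 1
    then have "v \<in> {0, 1, 2, 3, 4, 5}" by auto
    then show ?thesis by (rule that)
  next
    case 2
    then show ?thesis using that(2)[of "(v - 6) div 3" "(v - 6) mod 3"] by (simp add: lit_def less_mult_imp_div_less)
  next
    case 3
    then show ?thesis using that(3)[of "v - (6 + 3 * n)"] assms by (simp add: edge_def)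
  qed
qed

section \<open>The gadget as an admissible instance\<close>

lemma half_arc_less: "half_arc n m mem u v \<Longrightarrow> u < v \<and> v < 6 + 3 * n + m"
  by (auto simp: half_arc_def)

lemma pair_digraph_G: "pair_digraph G"
proof
  fix e
  assume "e \<in> parcs G"
  then have "adj (fst e) (snd e)" by (metis parcs_G prod.collapse)
  then show "fst e \<in> pverts G" "snd e \<in> pverts G" "fst e \<noteq> snd e"
    by (auto simp: gadget_arc_def dest!: half_arc_less)
next
  have "parcs G \<subseteq> {..<6 + 3 * n + m} \<times> {..<6 + 3 * n + m}"
    by (auto simp: gadget_arc_def dest!: half_arc_less)
  then show "finite (parcs G)" by (rule finite_subset) simp
qed simp

lemma symmetric_G: "symmetric (with_proj G)"
  using adj_sym by (auto simp: symmetric_def sym_def)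

lemma awalk_G: "pre_digraph.awalk (with_proj G) u p v \<longleftrightarrow> u < 6 + 3 * n + m \<and> (\<forall>(a, b) \<in> set p. adj a b) \<and> pcas u p v"
  by (auto simp: awalk_pair subset_iff)

lemma strongly_connected_G: "strongly_connected (with_proj G)"
proof (rule strongly_connected_pairI[OF pair_digraph_G])
  define conn where "conn u v \<longleftrightarrow> (\<exists>p. (\<forall>(a, b) \<in> set p. adj a b) \<and> pcas u p v)" for u v
  have single: "conn u v" if "adj u v" for u v
    unfolding conn_def using that by (intro exI[of _ "[(u, v)]"]) simp
  have trans: "conn u w" if uv: "conn u v" and vw: "conn v w" for u v w
  proof -
    from uv obtain p where "\<forall>(a, b) \<in> set p. adj a b" "pcas u p v" unfolding conn_def by blast
    moreover from vw obtain q where "\<forall>(a, b) \<in> set q. adj a b" "pcas v q w" unfolding conn_def by blast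
    ultimately show ?thesis unfolding conn_def
      by (intro exI[of _ "p @ q"]) (auto simp: pcas_append)
  qed
  have zero: "conn v 0 \<and> conn 0 v" if "v < 6 + 3 * n + m" for v
    using that
  proof (cases rule: vertex_cases)
    case 1
    have "conn 1 0" "conn 0 1" "conn 2 0" "conn 0 2" "conn 3 0" "conn 0 3" "conn 4 1" "conn 1 4" "conn 5 2" "conn 2 5"
      by (rule single, simp add: adj_simps)+
    moreover have "conn 0 0" unfolding conn_def by (intro exI[of _ "[]"]) simp
    ultimately show ?thesis using 1 trans[of 4 1 0] trans[of 0 1 4] trans[of 5 2 0] trans[of 0 2 5] by auto
  next
    case (2 l i)
    then have "adj (lit l i) 0" "adj 0 (lit l i)" by (simp_all add: adj_lit adj_to)
    then show ?thesis using 2 by (auto intro!: single)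
  next
    case (3 e)
    then obtain l where l: "l < n" "mem e l" using nonempty by blast
    have "conn (edge e) (lit l 0)" "conn (lit l 0) (edge e)" "conn (lit l 0) 0" "conn 0 (lit l 0)"
      using 3 l by (auto intro!: single simp: adj_edge adj_lit adj_to)
    then show ?thesis using 3 trans by blast
  qed
  fix u v
  assume u: "u \<in> pverts G" and v: "v \<in> pverts G"
  then have "conn u v" using zero[of u] zero[of v] trans by auto
  then show "\<exists>p. pre_digraph.awalk (with_proj G) u p v" unfolding awalk_G conn_def using u by auto
next
  have "0 \<in> pverts G" by simp
  then show "pverts G \<noteq> {}" by blast
qed

lemma D_sym: "D u v = D v u"
  by (auto simp: gadget_bound_def)

text \<open>The middle vertex is the corner to which the pendant vertex \<open>v\<close> is
  attached; it is 0 for the vertices that belong to a hypergraph vertex.\<close>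

lemma bound_2_path: "half_bound_2 n u v \<Longrightarrow> adj u (if v = 4 then 1 else if v = 5 then 2 else 0) \<and> adj (if v = 4 then 1 else if v = 5 then 2 else 0) v"
  by (auto simp: half_bound_2_conv adj_simps)

lemma instance_G: "ditgr_instance (G, D, 2)"
proof -
  have pos: "0 < D u v" for u v by (auto simp: gadget_bound_def zero_enat_def)
  have dist: "static_dist G u v \<le> ereal_of_enat (D u v)" if uv: "u < 6 + 3 * n + m" "v < 6 + 3 * n + m" for u v
  proof -
    have d2: "static_dist G u v \<le> ereal 2" if "adj u w" "adj w v" for w
      using static_dist_le[OF pair_digraph_G, of u "[(u, w), (w, v)]" v] that uv by (simp add: awalk_G)
    have d3: "static_dist G u v \<le> ereal 3" if "adj u w" "adj w w'" "adj w' v" for w w'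
      using static_dist_le[OF pair_digraph_G, of u "[(u, w), (w, w'), (w', v)]" v] that uv by (simp add: awalk_G)
    show ?thesis
    proof (cases "half_bound_2 n u v \<or> half_bound_2 n v u")
      case True
      then have D: "D u v = enat 2" by (simp add: gadget_bound_def)
      from True obtain w where "adj u w \<and> adj w v \<or> adj v w \<and> adj w u" using bound_2_path by blast
      then have "adj u w" "adj w v" using adj_sym[of w u] adj_sym[of v w] by auto
      from d2[OF this] show ?thesis by (simp add: D)
    next
      case not_2: False
      show ?thesis
      proof (cases "half_bound_3 n m u v \<or> half_bound_3 n m v u")
        case True
        with not_2 have D: "D u v = enat 3" by (simp add: gadget_bound_def)
        from True obtain e where e: "e < m" "u = edge e \<and> v = 1 \<or> u = 1 \<and> v = edge e"
          by (auto simp: half_bound_3_conv)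
        obtain l where l: "l < n" "mem e l" using nonempty e(1) by blast
        have adj: "adj (edge e) (lit l 0)" "adj (lit l 0) 0" "adj 0 1" "adj (lit l 0) (edge e)" "adj 0 (lit l 0)" "adj 1 0"
          using e(1) l by (auto simp: adj_simps adj_to)
        from e(2) have "static_dist G u v \<le> ereal 3"
        proof
          assume "u = edge e \<and> v = 1"
          then show ?thesis using adj by (intro d3[of "lit l 0" 0]) simp_all
        next
          assume "u = 1 \<and> v = edge e"
          then show ?thesis using adj by (intro d3[of 0 "lit l 0"]) simp_all
        qed
        then show ?thesis by (simp add: D)
      qed (use not_2 in \<open>simp add: gadget_bound_def\<close>)
    qed
  qed
  have all: "\<forall>u \<in> pverts G. \<forall>v \<in> pverts G. u \<noteq> v \<longrightarrow> D u v > 0 \<and> static_dist G u v \<le> ereal_of_enat (D u v)"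
  proof (intro ballI impI)
    fix u v
    assume "u \<in> pverts G" "v \<in> pverts G"
    then have "u < 6 + 3 * n + m" "v < 6 + 3 * n + m" by simp_all
    from dist[OF this] show "D u v > 0 \<and> static_dist G u v \<le> ereal_of_enat (D u v)"
      by (rule conjI[OF pos])
  qed
  show ?thesis
    by (rule iffD2[OF ditgr_instance.simps conjI[OF pair_digraph_G
      conjI[OF strongly_connected_G conjI[OF zero_less_numeral all]]]])
qed

text \<open>All arcs but those between 0 and 1 join vertices of different colours.\<close>

definition side :: "nat \<Rightarrow> bool" where
  "side v \<longleftrightarrow> v \<in> {2, 3, 4} \<or> (\<exists>l<n. \<exists>i<3. v = lit l i)"

lemma side_simps: "\<not> side 0" "\<not> side 1" "side 2" "side 3" "side 4" "\<not> side 5" "\<not> side (edge e)"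
  "l < n \<Longrightarrow> i < 3 \<Longrightarrow> side (lit l i)"
  by (auto simp: side_def)

lemma side_half_arc: "half_arc n m mem u v \<Longrightarrow> side u = side v \<longleftrightarrow> u = 0 \<and> v = 1"
  unfolding half_arc_conv by (elim disjE exE conjE) (auto simp: side_simps side_simps(2)[unfolded One_nat_def])

lemma side_arc: "adj u v \<Longrightarrow> side u = side v \<longleftrightarrow> (u, v) \<in> {(0, 1), (1, 0)}"
  unfolding gadget_arc_def using side_half_arc[of u v] side_half_arc[of v u] side_simps(1,2) by auto

section \<open>The odd cycles of the gadget\<close>

text \<open>Without the arcs between 0 and 1 the graph is bipartite with the two sides given by
  \<open>side\<close>.\<close>

lemma walk_parity:
  "pcas u p v \<Longrightarrow> \<forall>(a, b) \<in> set p. adj a b \<Longrightarrow> (0, 1) \<notin> set p \<Longrightarrow> (1, 0) \<notin> set p \<Longrightarrow>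
    even (length p) \<longleftrightarrow> side u = side v"
proof (induct p arbitrary: u)
  case (Cons e p)
  then have "adj u (snd e)" "(u, snd e) \<notin> {(0, 1), (1, 0)}" by (cases e; auto)+
  then have "side u \<noteq> side (snd e)" using side_arc by blast
  moreover have "even (length p) \<longleftrightarrow> side (snd e) = side v" using Cons by auto
  ultimately show ?case by auto
qed simp

text \<open>The set \<open>S\<close> can only be left through the cut vertex \<open>c\<close>. This
  excludes that a path which has just left \<open>c\<close> enters a pendant vertex or the part for
  the hypergraph and still reaches a target elsewhere.\<close>

lemma walk_stays:
  "pcas u p v \<Longrightarrow> \<forall>(a, b) \<in> set p. adj a b \<Longrightarrow> c \<notin> snd ` set p \<Longrightarrow> u \<in> S \<Longrightarrow>
    (\<And>a b. a \<in> S \<Longrightarrow> adj a b \<Longrightarrow> b = c \<or> b \<in> S) \<Longrightarrow> v \<in> S"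
proof (induct p arbitrary: u)
  case (Cons e p)
  then have "adj u (snd e)" "snd e \<noteq> c" by (cases e; auto)+
  then have "snd e \<in> S" using Cons.prems(4,5) by blast
  then show ?case using Cons.hyps[of "snd e"] Cons.prems by auto
qed simp

definition "gadget_part = {v. \<exists>l<n. \<exists>i<3. v = lit l i} \<union> {v. \<exists>e<m. v = edge e}"

lemma gadget_part_arc: "a \<in> gadget_part \<Longrightarrow> adj a b \<Longrightarrow> b = 0 \<or> b \<in> gadget_part"
  by (auto simp: gadget_part_def adj_edge adj_lit)

lemma gadget_part_small: "k < 6 \<Longrightarrow> k \<notin> gadget_part"
  by (auto simp: gadget_part_def)

lemma pcas_last: "pcas u p v \<Longrightarrow> p \<noteq> [] \<Longrightarrow> v \<in> snd ` set p"
proof (induct p arbitrary: u)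
  case (Cons e p)
  then show ?case by (cases "p = []") auto
qed simp

text \<open>
  Once the path leaves 0 or 1 through \<open>v\<close>, it cannot return, since both triangle vertices used by the
  removed arc are visited at the ends only.
\<close>

lemma path_1_0:
  assumes "pcas 1 p 0" "\<forall>(a, b) \<in> set p. adj a b" "distinct (1 # map snd p)" "even (length p)"
  shows "p = [(1, 2), (2, 0)]"
proof -
  from assms(1) obtain v q where p: "p = (1, v) # q" by (cases p) auto
  have v: "v = 0 \<or> v = 2 \<or> v = 4" using assms(2) p by (auto simp: adj_simps)
  have q: "pcas v q 0" "\<forall>(a, b) \<in> set q. adj a b" "1 \<notin> snd ` set q" "v \<notin> snd ` set q" "distinct (map snd q)"
    using assms p by auto
  \<comment> \<open>The direct arc would end the path at once, with an odd number of arcs.\<close>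
  have "v \<noteq> 0"
  proof
    assume "v = 0"
    then have "q = []" using q(1,4) pcas_last[of 0 q 0] by auto
    then show False using assms(4) p by simp
  qed
  moreover have "v \<noteq> 4" using walk_stays[OF q(1,2,3), of "{4}"] by (auto simp: adj_4)
  ultimately have v: "v = 2" using v by auto
  with q(1) obtain w r where q': "q = (2, w) # r" by (cases q) auto
  have "w = 0 \<or> w = 5" using q(2,3) q' by (auto simp: adj_2)
  moreover have r: "pcas w r 0" "\<forall>(a, b) \<in> set r. adj a b" "2 \<notin> snd ` set r" "w \<notin> snd ` set r"
    using q q' v by auto
  have "w \<noteq> 5" using walk_stays[OF r(1,2,3), of "{5}"] by (auto simp: adj_5)
  ultimately have "w = 0" by simp
  then have "r = []" using r(1,4) pcas_last[of 0 r 0] by auto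
  then show ?thesis using p q' v \<open>w = 0\<close> by simp
qed

lemma path_0_1:
  assumes "pcas 0 p 1" "\<forall>(a, b) \<in> set p. adj a b" "distinct (0 # map snd p)" "even (length p)"
  shows "p = [(0, 2), (2, 1)]"
proof -
  from assms(1) obtain v q where p: "p = (0, v) # q" by (cases p) auto
  have v: "v = 1 \<or> v = 2 \<or> v = 3 \<or> v \<in> gadget_part" using assms(2) p by (auto simp: adj_0 gadget_part_def)
  have q: "pcas v q 1" "\<forall>(a, b) \<in> set q. adj a b" "0 \<notin> snd ` set q" "v \<notin> snd ` set q" "distinct (map snd q)"
    using assms p by auto
  have "v \<noteq> 1"
  proof
    assume "v = 1"
    then have "q = []" using q(1,4) pcas_last[of 1 q 1] by auto
    then show False using assms(4) p by simp
  qed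
  moreover have "v \<noteq> 3" using walk_stays[OF q(1,2,3), of "{3}"] by (auto simp: adj_3)
  moreover have "v \<notin> gadget_part"
    using walk_stays[OF q(1,2,3), of gadget_part] gadget_part_arc gadget_part_small[of 1] by auto
  ultimately have v: "v = 2" using v by auto
  with q(1) obtain w r where q': "q = (2, w) # r" by (cases q) auto
  have "w = 1 \<or> w = 5" using q(2,3) q' by (auto simp: adj_2)
  moreover have r: "pcas w r 1" "\<forall>(a, b) \<in> set r. adj a b" "2 \<notin> snd ` set r" "w \<notin> snd ` set r"
    using q q' v by auto
  have "w \<noteq> 5" using walk_stays[OF r(1,2,3), of "{5}"] by (auto simp: adj_5)
  ultimately have "w = 1" by simp
  then have "r = []" using r(1,4) pcas_last[of 1 r 1] by auto
  then show ?thesis using p q' v \<open>w = 1\<close> by simp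
qed

text \<open>A cycle is cut open at one of its arcs, so that statements about paths apply to the
  rest.\<close>

lemma rotate_cycle:
  assumes "pcas u p u" "(a, b) \<in> set p" "distinct (map snd p)"
  obtains q where "pcas b q a" "distinct (b # map snd q)" "set p = insert (a, b) (set q)" "length p = Suc (length q)"
proof -
  from assms(2) obtain p1 p2 where p: "p = p1 @ (a, b) # p2" by (meson split_list)
  show ?thesis
  proof (rule that[of "p2 @ p1"])
    show "pcas b (p2 @ p1) a" using assms(1) p by (auto simp: pcas_append)
  qed (use assms(3) p in auto)
qed

text \<open>By parity an odd cycle uses an arc between 0 and 1. The rest of it is a path with an
  even number of arcs between these two vertices, and such a path has to pass through 2.\<close>

lemma odd_cycles_G: "odd_cycles G = {{{0, 1}, {1, 2}, {0, 2}}}"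
proof
  have sym: "parcs (mk_symmetric (with_proj G)) = parcs G" "pverts (mk_symmetric (with_proj G)) = pverts G"
    using adj_sym by (auto simp: parcs_mk_symmetric)
  show "odd_cycles G \<subseteq> {{{0, 1}, {1, 2}, {0, 2}}}"
  proof
    fix C
    assume "C \<in> odd_cycles G"
    then obtain p u where C: "C = (\<lambda>(u, v). {u, v}) ` set p" and "odd (length p)"
      and p: "set p \<subseteq> parcs G" "pcas u p u" "distinct (map snd p)"
      unfolding odd_cycles_def cycle_pair sym by blast
    have arcs: "\<forall>(a, b) \<in> set p. adj a b" using p(1) by (auto simp: subset_iff)
    then consider "(0, 1) \<in> set p" | "(1, 0) \<in> set p"
      using walk_parity[OF p(2)] \<open>odd (length p)\<close> by auto
    then show "C \<in> {{{0, 1}, {1, 2}, {0, 2}}}"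
    proof cases
      case 1
      from rotate_cycle[OF p(2) 1 p(3)] obtain q where q: "pcas 1 q 0" "distinct (1 # map snd q)"
        "set p = insert (0, 1) (set q)" "length p = Suc (length q)" .
      have "q = [(1, 2), (2, 0)]" using q arcs \<open>odd (length p)\<close> by (intro path_1_0) auto
      then show ?thesis using C q(3) by auto
    next
      case 2
      from rotate_cycle[OF p(2) 2 p(3)] obtain q where q: "pcas 0 q 1" "distinct (0 # map snd q)"
        "set p = insert (1, 0) (set q)" "length p = Suc (length q)" .
      have "q = [(0, 2), (2, 1)]" using q arcs \<open>odd (length p)\<close> by (intro path_0_1) auto
      then show ?thesis using C q(3) by auto
    qed
  qed
  have "pre_digraph.cycle (with_proj (mk_symmetric (with_proj G))) [(0, 1), (1, 2), (2, 0)]"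
    unfolding cycle_pair sym by (intro bexI[of _ 0]) (auto simp: adj_simps)
  then have "(\<lambda>(u, v). {u, v}) ` set [(0, 1), (1, 2), (2, 0)] \<in> odd_cycles G"
    unfolding odd_cycles_def mem_Collect_eq by (intro exI[of _ "[(0, 1), (1, 2), (2, 0)]"] conjI refl) simp_all
  then show "{{{0, 1}, {1, 2}, {0, 2}}} \<subseteq> odd_cycles G"
    by (simp add: insert_commute)
qed

lemma restricted_G: "ditgr_restricted (G, D, 2)"
proof -
  have "card {{0, 1}, {1, 2}, {0, 2 :: nat}} = 3"
    by (simp add: doubleton_eq_iff)
  then show ?thesis using D_sym symmetric_G odd_cycles_G by (auto simp: only_odd_cycle_is_triangle_def)
qed

section \<open>Labelings and colourings correspond\<close>

definition colourable :: bool where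
  "colourable \<longleftrightarrow> (\<exists>col. \<forall>e<m. (\<exists>l<n. mem e l \<and> col l) \<and> (\<exists>l<n. mem e l \<and> \<not> col l))"

lemma yes_imp_colourable:
  assumes "ditgr_yes (G, D, 2)"
  shows colourable
proof -
  from assms obtain lab where lab: "periodic_labeling G 2 lab"
    and dur: "\<And>u v. u < 6 + 3 * n + m \<Longrightarrow> v < 6 + 3 * n + m \<Longrightarrow> u \<noteq> v \<Longrightarrow> fastest_duration G 2 lab u v \<le> D u v"
    by auto
  interpret two_periodic G lab by (rule two_periodic.intro[OF pair_digraph_G lab])
  have bit: "lab (u, v) = 0 \<or> lab (u, v) = 1" if "adj u v" for u v using lab_cases[of "(u, v)"] that by simp
  have bound_2: "\<exists>w. adj u w \<and> adj w v \<and> lab (u, w) \<noteq> lab (w, v)"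
    if "half_bound_2 n u v \<or> half_bound_2 n v u" "u \<noteq> v" "\<not> adj u v" for u v
  proof -
    have "u < 6 + 3 * n + m" "v < 6 + 3 * n + m" using that(1) by (auto simp: half_bound_2_def)
    then have "fastest_duration G 2 lab u v \<le> enat 2" using dur[of u v] that by (simp add: gadget_bound_def)
    from duration_2D[OF this] that show ?thesis by auto
  qed
  have pend: "lab (3, 0) \<noteq> lab (0, 1)" "lab (3, 0) \<noteq> lab (0, 2)" "lab (1, 0) \<noteq> lab (0, 3)" "lab (2, 0) \<noteq> lab (0, 3)"
    "lab (4, 1) \<noteq> lab (1, 0)" "lab (4, 1) \<noteq> lab (1, 2)" "lab (0, 1) \<noteq> lab (1, 4)" "lab (2, 1) \<noteq> lab (1, 4)"
    "lab (5, 2) \<noteq> lab (2, 0)" "lab (5, 2) \<noteq> lab (2, 1)" "lab (0, 2) \<noteq> lab (2, 5)" "lab (1, 2) \<noteq> lab (2, 5)"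
    using bound_2[of 3 1] bound_2[of 3 2] bound_2[of 1 3] bound_2[of 2 3]
      bound_2[of 4 0] bound_2[of 4 2] bound_2[of 0 4] bound_2[of 2 4]
      bound_2[of 5 0] bound_2[of 5 1] bound_2[of 0 5] bound_2[of 1 5]
    by (auto simp: half_bound_2_conv adj_simps adj_to)
  have "adj 0 1" "adj 1 0" "adj 0 2" "adj 2 0" "adj 1 2" "adj 2 1" "adj 0 3" "adj 3 0" "adj 1 4" "adj 4 1" "adj 2 5" "adj 5 2"
    by (simp_all add: adj_simps)
  \<comment> \<open>Arcs of the triangle that leave the same corner have equal labels, and so have
    those that enter the same corner. The chain is (0,1), (2,1), (2,0), (1,0).\<close>
  then have "lab (0, 1) = lab (1, 0)" using pend bit by (smt (verit))
  have lits: "lab (0, lit l 0) \<noteq> lab (lit l 0, 0)" if l: "l < n" for l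
  proof -
    have "lab (lit l i, 0) \<noteq> lab (0, lit l j)" if "i < 3" "j < 3" "i \<noteq> j" for i j
      using bound_2[of "lit l i" "lit l j"] l that
      by (auto simp: half_bound_2_conv adj_lit adj_to split: if_splits)
    \<comment> \<open>Two vertices would only compare the arc from one to 0 with the arc from 0 to
      the other. With three, vertices 0 and 2 send at the same time because both differ from the
      time at which 1 receives, and 2 sends at a time different from that at which 0
      receives.\<close>
    from this[of 0 1] this[of 2 1] this[of 2 0] show ?thesis
      using bit[of "lit l 0" 0] bit[of "lit l 2" 0] bit[of 0 "lit l 1"] bit[of 0 "lit l 0"] l
      by (auto simp: adj_lit adj_to)
  qed
  have clause: "\<exists>l<n. mem e l \<and> lab (lit l 0, 0) \<noteq> lab (0, 1)" "\<exists>l<n. mem e l \<and> lab (1, 0) \<noteq> lab (0, lit l 0)"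
    if e: "e < m" for e
  proof -
    have v: "edge e < 6 + 3 * n + m" using e by (simp add: edge_def)
    have D: "D (edge e) 1 = enat 3" "D 1 (edge e) = enat 3"
      using e by (auto simp: gadget_bound_def half_bound_2_conv half_bound_3_conv)
    have na: "\<not> adj (edge e) 1" "\<not> adj 1 (edge e)" by (auto simp: adj_simps)
    have nn: "adj (edge e) w \<Longrightarrow> \<not> adj w 1" "adj 1 w \<Longrightarrow> \<not> adj w (edge e)" for w
      by (auto simp: adj_edge adj_lit adj_simps)
    have "fastest_duration G 2 lab (edge e) 1 \<le> enat 3" using dur[of "edge e" 1] v D by simp
    then obtain w w' where "adj (edge e) w" "adj w w'" "adj w' 1" "lab (w, w') \<noteq> lab (w', 1)"
      by (rule duration_3D) (use na nn in auto)
    then show "\<exists>l<n. mem e l \<and> lab (lit l 0, 0) \<noteq> lab (0, 1)" by (auto simp: adj_edge adj_lit)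
    have "fastest_duration G 2 lab 1 (edge e) \<le> enat 3" using dur[of 1 "edge e"] v D by simp
    then obtain w w' where "adj 1 w" "adj w w'" "adj w' (edge e)" "lab (1, w) \<noteq> lab (w, w')"
      by (rule duration_3D) (use na nn in auto)
    then show "\<exists>l<n. mem e l \<and> lab (1, 0) \<noteq> lab (0, lit l 0)"
      using na(2) nn(2) by (auto simp: adj_to adj_simps)
  qed
  show colourable unfolding colourable_def
  proof (intro exI[of _ "\<lambda>l. lab (lit l 0, 0) = lab (0, 1)"] allI impI conjI)
    fix e assume e: "e < m"
    from clause(1)[OF e] show "\<exists>l<n. mem e l \<and> lab (lit l 0, 0) \<noteq> lab (0, 1)" .
    from clause(2)[OF e] obtain l where l: "l < n" "mem e l" "lab (1, 0) \<noteq> lab (0, lit l 0)" by blast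
    \<comment> \<open>A member that does not receive at the time of (1,0) sends at this time, which
      is also that of (0,1).\<close>
    then have "lab (lit l 0, 0) = lab (0, 1)"
      using lits[OF l(1)] \<open>lab (0, 1) = lab (1, 0)\<close> bit[of "lit l 0" 0] bit[of 0 "lit l 0"] bit[of 1 0]
      by (auto simp: adj_lit adj_to adj_simps)
    then show "\<exists>l<n. mem e l \<and> lab (lit l 0, 0) = lab (0, 1)" using l by blast
  qed
qed

lemma colourable_imp_yes:
  assumes colourable
  shows "ditgr_yes (G, D, 2)"
proof -
  from assms obtain col where col: "\<And>e. e < m \<Longrightarrow> \<exists>l<n. mem e l \<and> col l" "\<And>e. e < m \<Longrightarrow> \<exists>l<n. mem e l \<and> \<not> col l"
    by (auto simp: colourable_def)
  define is_lit where "is_lit v \<longleftrightarrow> (\<exists>l<n. \<exists>i<3. v = lit l i)" for v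
  define c :: "nat \<Rightarrow> nat" where "c v = (if col ((v - 6) div 3) then 0 else 1)" for v
  \<comment> \<open>All arcs leaving a vertex of \<open>l\<close> get its colour and all arcs
    entering it the opposite label, so the labels alternate at it, also on the way from and to a
    hyperedge. Triangle arcs get 0 and pendant arcs 1.\<close>
  define lab where "lab = (\<lambda>(u, v). if is_lit u then c u else if is_lit v then 1 - c v else if u < 3 \<and> v < 3 then 0 else 1)"
  have c: "c (lit l i) = (if col l then 0 else 1)" if "i < 3" for l i using that by (simp add: c_def lit_def)
  have is_lit: "l < n \<Longrightarrow> i < 3 \<Longrightarrow> is_lit (lit l i)" "k < 6 \<Longrightarrow> \<not> is_lit k" "\<not> is_lit (edge e)" for l i k e
    unfolding is_lit_def by auto
  have labeling: "periodic_labeling G 2 lab" by (auto simp: periodic_labeling_def lab_def c_def)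
  interpret two_periodic G lab by (rule two_periodic.intro[OF pair_digraph_G labeling])
  have d2: "fastest_duration G 2 lab u v \<le> enat 2" if uv: "u \<noteq> v" "half_bound_2 n u v \<or> half_bound_2 n v u" for u v
  proof -
    let ?w = "if v = 4 \<or> u = 4 then 1 else if v = 5 \<or> u = 5 then 2 else 0 :: nat"
    define P :: "(nat \<times> nat) set" where "P = {(1, 3), (2, 3), (0, 4), (2, 4), (0, 5), (1, 5), (3, 1), (3, 2), (4, 0), (4, 2), (5, 0), (5, 1)}"
    have half: "(a, b) \<in> P \<and> (b, a) \<in> P \<or> (\<exists>l i j. l < n \<and> i < 3 \<and> j < 3 \<and> a = lit l i \<and> b = lit l j)"
      if "half_bound_2 n a b" for a b
      using that unfolding half_bound_2_conv by (elim disjE insertE) (auto simp: P_def)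
    have "(u, v) \<in> P \<or> (\<exists>l i j. l < n \<and> i < 3 \<and> j < 3 \<and> u = lit l i \<and> v = lit l j)"
      using uv(2)
    proof
      assume "half_bound_2 n u v"
      from half[OF this] show ?thesis by blast
    next
      assume "half_bound_2 n v u"
      from half[OF this] show ?thesis by blast
    qed
    then consider "(u, v) \<in> P" | l i j where "l < n" "i < 3" "j < 3" "u = lit l i" "v = lit l j" by blast
    then have "adj u ?w \<and> adj ?w v \<and> distinct [u, ?w, v] \<and> lab (u, ?w) \<noteq> lab (?w, v)"
    proof cases
      case 1
      then show ?thesis unfolding P_def by (elim insertE) (simp_all add: lab_def is_lit adj_simps)
    next
      case 2
      have "u \<noteq> 4" "u \<noteq> 5" "v \<noteq> 4" "v \<noteq> 5" using 2 by simp_all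
      then have "?w = 0" by simp
      moreover have "i \<noteq> j" using uv(1) 2 by auto
      ultimately show ?thesis using 2 by (simp add: lab_def is_lit c adj_lit adj_to)
    qed
    then show ?thesis by (intro duration_2[of u ?w v]) simp_all
  qed
  have "fastest_duration G 2 lab (edge e) 1 \<le> enat 3 \<and> fastest_duration G 2 lab 1 (edge e) \<le> enat 3" if e: "e < m" for e
  proof
    have adj: "adj (edge e) (lit l 0)" "adj (lit l 0) (edge e)" "adj 0 (lit l 0)" "adj (lit l 0) 0" "adj 1 0" "adj 0 1"
      if "l < n" "mem e l" for l
      using that e by (auto simp: adj_simps adj_to)
    from col(2)[OF e] obtain l where l: "l < n" "mem e l" "\<not> col l" by blast
    show "fastest_duration G 2 lab (edge e) 1 \<le> enat 3"
      by (rule duration_3[of _ "lit l 0" 0]) (use adj[OF l(1,2)] l(1,3) in \<open>simp_all add: lab_def is_lit c\<close>)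
    from col(1)[OF e] obtain l where l: "l < n" "mem e l" "col l" by blast
    show "fastest_duration G 2 lab 1 (edge e) \<le> enat 3"
      by (rule duration_3[of _ 0 "lit l 0"]) (use adj[OF l(1,2)] l(1,3) in \<open>simp_all add: lab_def is_lit c\<close>)
  qed
  then have "fastest_duration G 2 lab u v \<le> D u v" if "u \<noteq> v" for u v
    using d2[OF that] by (auto simp: gadget_bound_def half_bound_3_conv)
  then show ?thesis using labeling by auto
qed

theorem yes_iff_colourable: "ditgr_yes (G, D, 2) \<longleftrightarrow> colourable"
  using yes_imp_colourable colourable_imp_yes by blast

end

section \<open>Hypergraph 2-colouring as a source of reductions\<close>

lemma delimit_Nil [simp]: "delimit [] = [False]"
  and delimit_Cons [simp]: "delimit (b # x) = True # b # delimit x"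
  by (simp_all add: delimit_def)

lemma delimit_prefix_free: "delimit a @ r = delimit b @ s \<longleftrightarrow> a = b \<and> r = s"
proof (induct a arbitrary: b)
  case Nil
  then show ?case by (cases b) auto
next
  case (Cons c a)
  then show ?case by (cases b) auto
qed

fun bits_value :: "bool list \<Rightarrow> nat" where
  "bits_value [] = 0"
| "bits_value (b # bs) = of_bool b + 2 * bits_value bs"

lemma bits_value_binary [simp]: "bits_value (binary n) = n"
proof (induct n rule: binary.induct)
  case (1 n)
  then show ?case by (subst binary.simps) (auto elim!: oddE)
qed

lemma binary_eq [simp]: "binary m = binary n \<longleftrightarrow> m = n"
  by (metis bits_value_binary)

lemma encode_nat_prefix_free: "encode_nat a @ r = encode_nat b @ s \<longleftrightarrow> a = b \<and> r = s"
  by (simp add: encode_nat_def delimit_prefix_free)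

lemma encode_enat_prefix_free: "encode_enat a @ r = encode_enat b @ s \<longleftrightarrow> a = b \<and> r = s"
  by (cases a; cases b) (auto simp: encode_enat_def encode_nat_prefix_free)

lemma concat_encode_enat_eq:
  "concat (map (\<lambda>p. encode_enat (f p)) ps) @ r = concat (map (\<lambda>p. encode_enat (g p)) ps) @ s \<longleftrightarrow>
    (\<forall>p \<in> set ps. f p = g p) \<and> r = s"
  by (induct ps) (auto simp: encode_enat_prefix_free)

lemma unary_prefix_free:
  "replicate m True @ False # r = replicate n True @ False # s \<longleftrightarrow> m = n \<and> r = s"
proof (induct m arbitrary: n)
  case 0
  then show ?case by (cases n) auto
next
  case (Suc m)
  then show ?case by (cases n) auto
qed

lemma map_append_eq: "map f ps @ r = map g ps @ s \<longleftrightarrow> (\<forall>p \<in> set ps. f p = g p) \<and> r = s"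
  by (induct ps) auto

text \<open>Every field of the code is self-delimiting or has a length fixed by earlier fields, so
  the fields can be compared one after the other. Entries of the matrix outside the vertex set leave
  no trace in the code.\<close>

lemma encode_eqD:
  assumes eq: "encode (G, D, \<Delta>) = encode (G', D', \<Delta>')"
    and I: "encodable (G, D, \<Delta>)" and I': "encodable (G', D', \<Delta>')"
  shows "G = G'" "\<Delta> = \<Delta>'" "\<And>u v. u \<in> pverts G \<Longrightarrow> v \<in> pverts G \<Longrightarrow> D u v = D' u v"
proof -
  from I I' obtain n n' where n: "pverts G = {..<n}" "pverts G' = {..<n'}" by (auto simp: encodable_def)
  have sub: "parcs H \<subseteq> pverts H \<times> pverts H" if "pair_digraph H" for H :: "nat pair_pre_digraph"
  proof -
    interpret pair_digraph H by fact
    show ?thesis using wellformed' by auto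
  qed
  have arcs: "parcs G \<subseteq> {..<n} \<times> {..<n}" "parcs G' \<subseteq> {..<n'} \<times> {..<n'}"
    using I I' sub[of G] sub[of G'] n by (auto simp: encodable_def)
  have dist: "(\<lambda>(u, v). encode_enat (E u v)) = (\<lambda>p. encode_enat (case p of (u, v) \<Rightarrow> E u v))" for E :: "nat \<Rightarrow> nat \<Rightarrow> enat"
    by auto
  have last: "encode_nat \<Delta> = encode_nat \<Delta> @ []" "encode_nat \<Delta>' = encode_nat \<Delta>' @ []" by simp_all
  have n': "n = n'" using eq by (simp add: Let_def n unary_prefix_free)
  with eq have eq: "(\<forall>p \<in> {..<n} \<times> {..<n}. p \<in> parcs G \<longleftrightarrow> p \<in> parcs G') \<and>
      (\<forall>p \<in> {..<n} \<times> {..<n}. (case p of (u, v) \<Rightarrow> D u v) = (case p of (u, v) \<Rightarrow> D' u v)) \<and> \<Delta> = \<Delta>'"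
    by (simp add: Let_def n unary_prefix_free map_append_eq dist concat_encode_enat_eq atLeast0LessThan encode_nat_def
       del: Product_Type.split_paired_Ball_Sigma)
       (metis append_Nil2 delimit_prefix_free binary_eq)
  show "\<Delta> = \<Delta>'" using eq by simp
  have "parcs G = parcs G'" using eq arcs n' by blast
  then show "G = G'" using n n' by simp
  show "D u v = D' u v" if "u \<in> pverts G" "v \<in> pverts G" for u v using eq n that by auto
qed

text \<open>\<open>DiTGR\<close> is an image, so it must be excluded that a no-instance shares its
  code with a yes-instance. Two instances with the same code agree in all that
  \<open>ditgr_yes\<close> depends on.\<close>

lemma encode_in_DiTGR:
  assumes "encodable I"
  shows "encode I \<in> DiTGR \<longleftrightarrow> ditgr_yes I"
proof
  assume "encode I \<in> DiTGR"
  then obtain I' where I': "encode I = encode I'" "encodable I'" "ditgr_yes I'" by (auto simp: DiTGR_def)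
  obtain G D \<Delta> where I: "I = (G, D, \<Delta>)" by (cases I)
  obtain G' D' \<Delta>' where I'': "I' = (G', D', \<Delta>')" by (cases I')
  have e: "encode (G', D', \<Delta>') = encode (G, D, \<Delta>)" using I' I I'' by simp
  note eq = encode_eqD[OF e, of, OF I'(2)[unfolded I''] assms[unfolded I]]
  show "ditgr_yes I" using I'(3) eq unfolding I I'' by auto
qed (use assms in \<open>auto simp: DiTGR_def\<close>)

section \<open>Writing down the instance of a hypergraph\<close>

lemma proj_unit [pf_intros]: "proj (\<lambda>e. ())"
  unfolding proj_def by (intro exI[of _ "[]"]) simp

lemma pf_list_const [pf_intros]: "pf_list (\<lambda>x e. xs)"
proof (induct xs)
  case (Cons b xs)
  then show ?case by (intro pf_intros)
qed (rule pf_list_Nil)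

text \<open>Nested loops replace \<open>List.product\<close>; this is the form that
  \<open>pf_list_concat\<close> handles.\<close>

lemma encode_conv:
  assumes "pverts G = {..<n}"
  shows "encode (G, D, \<Delta>) = map (\<lambda>i. True) [0..<n] @ [False] @
    concat (map (\<lambda>u. map (\<lambda>v. (u, v) \<in> parcs G) [0..<n]) [0..<n]) @
    concat (map (\<lambda>u. concat (map (\<lambda>v. encode_enat (D u v)) [0..<n])) [0..<n]) @ encode_nat \<Delta>"
proof -
  have 1: "map f (List.product xs ys) = concat (map (\<lambda>u. map (\<lambda>v. f (u, v)) ys) xs)"
    for f :: "nat \<times> nat \<Rightarrow> 'a" and xs ys
    by (induct xs) auto
  have 2: "concat (concat (map f xs)) = concat (map (\<lambda>u. concat (f u)) xs)" for f :: "nat \<Rightarrow> 'a list list" and xs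
    by (induct xs) auto
  have 3: "replicate n True = map (\<lambda>i. True) [0..<n]" by (simp add: map_replicate_const)
  show ?thesis using assms by (simp add: Let_def 1 2 3)
qed

text \<open>This isolates what a source problem has to supply: polynomially many vertices and edges,
  and a computable incidence relation.\<close>

theorem hypergraph_reduction:
  assumes n: "pf (\<lambda>x (e :: unit). n x)" and m: "pf (\<lambda>x (e :: unit). m x)"
    and mem: "pf (\<lambda>x (p :: nat \<times> nat). of_bool (mem x (fst p) (snd p)))"
    and nonempty: "\<And>x e. e < m x \<Longrightarrow> \<exists>l<n x. mem x e l"
    and B: "\<And>x. x \<in> B \<longleftrightarrow> hypergraph.colourable (n x) (m x) (mem x)"
  shows "\<exists>f. polytime_computable f \<and> (\<forall>x. f x \<in> DiTGR_restricted_instances \<and> (x \<in> B \<longleftrightarrow> f x \<in> DiTGR))"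
proof -
  let ?I = "\<lambda>x. (gadget_graph (n x) (m x) (mem x), gadget_bound (n x) (m x), 2 :: nat)"
  have H: "hypergraph (n x) (m x) (mem x)" for x using nonempty by unfold_locales
  have enc: "encodable (?I x)" for x
    using hypergraph.instance_G[OF H] by (auto simp: encodable_def gadget_graph_def)
  have pn: "pf (\<lambda>x (e :: 'e::env). n x)" using pf_weaken[OF n proj_unit] by simp
  have pm: "pf (\<lambda>x (e :: 'e::env). m x)" using pf_weaken[OF m proj_unit] by simp
  have pmem: "pf (\<lambda>x e. of_bool (mem x (F x e) (G x e)))" if "pf F" "pf G" for F G :: "bool list \<Rightarrow> 'e::env \<Rightarrow> nat"
    using pf_comp2[of "\<lambda>x a b. of_bool (mem x a b)", OF mem that] .
  have arc: "pf (\<lambda>x (p :: (unit \<times> nat) \<times> nat). of_bool (gadget_arc (n x) (m x) (mem x) (snd (fst p)) (snd p)))"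
    unfolding gadget_arc_def half_arc_def by (intro pf_intros pmem pn pm)
  have bound: "pf_list (\<lambda>x (p :: (unit \<times> nat) \<times> nat). encode_enat (gadget_bound (n x) (m x) (snd (fst p)) (snd p)))"
  proof -
    have "encode_enat (gadget_bound a b u v) = (if half_bound_2 a u v \<or> half_bound_2 a v u then encode_enat 2 
      else if half_bound_3 a b u v \<or> half_bound_3 a b v u then encode_enat 3 else encode_enat \<infinity>)" for a b u v
      by (simp add: gadget_bound_def numeral_eq_enat)
    then show ?thesis unfolding half_bound_2_def half_bound_3_def
      by (simp only:) (intro pf_intros pn pm)
  qed
  have "encode (?I x) = map (\<lambda>i. True) [0..<6 + 3 * n x + m x] @ [False] @
    concat (map (\<lambda>u. map (\<lambda>v. gadget_arc (n x) (m x) (mem x) u v) [0..<6 + 3 * n x + m x]) [0..<6 + 3 * n x + m x]) @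
    concat (map (\<lambda>u. concat (map (\<lambda>v. encode_enat (gadget_bound (n x) (m x) u v)) [0..<6 + 3 * n x + m x]))
      [0..<6 + 3 * n x + m x]) @ encode_nat 2" for x
    by (subst encode_conv[of _ "6 + 3 * n x + m x"]) (simp_all add: gadget_graph_def del: upt_Suc)
  then have "pf_list (\<lambda>x (e :: unit). encode (?I x))"
    by (simp only:) (intro pf_intros pn pm arc bound)
  then have "polytime_computable (\<lambda>x. encode (?I x))" by (rule pf_list_polytime)
  moreover have "encode (?I x) \<in> DiTGR_restricted_instances" for x
    unfolding DiTGR_restricted_instances_def using enc hypergraph.restricted_G[OF H] by (intro imageI CollectI conjI)
  moreover have "x \<in> B \<longleftrightarrow> encode (?I x) \<in> DiTGR" for x
    using encode_in_DiTGR[OF enc] hypergraph.yes_iff_colourable[OF H] B by simp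
  ultimately show ?thesis by blast
qed

text \<open>Truth of variable \<open>v\<close> is encoded as: the colour of \<open>2 * v\<close> differs from that of the vertex \<open>2 * nv\<close>.\<close>

definition clause_edges :: "nat \<Rightarrow> (nat \<Rightarrow> bool) \<Rightarrow> (nat \<Rightarrow> nat \<Rightarrow> bool) \<Rightarrow> (nat \<Rightarrow> nat \<Rightarrow> bool) \<Rightarrow> nat \<Rightarrow> nat \<Rightarrow> bool" where
  "clause_edges nv valid premise concl e l \<longleftrightarrow>
     e < nv \<and> (l = 2 * e \<or> l = 2 * e + 1) \<or>
     nv \<le> e \<and> valid (e - nv) \<and>
       (l = 2 * nv \<or> (\<exists>v<nv. l = 2 * v \<and> concl (e - nv) v) \<or> (\<exists>v<nv. l = 2 * v + 1 \<and> premise (e - nv) v)) \<or>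
     nv \<le> e \<and> \<not> valid (e - nv) \<and> l < 2"

text \<open>A number that codes no clause gets the pair 0, 1. This repeats the edge of variable 0
  and adds no constraint.\<close>

lemma clause_edges_nonempty:
  assumes "nv > 0"
  shows "\<exists>l<2 * nv + 1. clause_edges nv valid premise concl e l"
proof -
  consider "e < nv" | "nv \<le> e" "valid (e - nv)" | "nv \<le> e" "\<not> valid (e - nv)" by linarith
  then show ?thesis
  proof cases
    case 1
    then show ?thesis by (intro exI[of _ "2 * e"]) (simp add: clause_edges_def)
  next
    case 2
    then show ?thesis by (intro exI[of _ "2 * nv"]) (simp add: clause_edges_def)
  next
    case 3
    then show ?thesis by (intro exI[of _ 0]) (simp add: clause_edges_def)
  qed
qed

text \<open>Swapping the colours preserves 2-colourings, so truth is only defined relative to the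
  vertex \<open>2 * nv\<close>. It belongs to every clause edge, which is thus not monochromatic iff
  one of its literals differs from it. The pair edges make \<open>2 * v\<close> and
  \<open>2 * v + 1\<close> complementary.\<close>

lemma clause_edges_colourable:
  assumes nv: "nv > 0"
  shows "hypergraph.colourable (2 * nv + 1) (nv + nc) (clause_edges nv valid premise concl) \<longleftrightarrow>
    (\<exists>\<alpha>. \<forall>c<nc. valid c \<longrightarrow> (\<forall>v<nv. premise c v \<longrightarrow> \<alpha> v) \<longrightarrow> (\<exists>v<nv. concl c v \<and> \<alpha> v))"
proof -
  let ?mem = "clause_edges nv valid premise concl"
  interpret hypergraph "2 * nv + 1" "nv + nc" ?mem
    by unfold_locales (rule clause_edges_nonempty[OF nv])
  show ?thesis
  proof
    assume colourable
    then obtain col where col: "\<And>e. e < nv + nc \<Longrightarrow> \<exists>l<2 * nv + 1. ?mem e l \<and> col l"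
      "\<And>e. e < nv + nc \<Longrightarrow> \<exists>l<2 * nv + 1. ?mem e l \<and> \<not> col l"
      unfolding colourable_def by blast
    have pair: "col (2 * v) \<noteq> col (2 * v + 1)" if "v < nv" for v
      using col[of v] that by (auto simp: clause_edges_def)
    have "\<exists>v<nv. concl c v \<and> col (2 * v) \<noteq> col (2 * nv)"
      if c: "c < nc" "valid c" and pre: "\<forall>v<nv. premise c v \<longrightarrow> col (2 * v) \<noteq> col (2 * nv)" for c
    proof -
      obtain l where l: "?mem (nv + c) l" "col l \<noteq> col (2 * nv)"
        using col[of "nv + c"] c(1) by (cases "col (2 * nv)") auto
      from l(1) c(2) have "l = 2 * nv \<or> (\<exists>v<nv. l = 2 * v \<and> concl c v) \<or> (\<exists>v<nv. l = 2 * v + 1 \<and> premise c v)"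
        by (simp add: clause_edges_def)
      then show ?thesis using l(2) pre pair by auto
    qed
    then show "\<exists>\<alpha>. \<forall>c<nc. valid c \<longrightarrow> (\<forall>v<nv. premise c v \<longrightarrow> \<alpha> v) \<longrightarrow> (\<exists>v<nv. concl c v \<and> \<alpha> v)"
      by (intro exI[of _ "\<lambda>v. col (2 * v) \<noteq> col (2 * nv)"]) blast
  next
    assume "\<exists>\<alpha>. \<forall>c<nc. valid c \<longrightarrow> (\<forall>v<nv. premise c v \<longrightarrow> \<alpha> v) \<longrightarrow> (\<exists>v<nv. concl c v \<and> \<alpha> v)"
    then obtain \<alpha> where \<alpha>: "\<And>c. c < nc \<Longrightarrow> valid c \<Longrightarrow> (\<forall>v<nv. premise c v \<longrightarrow> \<alpha> v) \<Longrightarrow> (\<exists>v<nv. concl c v \<and> \<alpha> v)"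
      by blast
    define col where "col l \<longleftrightarrow> l < 2 * nv \<and> (\<alpha> (l div 2) \<longleftrightarrow> even l)" for l
    have col: "v < nv \<Longrightarrow> col (2 * v) = \<alpha> v" "v < nv \<Longrightarrow> col (2 * v + 1) = (\<not> \<alpha> v)" "\<not> col (2 * nv)" for v
      by (auto simp: col_def)
    have "(\<exists>l<2 * nv + 1. ?mem e l \<and> col l) \<and> (\<exists>l<2 * nv + 1. ?mem e l \<and> \<not> col l)" if e: "e < nv + nc" for e
    proof -
      have pair: "(\<exists>l<2 * nv + 1. ?mem e l \<and> col l) \<and> (\<exists>l<2 * nv + 1. ?mem e l \<and> \<not> col l)"
        if "v < nv" "?mem e (2 * v)" "?mem e (2 * v + 1)" for v
        using that col(1,2)[of v] by (cases "\<alpha> v") (auto intro: exI[of _ "2 * v"] exI[of _ "2 * v + 1"])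
      consider "e < nv" | "nv \<le> e" "valid (e - nv)" | "nv \<le> e" "\<not> valid (e - nv)" by linarith
      then show ?thesis
      proof cases
        case 1
        then show ?thesis by (intro pair[of e]) (simp_all add: clause_edges_def)
      next
        case 3
        then show ?thesis using nv by (intro pair[of 0]) (simp_all add: clause_edges_def)
      next
        case 2
        let ?c = "e - nv"
        have "\<exists>l<2 * nv + 1. ?mem e l \<and> col l"
        proof (cases "\<forall>v<nv. premise ?c v \<longrightarrow> \<alpha> v")
          case True
          have "?c < nc" using 2 e by linarith
          with True obtain v where "v < nv" "concl ?c v" "\<alpha> v" using \<alpha>[of ?c] 2 by auto
          then show ?thesis using 2 col by (intro exI[of _ "2 * v"]) (auto simp: clause_edges_def)
        next
          case False
          then obtain v where "v < nv" "premise ?c v" "\<not> \<alpha> v" by blast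
          then show ?thesis using 2 col by (intro exI[of _ "2 * v + 1"]) (auto simp: clause_edges_def)
        qed
        moreover have "\<exists>l<2 * nv + 1. ?mem e l \<and> \<not> col l"
          using 2 col by (intro exI[of _ "2 * nv"]) (simp add: clause_edges_def)
        ultimately show ?thesis ..
      qed
    qed
    then show colourable unfolding colourable_def by blast
  qed
qed

section \<open>Runs of a machine as applications of finitely many rules\<close>

fun shift :: "move \<Rightarrow> nat" where
  "shift Left = 0" | "shift Stay = 1" | "shift Right = 2"

lemma shift_offset: "int (shift m) = offset m + 1"
  by (cases m) auto

locale machine_run =
  fixes M :: tm
  assumes wf: "wf_tm M"
begin

abbreviation "k \<equiv> num_tapes M"
abbreviation "Q \<equiv> num_states M"
abbreviation "S \<equiv> num_symbols M"

definition cfg :: "bool list \<Rightarrow> nat \<Rightarrow> config" where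
  "cfg w t = (step M ^^ t) (init M w)"

definition "state w t = fst (cfg w t)"
definition "cont w t j = fst (snd (cfg w t) ! j)"
definition "hpos w t j = snd (snd (cfg w t) ! j)"
definition "scan w t j = cont w t j (hpos w t j)"

text \<open>The halting state becomes a fixed point, so a tableau needs no case for halting, and the
  output may be read at any later time.\<close>

definition total_delta :: "nat \<Rightarrow> nat list \<Rightarrow> nat \<times> (nat \<times> move) list" where
  "total_delta q rs = (if q = halt M then (q, stay rs) else delta M q rs)"

lemma step_total_delta: "step M (q, ts) = (case total_delta q (map read ts) of (q', as) \<Rightarrow> (q', map2 act as ts))"
proof -
  have "act (read t, Stay) t = t" for t by (cases t) auto
  then have "map2 act (stay (map read ts)) ts = ts" by (induct ts) auto
  then show ?thesis by (simp add: total_delta_def)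
qed

lemma total_delta_wf:
  assumes "q < Q" "length rs = k" "set rs \<subseteq> {..<S}" "total_delta q rs = (q', as)"
  shows "q' < Q \<and> length as = k \<and> fst ` set as \<subseteq> {..<S}"
proof (cases "q = halt M")
  case True
  then show ?thesis using assms by (auto simp: total_delta_def)
next
  case False
  then have "delta M q rs = (q', as)" using assms by (simp add: total_delta_def)
  moreover have "case delta M q rs of (q', as) \<Rightarrow> q' < Q \<and> length as = k \<and> fst ` set as \<subseteq> {..<S}"
    using wf assms(1-3) by (simp add: wf_tm_def)
  ultimately show ?thesis by simp
qed

text \<open>The order is arbitrary. As the machine is fixed, this list is a finite table; the
  functions on rule numbers derived from it are 0 outside the table, which makes
  \<open>pf_table\<close> and \<open>pf_table2\<close> applicable.\<close>

definition rules :: "(nat \<times> nat list) list" where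
  "rules = (SOME rs. set rs = {..<Q} \<times> {xs. set xs \<subseteq> {..<S} \<and> length xs = k})"

lemma set_rules: "set rules = {..<Q} \<times> {xs. set xs \<subseteq> {..<S} \<and> length xs = k}"
proof -
  have "finite ({..<Q} \<times> {xs. set xs \<subseteq> {..<S} \<and> length xs = k})"
    by (intro finite_cartesian_product finite_lists_length_eq) simp_all
  from finite_list[OF this] show ?thesis unfolding rules_def by (rule someI_ex)
qed

abbreviation "R \<equiv> length rules"

definition "rule_state r = (if r < R then fst (rules ! r) else 0)"
definition "rule_scan r j = (if r < R \<and> j < k then snd (rules ! r) ! j else 0)"
definition "rule_result r = total_delta (fst (rules ! r)) (snd (rules ! r))"
definition "rule_next r = (if r < R then fst (rule_result r) else 0)"
definition "rule_write r j = (if r < R \<and> j < k then fst (snd (rule_result r) ! j) else 0)"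
definition "rule_shift r j = (if r < R \<and> j < k then shift (snd (snd (rule_result r) ! j)) else 0)"

definition applies :: "bool list \<Rightarrow> nat \<Rightarrow> nat \<Rightarrow> bool" where
  "applies w t r \<longleftrightarrow> r < R \<and> state w t = rule_state r \<and> (\<forall>j<k. scan w t j = rule_scan r j)"

text \<open>A head moves by at most one cell per step. This limits the window of cells that a
  tableau has to represent.\<close>

lemma cfg_wf:
  "state w t < Q \<and> length (snd (cfg w t)) = k \<and> (\<forall>j<k. (\<forall>i. cont w t j i < S) \<and> \<bar>hpos w t j\<bar> \<le> int t)"
proof (induct t)
  case 0
  have S: "S \<ge> 3" "k \<ge> 1" "start M < Q" using wf by (auto simp: wf_tm_def)
  then have "\<forall>i. string_contents y i < S" for y by (auto simp: string_contents_def)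
  then show ?case using S by (auto simp: state_def cont_def hpos_def cfg_def init_def nth_Cons split: nat.splits)
next
  case (Suc t)
  let ?ts = "snd (cfg w t)"
  obtain q' as where d: "total_delta (state w t) (map read ?ts) = (q', as)" by fastforce
  have rd: "read (?ts ! j) = scan w t j" if "j < k" for j
    by (cases "?ts ! j") (simp add: scan_def cont_def hpos_def)
  have rs: "length (map read ?ts) = k" "set (map read ?ts) \<subseteq> {..<S}"
  proof -
    show "length (map read ?ts) = k" using Suc by simp
    show "set (map read ?ts) \<subseteq> {..<S}"
    proof
      fix a assume "a \<in> set (map read ?ts)"
      then obtain i where "i < k" "a = read (?ts ! i)" using Suc by (auto simp del: read.simps simp: in_set_conv_nth)
      then show "a \<in> {..<S}" using rd[of i] Suc by (simp add: scan_def)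
    qed
  qed
  from total_delta_wf[OF _ rs d] Suc have as: "q' < Q" "length as = k" "fst ` set as \<subseteq> {..<S}" by auto
  have cfg: "cfg w (Suc t) = (q', map2 act as ?ts)"
    using d step_total_delta[of "state w t" ?ts] by (simp add: cfg_def state_def del: step.simps)
  have act: "fst (act a tp) = (fst tp)(snd tp := fst a) \<and> snd (act a tp) = snd tp + offset (snd a)" for a tp
    by (cases a; cases tp) simp
  have off: "\<bar>offset m\<bar> \<le> 1" for m by (cases m) auto
  have "fst (as ! j) < S" if "j < k" for j using as that by (auto simp: image_subset_iff)
  moreover have "snd (cfg w (Suc t)) ! j = act (as ! j) (?ts ! j)" if "j < k" for j
    using cfg as(2) Suc that by simp
  then have "cont w (Suc t) j = (cont w t j)(hpos w t j := fst (as ! j))"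
    "hpos w (Suc t) j = hpos w t j + offset (snd (as ! j))" if "j < k" for j
    using that act by (simp_all add: cont_def hpos_def)
  moreover have "\<bar>hpos w t j + offset (snd (as ! j))\<bar> \<le> int (Suc t)" if "j < k" for j
  proof -
    have "\<bar>hpos w t j\<bar> \<le> int t" using Suc that by blast
    then show ?thesis using off[of "snd (as ! j)"] by linarith
  qed
  ultimately show ?case using as Suc cfg by (auto simp: state_def)
qed

lemma read_cfg: "j < k \<Longrightarrow> map read (snd (cfg w t)) ! j = scan w t j"
  using cfg_wf[of w t] by (cases "snd (cfg w t) ! j") (simp add: scan_def cont_def hpos_def)

lemma applies_exists: "\<exists>r. applies w t r"
proof -
  let ?rs = "map read (snd (cfg w t))"
  have l: "length ?rs = k" using cfg_wf[of w t] by simp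
  have "set ?rs \<subseteq> {..<S}"
  proof
    fix a assume "a \<in> set ?rs"
    then obtain i where "i < k" "a = ?rs ! i" using l by (metis in_set_conv_nth)
    then show "a \<in> {..<S}" using read_cfg[of i w t] cfg_wf[of w t] by (simp add: scan_def del: nth_map)
  qed
  then have "(state w t, ?rs) \<in> set rules" using l cfg_wf[of w t] by (simp add: set_rules)
  then obtain r where "r < R" "rules ! r = (state w t, ?rs)" by (metis in_set_conv_nth)
  then show ?thesis using read_cfg by (intro exI[of _ r]) (auto simp: applies_def rule_state_def rule_scan_def)
qed

lemma applies_step:
  assumes "applies w t r"
  shows "state w (Suc t) = rule_next r"
    and "j < k \<Longrightarrow> cont w (Suc t) j = (cont w t j)(hpos w t j := rule_write r j)"
    and "j < k \<Longrightarrow> hpos w (Suc t) j = hpos w t j + int (rule_shift r j) - 1"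
proof -
  let ?ts = "snd (cfg w t)"
  have r: "r < R" using assms by (simp add: applies_def)
  then have "rules ! r \<in> set rules" by simp
  then have len: "length (snd (rules ! r)) = k" "fst (rules ! r) < Q" "set (snd (rules ! r)) \<subseteq> {..<S}"
    by (auto simp: set_rules mem_Times_iff)
  have "map read ?ts = snd (rules ! r)"
  proof (rule nth_equalityI)
    show "length (map read ?ts) = length (snd (rules ! r))" using len cfg_wf[of w t] by simp
    fix j assume "j < length (map read ?ts)"
    then have "j < k" using cfg_wf[of w t] by simp
    then show "map read ?ts ! j = snd (rules ! r) ! j"
      using read_cfg assms r by (auto simp: applies_def rule_scan_def)
  qed
  then have d: "total_delta (state w t) (map read ?ts) = rule_result r"
    using assms r by (simp add: rule_result_def applies_def rule_state_def)
  obtain q' as where qa: "rule_result r = (q', as)" by fastforce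
  have as: "length as = k" using total_delta_wf[OF len(2,1,3)] qa by (simp add: rule_result_def)
  have cfg: "cfg w (Suc t) = (q', map2 act as ?ts)"
    using d qa step_total_delta[of "state w t" ?ts] by (simp add: cfg_def state_def del: step.simps)
  have act: "fst (act a tp) = (fst tp)(snd tp := fst a) \<and> snd (act a tp) = snd tp + offset (snd a)" for a tp
    by (cases a; cases tp) simp
  have lts: "length ?ts = k" using cfg_wf[of w t] by simp
  show "state w (Suc t) = rule_next r" using r qa cfg by (simp add: state_def rule_next_def)
  show "cont w (Suc t) j = (cont w t j)(hpos w t j := rule_write r j)" if "j < k"
    using that r qa cfg as lts act by (simp add: cont_def hpos_def rule_write_def)
  show "hpos w (Suc t) j = hpos w t j + int (rule_shift r j) - 1" if "j < k"
    using that r qa cfg as lts act by (simp add: hpos_def rule_shift_def shift_offset)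
qed

lemma cfg_0: "state w 0 = start M" "j < k \<Longrightarrow> hpos w 0 j = 0"
  "j < k \<Longrightarrow> cont w 0 j = string_contents (if j = 0 then w else [])"
  using wf by (auto simp: wf_tm_def state_def cont_def hpos_def cfg_def init_def nth_Cons split: nat.splits)

lemma halted:
  assumes "computes_in_time M f time" "time (length w) \<le> t"
  shows "cont w t (k - 1) = string_contents (f w)"
proof -
  from assms(1) obtain t0 ts where t0: "t0 \<le> time (length w)" "cfg w t0 = (halt M, ts)"
    "fst (last ts) = string_contents (f w)"
    unfolding computes_in_time_def cfg_def by blast
  have "cfg w (t0 + d) = (halt M, ts)" for d
    by (induct d) (use t0(2) in \<open>simp_all add: cfg_def\<close>)
  from this[of "t - t0"] have c: "cfg w t = (halt M, ts)" using t0(1) assms(2) by simp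
  moreover have "length ts = k" "k > 0" using cfg_wf[of w t] c wf by (auto simp: wf_tm_def)
  moreover from this have "ts \<noteq> []" by auto
  ultimately show ?thesis using t0(3) by (simp add: cont_def last_conv_nth)
qed

lemma pf_rule_tables [pf_intros]:
  "pf F \<Longrightarrow> pf (\<lambda>x e. rule_state (F x e))"
  "pf F \<Longrightarrow> pf G \<Longrightarrow> pf (\<lambda>x e. rule_scan (F x e) (G x e))"
  "pf F \<Longrightarrow> pf (\<lambda>x e. rule_next (F x e))"
  "pf F \<Longrightarrow> pf G \<Longrightarrow> pf (\<lambda>x e. rule_write (F x e) (G x e))"
  "pf F \<Longrightarrow> pf G \<Longrightarrow> pf (\<lambda>x e. rule_shift (F x e) (G x e))"
  by (rule pf_table[where c = R and d = 0] pf_table2[where c = "R + k" and d = 0];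
      auto simp: rule_state_def rule_scan_def rule_next_def rule_write_def rule_shift_def)+

end

section \<open>The tableau of a computation\<close>

lemma radix_less: "a < W \<Longrightarrow> b < N \<Longrightarrow> a + W * b < W * (N :: nat)"
proof -
  assume "a < W" "b < N"
  then have "a + W * b < W * Suc b" by simp
  also have "\<dots> \<le> W * N" using \<open>b < N\<close> by (intro mult_le_mono2) simp
  finally show ?thesis .
qed

lemma radix_mod_div: "a < W \<Longrightarrow> (a + W * b) mod W = a" "a < W \<Longrightarrow> (a + W * b) div W = (b :: nat)"
  by simp_all

locale tableau = machine_run M for M +
  fixes p q :: "nat poly" and V B :: "bool list set"
  assumes comp: "computes_in_time M (\<lambda>w. [w \<in> V]) (poly q)"
    and B: "\<And>x. x \<in> B \<longleftrightarrow> (\<exists>u. length u \<le> poly p (length x) \<and> encode_pair x u \<in> V)"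
begin

definition "len x = 2 * length x + (1 :: nat)" for x :: "bool list"
definition "bound x = len x + poly p (length x)"
text \<open>Apart from the running time this covers the length of the longest input of the verifier,
  so that the cells from \<open>- T x\<close> to \<open>T x\<close> contain the whole input.\<close>

definition "T x = poly q (bound x) + bound x"
text \<open>A common radix above all times, cell numbers, states, symbols, tapes and rules; the
  summand 20 puts it above the kinds of variables and clauses as well.\<close>

definition "W x = 2 * T x + Q + S + k + R + 20"
definition "nv x = W x * (W x * (W x * (W x * W x)))"
definition "code x a t j i s = a + W x * (t + W x * (j + W x * (i + W x * s)))"

text \<open>
  The variables state that at time \<open>t\<close> the state is \<open>s\<close>, the head of tape \<open>j\<close> is at position \<open>i - T x\<close>,
  the cell \<open>i - T x\<close> of tape \<open>j\<close> contains \<open>s\<close>, the head of tape \<open>j\<close> scans \<open>s\<close>, and rule \<open>s\<close> is applied.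
  The clauses only derive true variables, and the last kind of clause forbids the output 1 (rejection).
  Thus it does no harm if a satisfying assignment makes further variables true: it still contains
  the computation for one certificate.
\<close>

abbreviation "vState x t s \<equiv> code x 0 t 0 0 s"
abbreviation "vHead x t j i \<equiv> code x 1 t j i 0"
abbreviation "vCell x t j i s \<equiv> code x 2 t j i s"
abbreviation "vScan x t j s \<equiv> code x 3 t j 0 s"
abbreviation "vRule x t s \<equiv> code x 4 t 0 0 s"

text \<open>The cells of the certificate admit every symbol below 3, which is the only freedom in
  the tableau. Clauses of kind 3 spread blanks to the right, so the certificate has no gaps.\<close>

definition initial :: "bool list \<Rightarrow> nat \<Rightarrow> nat \<Rightarrow> nat \<Rightarrow> bool" where
  "initial x j i s \<longleftrightarrow>
     (if j = 0 \<and> T x \<le> i \<and> i < T x + len x then s = bit_sym (delimit x) (i - T x)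
      else if j = 0 \<and> T x + len x \<le> i \<and> i < T x + bound x then True else s = 0)"

text \<open>The last index is a rule number, except for kind 9, where it is the position of a head
  that is away from cell \<open>i\<close>.\<close>

definition valid :: "bool list \<Rightarrow> nat \<Rightarrow> nat \<Rightarrow> nat \<Rightarrow> nat \<Rightarrow> nat \<Rightarrow> nat \<Rightarrow> bool" where
  "valid x a t j i s r \<longleftrightarrow> a < 11 \<and> t < T x \<and> j < k \<and> i < 2 * T x + 1 \<and> s < S \<and>
     (a = 3 \<longrightarrow> T x + len x \<le> i \<and> i < T x + bound x) \<and>
     (a = 9 \<longrightarrow> r < 2 * T x + 1 \<and> r \<noteq> i) \<and> (a \<noteq> 9 \<longrightarrow> r < R)"

text \<open>A transition depends on the symbols under all heads. Deriving these first, by kind 4,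
  spares the rule clause of kind 5 the head positions of all tapes, so that a fixed number of
  indices describes every clause.\<close>

definition premise :: "bool list \<Rightarrow> nat \<Rightarrow> nat \<Rightarrow> nat \<Rightarrow> nat \<Rightarrow> nat \<Rightarrow> nat \<Rightarrow> nat \<Rightarrow> bool" where
  "premise x a t j i s r v \<longleftrightarrow>
     a = 3 \<and> v = vCell x 0 0 i 0 \<or>
     a = 4 \<and> (v = vHead x t j i \<or> v = vCell x t j i s) \<or>
     a = 5 \<and> (v = vState x t (rule_state r) \<or> (\<exists>j'<k. v = vScan x t j' (rule_scan r j'))) \<or>
     a = 6 \<and> v = vRule x t r \<or>
     (a = 7 \<or> a = 8) \<and> (v = vRule x t r \<or> v = vHead x t j i) \<or>
     a = 9 \<and> (v = vCell x t j i s \<or> v = vHead x t j r) \<or>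
     a = 10 \<and> v = vCell x (T x) (k - 1) (T x) 1"

definition concl :: "bool list \<Rightarrow> nat \<Rightarrow> nat \<Rightarrow> nat \<Rightarrow> nat \<Rightarrow> nat \<Rightarrow> nat \<Rightarrow> nat \<Rightarrow> bool" where
  "concl x a t j i s r v \<longleftrightarrow>
     a = 0 \<and> v = vState x 0 (start M) \<or>
     a = 1 \<and> v = vHead x 0 j (T x) \<or>
     a = 2 \<and> (\<exists>s'<3. initial x j i s' \<and> v = vCell x 0 j i s') \<or>
     a = 3 \<and> v = vCell x 0 0 (Suc i) 0 \<or>
     a = 4 \<and> v = vScan x t j s \<or>
     a = 5 \<and> v = vRule x t r \<or>
     a = 6 \<and> v = vState x (Suc t) (rule_next r) \<or>
     a = 7 \<and> v = vCell x (Suc t) j i (rule_write r j) \<or>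
     a = 8 \<and> v = vHead x (Suc t) j (i + rule_shift r j - 1) \<or>
     a = 9 \<and> v = vCell x (Suc t) j i s"

definition sat :: "bool list \<Rightarrow> (nat \<Rightarrow> bool) \<Rightarrow> bool" where
  "sat x \<alpha> \<longleftrightarrow> (\<forall>a t j i s r. valid x a t j i s r \<longrightarrow>
     (\<forall>v<nv x. premise x a t j i s r v \<longrightarrow> \<alpha> v) \<longrightarrow> (\<exists>v<nv x. concl x a t j i s r v \<and> \<alpha> v))"

lemma W_bounds: "2 * T x + 2 < W x" "Q < W x" "S < W x" "k < W x" "R < W x" "11 < W x"
  by (simp_all add: W_def)

lemma T_bounds: "len x \<le> bound x" "bound x \<le> T x" "0 < T x" "poly q (bound x) \<le> T x"
  by (simp_all add: T_def bound_def len_def)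

lemma params: "3 \<le> S" "0 < k" "start M < Q" "0 < R"
proof -
  show "3 \<le> S" "0 < k" "start M < Q" using wf by (auto simp: wf_tm_def)
  show "0 < R" using applies_exists[of "[]" 0] by (auto simp: applies_def)
qed

lemma rule_bounds:
  assumes "r < R"
  shows "rule_state r < Q" "rule_next r < Q" "j < k \<Longrightarrow> rule_scan r j < S" "j < k \<Longrightarrow> rule_write r j < S"
    "rule_shift r j \<le> 2"
proof -
  have "rules ! r \<in> set rules" using assms by simp
  then have r: "length (snd (rules ! r)) = k" "fst (rules ! r) < Q" "set (snd (rules ! r)) \<subseteq> {..<S}"
    by (auto simp: set_rules mem_Times_iff)
  obtain q' as where d: "total_delta (fst (rules ! r)) (snd (rules ! r)) = (q', as)" by fastforce
  from total_delta_wf[OF r(2,1,3) d] have as: "q' < Q" "length as = k" "fst ` set as \<subseteq> {..<S}" by auto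
  show "rule_state r < Q" "rule_next r < Q" using assms r d as by (auto simp: rule_state_def rule_next_def rule_result_def)
  show "rule_scan r j < S" if "j < k" using nth_mem[of j "snd (rules ! r)"] r assms that subsetD[OF r(3)] by (simp add: rule_scan_def)
  show "rule_write r j < S" if "j < k"
    using nth_mem[of j as] as assms that d by (auto simp: rule_write_def rule_result_def image_subset_iff)
  have "shift m \<le> 2" for m by (cases m) auto
  then show "rule_shift r j \<le> 2" by (simp add: rule_shift_def)
qed

lemma code_less:
  "a < W x \<Longrightarrow> t < W x \<Longrightarrow> j < W x \<Longrightarrow> i < W x \<Longrightarrow> s < W x \<Longrightarrow> code x a t j i s < nv x"
  unfolding code_def nv_def by (intro radix_less)

definition clause_of :: "(bool list \<Rightarrow> nat \<Rightarrow> nat \<Rightarrow> nat \<Rightarrow> nat \<Rightarrow> nat \<Rightarrow> nat \<Rightarrow> 'c) \<Rightarrow> bool list \<Rightarrow> nat \<Rightarrow> 'c" where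
  "clause_of f x c = f x (c mod W x) (c div W x mod W x) (c div W x div W x mod W x)
     (c div W x div W x div W x mod W x) (c div W x div W x div W x div W x mod W x)
     (c div W x div W x div W x div W x div W x mod W x)"

definition "ccode x a t j i s r = a + W x * (t + W x * (j + W x * (i + W x * (s + W x * r))))"

lemma ccode_less:
  "a < W x \<Longrightarrow> t < W x \<Longrightarrow> j < W x \<Longrightarrow> i < W x \<Longrightarrow> s < W x \<Longrightarrow> r < W x \<Longrightarrow>
    ccode x a t j i s r < W x * nv x"
  unfolding ccode_def nv_def by (intro radix_less)

lemma clause_of_ccode:
  "a < W x \<Longrightarrow> t < W x \<Longrightarrow> j < W x \<Longrightarrow> i < W x \<Longrightarrow> s < W x \<Longrightarrow> r < W x \<Longrightarrow>
    clause_of f x (ccode x a t j i s r) = f x a t j i s r"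
  unfolding ccode_def clause_of_def by (simp only: radix_mod_div mod_less)

lemma valid_less:
  assumes "valid x a t j i s r"
  shows "a < W x" "t < W x" "j < W x" "i < W x" "s < W x" "r < W x"
  using assms W_bounds[of x] unfolding valid_def by (cases "a = 9"; force)+

text \<open>Valid indices lie below the radix, so each clause has a number below
  \<open>W x * nv x\<close>.\<close>

lemma sat_iff:
  "(\<exists>\<alpha>. sat x \<alpha>) \<longleftrightarrow> (\<exists>\<alpha>. \<forall>c<W x * nv x. clause_of valid x c \<longrightarrow>
    (\<forall>v<nv x. clause_of premise x c v \<longrightarrow> \<alpha> v) \<longrightarrow> (\<exists>v<nv x. clause_of concl x c v \<and> \<alpha> v))"
  (is "_ \<longleftrightarrow> (\<exists>\<alpha>. ?S \<alpha>)")
proof -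
  have "sat x \<alpha> \<longleftrightarrow> ?S \<alpha>" for \<alpha>
  proof
    assume "sat x \<alpha>"
    then show "?S \<alpha>" unfolding sat_def clause_of_def by blast
  next
    assume S: "?S \<alpha>"
    show "sat x \<alpha>" unfolding sat_def
    proof (intro allI impI)
      fix a t j i s r
      assume v: "valid x a t j i s r" and pre: "\<forall>v<nv x. premise x a t j i s r v \<longrightarrow> \<alpha> v"
      note less = valid_less[OF v]
      from S[rule_format, OF ccode_less[OF less]] v pre
      show "\<exists>v<nv x. concl x a t j i s r v \<and> \<alpha> v" by (simp add: clause_of_ccode[OF less])
    qed
  qed
  then show ?thesis by simp
qed

lemma length_delimit: "length (delimit x) = len x"
  by (induct x) (simp_all add: len_def)

lemma encode_pair_contents:
  "i < len x \<Longrightarrow> string_contents (encode_pair x u) (int i) = bit_sym (delimit x) i"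
  "len x \<le> i \<Longrightarrow> string_contents (encode_pair x u) (int i) = bit_sym u (i - len x)"
  by (auto simp: string_contents_bit_sym bit_sym_def encode_pair_def nth_append length_delimit)

lemma sat_imp:
  assumes sat: "sat x \<alpha>"
  shows "x \<in> B"
proof -
  have inst: "\<exists>v. concl x a t j i s r v \<and> \<alpha> v"
    if "valid x a t j i s r" "\<And>v. premise x a t j i s r v \<Longrightarrow> \<alpha> v" for a t j i s r
    using sat[unfolded sat_def, rule_format, OF that(1)] that(2) by blast
  note defs = valid_def premise_def concl_def
  let ?T = "T x"
  define blank where "blank d \<longleftrightarrow> \<alpha> (vCell x 0 0 (?T + len x + d) 0)" for d
  let ?P = "poly p (length x)"
  \<comment> \<open>The certificate is cut at the first cell marked blank, or at its maximal length.
    All later cells in its region are marked blank by kind 3.\<close>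
  define m where "m = (LEAST d. d = ?P \<or> blank d)"
  have m: "m = ?P \<or> blank m" "m \<le> ?P" "\<And>d. d < m \<Longrightarrow> \<not> blank d"
  proof -
    show "m = ?P \<or> blank m" unfolding m_def by (rule LeastI[of _ ?P]) simp
    show "m \<le> ?P" unfolding m_def by (rule Least_le) simp
    show "\<not> blank d" if "d < m" for d using not_less_Least[of d "\<lambda>d. d = ?P \<or> blank d"] that by (simp add: m_def)
  qed
  have mono: "blank (Suc d)" if "blank d" "Suc d < ?P" for d
    using inst[of 3 0 0 "?T + len x + d" 0 0] params T_bounds[of x] that
    by (auto simp: defs blank_def bound_def)
  have blank: "blank d" if "m \<le> d" "d < ?P" for d
    using that
  proof (induct d rule: dec_induct)
    case base
    then show ?case using m by auto
  next
    case (step d)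
    then show ?case by (intro mono) auto
  qed
  \<comment> \<open>A cell may carry the marks 1 and 2 at once, and then 2 is preferred. A cell
    before \<open>m\<close> without mark 2 has mark 1, since it is not marked blank.\<close>
  define u where "u = map (\<lambda>d. \<alpha> (vCell x 0 0 (?T + len x + d) 2)) [0..<m]"
  let ?w = "encode_pair x u"
  have init_cell: "\<exists>s<3. initial x j i s \<and> \<alpha> (vCell x 0 j i s)" if "j < k" "i < 2 * ?T + 1" for j i
    using inst[of 2 0 j i 0 0] params T_bounds[of x] that by (auto simp: defs)
  have "\<alpha> (vCell x 0 j i (cont ?w 0 j (int i - int ?T)))" if j: "j < k" and i: "i < 2 * ?T + 1" for j i
  proof -
    obtain s where s: "s < 3" "initial x j i s" "\<alpha> (vCell x 0 j i s)" using init_cell[OF j i] by blast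
    show ?thesis
    proof (cases "j = 0 \<and> ?T + len x \<le> i \<and> i < ?T + bound x")
      case True
      let ?d = "i - ?T - len x"
      have d: "i = ?T + len x + ?d" "?d < ?P" using True by (auto simp: bound_def)
      have "int i - int ?T = int (i - ?T)" using True by simp
      moreover have "len x \<le> i - ?T" using True by linarith
      ultimately have c: "cont ?w 0 j (int i - int ?T) = bit_sym u ?d"
        using True j encode_pair_contents(2)[of x "i - ?T" u] by (simp add: cfg_0)
      show ?thesis
      proof (cases "?d < m")
        case True
        then have "\<not> \<alpha> (vCell x 0 0 i 0)" using m(3)[OF True] d(1) by (simp add: blank_def)
        then have "s \<noteq> 0" using s(3) \<open>j = 0 \<and> _\<close> by metis
        then have "s = 1 \<or> s = 2" using s(1) by auto
        moreover have "bit_sym u ?d = (if \<alpha> (vCell x 0 0 i 2) then 2 else 1)"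
          using True d(1) by (simp add: u_def bit_sym_def)
        ultimately show ?thesis using c s(3) \<open>j = 0 \<and> _\<close> by auto
      next
        case False
        then have "bit_sym u ?d = 0" by (simp add: u_def bit_sym_def)
        moreover have "\<alpha> (vCell x 0 0 i 0)" using blank[of ?d] False d by (auto simp: blank_def)
        ultimately show ?thesis using c \<open>j = 0 \<and> _\<close> by auto
      qed
    next
      case False
      have "cont ?w 0 j (int i - int ?T) = s"
      proof (cases "j = 0 \<and> ?T \<le> i")
        case True
        then have "int i - int ?T = int (i - ?T)" by simp
        then have c: "cont ?w 0 j (int i - int ?T) = string_contents ?w (int (i - ?T))"
          using cfg_0(3)[OF j] True by simp
        consider "i - ?T < len x" | "?T + bound x \<le> i" using False True by linarith
        then show ?thesis
        proof cases
          case 1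
          then have "s = bit_sym (delimit x) (i - ?T)" using True s(2) by (auto simp: initial_def)
          then show ?thesis unfolding c encode_pair_contents(1)[OF 1] by simp
        next
          case 2
          then have "length u \<le> i - ?T - len x" using m(2) by (simp add: u_def bound_def)
          then have "bit_sym u (i - ?T - len x) = 0" by (simp add: bit_sym_eq_0)
          moreover have "len x \<le> i - ?T" using 2 T_bounds(1)[of x] by linarith
          moreover have "s = 0" using True False s(2) 2 by (auto simp: initial_def bound_def)
          ultimately show ?thesis unfolding c by (simp add: encode_pair_contents(2))
        qed
      next
        case F: False
        then have "s = 0" using s(2) by (auto simp: initial_def)
        moreover have "string_contents y z = 0" if "z < 0" for y z using that by (simp add: string_contents_def)
        ultimately show ?thesis using F j by (auto simp: cfg_0 string_contents_def)
      qed
      then show ?thesis using s(3) by simp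
    qed
  qed
  note cell_0 = this
  have run: "\<alpha> (vState x t (state ?w t)) \<and>
      (\<forall>j<k. \<alpha> (vHead x t j (nat (hpos ?w t j + int ?T)))) \<and>
      (\<forall>j<k. \<forall>i<2 * ?T + 1. \<alpha> (vCell x t j i (cont ?w t j (int i - int ?T))))" if "t \<le> ?T" for t
    using that
  proof (induct t)
    case 0
    have "\<alpha> (vState x 0 (start M))"
      using inst[of 0 0 0 0 0 0] params T_bounds[of x] by (auto simp: defs)
    moreover have "\<alpha> (vHead x 0 j ?T)" if "j < k" for j
    proof -
      have "valid x 1 0 j 0 0 0" unfolding valid_def
        by (intro conjI impI) (use params T_bounds(3)[of x] that in simp_all)
      from inst[OF this] show ?thesis by (simp add: premise_def concl_def)
    qed
    ultimately show ?case using cell_0 by (simp add: cfg_0)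
  next
    case (Suc t)
    then have t: "t < ?T" by simp
    note IH = Suc.hyps[OF less_imp_le[OF t]]
    define hp where "hp j = nat (hpos ?w t j + int ?T)" for j
    \<comment> \<open>Before time \<open>?T\<close> no head has reached the left end of the window,
      so the subtraction of 1 in kind 8 is not truncated.\<close>
    have hp: "int (hp j) = hpos ?w t j + int ?T" "hp j < 2 * ?T + 1" "0 < hp j" if "j < k" for j
    proof -
      have "\<bar>hpos ?w t j\<bar> \<le> int t" using cfg_wf[of ?w t] that by simp
      then show "int (hp j) = hpos ?w t j + int ?T" "hp j < 2 * ?T + 1" "0 < hp j" using t by (simp_all add: hp_def)
    qed
    have scan: "\<alpha> (vScan x t j (scan ?w t j))" if j: "j < k" for j
    proof -
      have "scan ?w t j = cont ?w t j (int (hp j) - int ?T)" using hp(1)[OF j] by (simp add: scan_def)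
      moreover have "scan ?w t j < S" using cfg_wf[of ?w t] j by (simp add: scan_def)
      moreover have "\<alpha> (vHead x t j (hp j))" "\<alpha> (vCell x t j (hp j) (cont ?w t j (int (hp j) - int ?T)))"
      proof -
        show "\<alpha> (vHead x t j (hp j))" using IH j by (simp add: hp_def)
        have "\<forall>i<2 * ?T + 1. \<alpha> (vCell x t j i (cont ?w t j (int i - int ?T)))" using IH j by simp
        then show "\<alpha> (vCell x t j (hp j) (cont ?w t j (int (hp j) - int ?T)))" using hp(2)[OF j] by simp
      qed
      ultimately show ?thesis
        using inst[of 4 t j "hp j" "scan ?w t j" 0] j hp(2)[OF j] t params by (auto simp: defs)
    qed
    have head: "\<alpha> (vHead x t j (hp j))" if "j < k" for j using IH that by (simp add: hp_def)
    obtain r where ap: "applies ?w t r" using applies_exists by blast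
    then have r: "r < R" "state ?w t = rule_state r" "\<And>j. j < k \<Longrightarrow> scan ?w t j = rule_scan r j"
      by (auto simp: applies_def)
    have rule: "\<alpha> (vRule x t r)"
      using inst[of 5 t 0 0 0 r] IH scan r t params by (auto simp: defs)
    have "\<alpha> (vState x (Suc t) (rule_next r))"
      using inst[of 6 t 0 0 0 r] rule r(1) t params by (auto simp: defs)
    moreover have "\<alpha> (vHead x (Suc t) j (nat (hpos ?w (Suc t) j + int ?T)))" if j: "j < k" for j
    proof -
      have "nat (hpos ?w (Suc t) j + int ?T) = hp j + rule_shift r j - 1"
        using hp[OF j] applies_step(3)[OF ap j] by simp
      then show ?thesis
        using inst[of 8 t j "hp j" 0 r] rule head[OF j] r(1) t params j hp(2)[OF j] by (auto simp: defs)
    qed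
    moreover have "\<alpha> (vCell x (Suc t) j i (cont ?w (Suc t) j (int i - int ?T)))" if j: "j < k" and i: "i < 2 * ?T + 1" for j i
    proof (cases "i = hp j")
      case True
      then have "cont ?w (Suc t) j (int i - int ?T) = rule_write r j"
        using hp[OF j] applies_step(2)[OF ap j] by simp
      then show ?thesis
        using inst[of 7 t j i 0 r] rule head[OF j] r(1) t params j i True by (auto simp: defs)
    next
      case False
      then have "cont ?w (Suc t) j (int i - int ?T) = cont ?w t j (int i - int ?T)"
        using hp[OF j] applies_step(2)[OF ap j] by auto
      moreover have "cont ?w t j (int i - int ?T) < S" using cfg_wf[of ?w t] j by simp
      moreover have "\<alpha> (vCell x t j i (cont ?w t j (int i - int ?T)))" using IH j i by blast
      ultimately show ?thesis
        using inst[of 9 t j i "cont ?w t j (int i - int ?T)" "hp j"] head[OF j] t j i False hp(2)[OF j]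
        by (auto simp: defs)
    qed
    ultimately show ?case using applies_step(1)[OF ap] by simp
  qed
  have u: "length u \<le> ?P" using m(2) by (simp add: u_def)
  then have "length ?w \<le> bound x" by (simp add: encode_pair_def length_delimit bound_def)
  then have "poly q (length ?w) \<le> ?T" using poly_nat_mono[of "length ?w" "bound x" q] T_bounds[of x] by linarith
  from halted[OF comp this] have "cont ?w ?T (k - 1) 0 = (if ?w \<in> V then 2 else 1)"
    by (simp add: string_contents_def)
  moreover have "\<alpha> (vCell x ?T (k - 1) ?T (cont ?w ?T (k - 1) 0))"
  proof -
    have "\<forall>j<k. \<forall>i<2 * ?T + 1. \<alpha> (vCell x ?T j i (cont ?w ?T j (int i - int ?T)))" using run[of ?T] by simp
    from this[rule_format, of "k - 1" ?T] show ?thesis using params by simp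
  qed
  moreover have "\<not> \<alpha> (vCell x ?T (k - 1) ?T 1)"
    using inst[of 10 0 0 0 0 0] params T_bounds[of x] by (auto simp: defs)
  ultimately have "?w \<in> V" by (auto split: if_splits)
  then show ?thesis using B u by blast
qed

end

lemma pf_list_delimit [pf_intros]: "pf_list (\<lambda>x (e :: 'e::env). delimit x)"
proof -
  have "delimit x = concat (map (\<lambda>i. [True, bit_sym x i = 2]) [0..<length x]) @ [False]" for x
  proof -
    have "map (\<lambda>b. [True, b]) x = map (\<lambda>i. [True, bit_sym x i = 2]) [0..<length x]"
      by (rule nth_equalityI) (auto simp: bit_sym_def)
    then show ?thesis by (simp add: delimit_def)
  qed
  then show ?thesis by (simp only:) (intro pf_intros pf_bit_sym)
qed

context tableau
begin

lemma imp_sat: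
  assumes "x \<in> B"
  shows "\<exists>\<alpha>. sat x \<alpha>"
proof -
  from assms B obtain u where u: "length u \<le> poly p (length x)" "encode_pair x u \<in> V" by blast
  let ?w = "encode_pair x u" let ?T = "T x"
  \<comment> \<open>Truth in the actual run on \<open>?w\<close>; coordinates that a kind of
    variable does not use are left free.\<close>
  define hold where "hold a t j i s \<longleftrightarrow>
    a = 0 \<and> state ?w t = s \<or> a = 1 \<and> hpos ?w t j + int ?T = int i \<or> a = 2 \<and> cont ?w t j (int i - int ?T) = s \<or>
    a = 3 \<and> scan ?w t j = s \<or> a = 4 \<and> applies ?w t s" for a t j i s :: nat
  define \<alpha> where "\<alpha> v = hold (v mod W x) (v div W x mod W x) (v div W x div W x mod W x)
    (v div W x div W x div W x mod W x) (v div W x div W x div W x div W x)" for v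
  have \<alpha>: "\<alpha> (code x a t j i s) = hold a t j i s"
    if "a < W x" "t < W x" "j < W x" "i < W x" for a t j i s
    unfolding \<alpha>_def code_def using that by (simp only: radix_mod_div)
  have "\<exists>v<nv x. concl x a t j i s r v \<and> \<alpha> v"
    if valid: "valid x a t j i s r" and pre: "\<forall>v<nv x. premise x a t j i s r v \<longrightarrow> \<alpha> v" for a t j i s r
  proof -
    note W = W_bounds[of x]
    have lt: "t < ?T" "j < k" "i < 2 * ?T + 1" "s < S" "a < 11"
      using valid unfolding valid_def by blast+
    have rR: "a \<noteq> 9 \<Longrightarrow> r < R" using valid unfolding valid_def by blast
    have r9: "a = 9 \<Longrightarrow> r < 2 * ?T + 1 \<and> r \<noteq> i" using valid unfolding valid_def by blast
    have lW: "t < W x" "Suc t < W x" "j < W x" "i < W x" "Suc i < W x" "s < W x" "?T < W x" "k - 1 < W x" "0 < W x"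
      using lt W by linarith+
    have num: "0 < W x" "1 < W x" "2 < W x" "3 < W x" "4 < W x" using W by linarith+
    have result: "\<exists>v<nv x. concl x a t j i s r v \<and> \<alpha> v"
      if "concl x a t j i s r (code x a' t' j' i' s')" "hold a' t' j' i' s'"
        "a' < W x" "t' < W x" "j' < W x" "i' < W x" "s' < W x" for a' t' j' i' s'
      using that \<alpha>[OF that(3-6)] code_less[OF that(3-7)] by blast
    have known: "hold a' t' j' i' s'"
      if "premise x a t j i s r (code x a' t' j' i' s')"
        "a' < W x" "t' < W x" "j' < W x" "i' < W x" "s' < W x" for a' t' j' i' s'
      using pre that(1) \<alpha>[OF that(2-5)] code_less[OF that(2-6)] by blast
    have "a = 0 \<or> a = 1 \<or> a = 2 \<or> a = 3 \<or> a = 4 \<or> a = 5 \<or> a = 6 \<or> a = 7 \<or> a = 8 \<or> a = 9 \<or> a = 10"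
      using lt(5) by presburger
    then consider "a = 0" | "a = 1" | "a = 2" | "a = 3" | "a = 4" | "a = 5" | "a = 6" | "a = 7" | "a = 8" | "a = 9" | "a = 10" by blast
    then show ?thesis
    proof cases
      case 1
      have "start M < W x" using params W by linarith
      then show ?thesis using 1 num lW
        by (intro result[of 0 0 0 0 "start M"]) (simp_all add: concl_def hold_def cfg_0)
    next
      case 2
      then show ?thesis using num lW lt
        by (intro result[of 1 0 j ?T 0]) (simp_all add: concl_def hold_def cfg_0)
    next
      case 3
      let ?s = "cont ?w 0 j (int i - int ?T)"
      have s3: "?s < 3" using lt(2) by (simp add: cfg_0 string_contents_def)
      have "initial x j i ?s"
      proof (cases "j = 0 \<and> ?T \<le> i")
        case True
        then have "int i - int ?T = int (i - ?T)" by simp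
        then have c: "?s = string_contents ?w (int (i - ?T))" using cfg_0(3)[OF lt(2), of ?w] True by simp
        consider "i < ?T + len x" | "?T + len x \<le> i" "i < ?T + bound x" | "?T + bound x \<le> i" by linarith
        then show ?thesis
        proof cases
          case 1
          then have "i - ?T < len x" using True by linarith
          then show ?thesis unfolding c encode_pair_contents(1)[OF \<open>i - ?T < len x\<close>]
            using 1 True by (simp add: initial_def)
        next
          case 2
          then show ?thesis using True by (simp add: initial_def)
        next
          case 3
          then have "len x \<le> i - ?T" "length u \<le> i - ?T - len x" using u(1) T_bounds(1)[of x] by (auto simp: bound_def)
          then have "?s = 0" unfolding c by (simp add: encode_pair_contents(2) bit_sym_eq_0)
          then show ?thesis using 3 True T_bounds(1)[of x] by (simp add: initial_def)
        qed
      next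
        case False
        then have "?s = 0" using lt(2) by (auto simp: cfg_0 string_contents_def)
        then show ?thesis using False by (auto simp: initial_def)
      qed
      then show ?thesis using 3 num lW s3
        by (intro result[of 2 0 j i ?s]) (auto simp: concl_def hold_def)
    next
      case 4
      have i: "?T + len x \<le> i" "i < ?T + bound x" using valid 4 by (auto simp: valid_def)
      have "hold 2 0 0 i 0" by (rule known) (use 4 num lW in \<open>simp_all add: premise_def\<close>)
      then have "cont ?w 0 0 (int i - int ?T) = 0" by (simp add: hold_def)
      moreover have "int i - int ?T = int (i - ?T)" "int (Suc i) - int ?T = int (Suc (i - ?T))" using i by auto
      moreover have "cont ?w 0 0 (int d) = bit_sym ?w d" for d
        using cfg_0(3)[of 0 ?w] params by (simp add: string_contents_bit_sym)
      ultimately have "bit_sym ?w (i - ?T) = 0" "cont ?w 0 0 (int (Suc i) - int ?T) = bit_sym ?w (Suc (i - ?T))"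
        by (simp_all only:)
      then have "cont ?w 0 0 (int (Suc i) - int ?T) = 0" by (simp add: bit_sym_eq_0)
      then show ?thesis using 4 num lW
        by (intro result[of 2 0 0 "Suc i" 0]) (simp_all add: concl_def hold_def)
    next
      case 5
      have "hold 1 t j i 0" "hold 2 t j i s"
        by (rule known; use 5 num lW in \<open>simp add: premise_def\<close>)+
      then have "hpos ?w t j = int i - int ?T" "cont ?w t j (int i - int ?T) = s" by (auto simp: hold_def)
      then have "hold 3 t j 0 s" by (simp add: hold_def scan_def)
      then show ?thesis using 5 num lW by (intro result[of 3 t j 0 s]) (simp_all add: concl_def)
    next
      case 6
      have r: "r < R" "r < W x" using rR 6 W by auto
      have "rule_state r < W x" using rule_bounds(1)[OF r(1)] W by linarith
      then have "hold 0 t 0 0 (rule_state r)" by (intro known) (use 6 num lW in \<open>simp_all add: premise_def\<close>)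
      moreover have "hold 3 t j' 0 (rule_scan r j')" if "j' < k" for j'
      proof -
        have "rule_scan r j' < W x" "j' < W x" using rule_bounds(3)[OF r(1) that] that W by linarith+
        then show ?thesis by (intro known) (use 6 num lW that in \<open>auto simp: premise_def\<close>)
      qed
      ultimately have "hold 4 t 0 0 r" using r by (simp add: hold_def applies_def)
      then show ?thesis using 6 num lW r by (intro result[of 4 t 0 0 r]) (simp_all add: concl_def)
    next
      case 7
      have r: "r < R" "r < W x" using rR 7 W by auto
      have "hold 4 t 0 0 r" by (rule known) (use 7 num lW r in \<open>simp_all add: premise_def\<close>)
      then have "applies ?w t r" by (simp add: hold_def)
      then have "hold 0 (Suc t) 0 0 (rule_next r)" using applies_step(1) by (simp add: hold_def)
      moreover have "rule_next r < W x" using rule_bounds(2)[OF r(1)] W by linarith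
      ultimately show ?thesis using 7 num lW by (intro result[of 0 "Suc t" 0 0 "rule_next r"]) (simp_all add: concl_def)
    next
      case 8
      have r: "r < R" "r < W x" using rR 8 W by auto
      have "hold 4 t 0 0 r" "hold 1 t j i 0" by (rule known; use 8 num lW r in \<open>simp add: premise_def\<close>)+
      then have ap: "applies ?w t r" and h: "hpos ?w t j = int i - int ?T" by (auto simp: hold_def)
      have "hold 2 (Suc t) j i (rule_write r j)" using applies_step(2)[OF ap lt(2)] h by (simp add: hold_def)
      moreover have "rule_write r j < W x" using rule_bounds(4)[OF r(1) lt(2)] W by linarith
      ultimately show ?thesis using 8 num lW by (intro result[of 2 "Suc t" j i "rule_write r j"]) (simp_all add: concl_def)
    next
      case 9
      have r: "r < R" "r < W x" using rR 9 W by auto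
      have "hold 4 t 0 0 r" "hold 1 t j i 0" by (rule known; use 9 num lW r in \<open>simp add: premise_def\<close>)+
      then have ap: "applies ?w t r" and h: "hpos ?w t j = int i - int ?T" by (auto simp: hold_def)
      have "\<bar>hpos ?w t j\<bar> \<le> int t" using cfg_wf[of ?w t] lt(2) by simp
      then have "0 < i" using h lt(1) by linarith
      then have "int (i + rule_shift r j - 1) = int i + int (rule_shift r j) - 1" by (simp add: of_nat_diff)
      then have "hold 1 (Suc t) j (i + rule_shift r j - 1) 0"
        using applies_step(3)[OF ap lt(2)] h by (simp only: hold_def) simp
      moreover have "i + rule_shift r j - 1 < W x" using rule_bounds(5)[OF r(1), of j] W(1) lt(3) by linarith
      ultimately show ?thesis using 9 num lW
        by (intro result[of 1 "Suc t" j "i + rule_shift r j - 1" 0]) (simp_all add: concl_def)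
    next
      case 10
      have r: "r < W x" "r \<noteq> i" using r9 10 W by auto
      have "hold 2 t j i s" "hold 1 t j r 0" by (rule known; use 10 num lW r in \<open>simp add: premise_def\<close>)+
      then have c: "cont ?w t j (int i - int ?T) = s" and h: "hpos ?w t j = int r - int ?T" by (auto simp: hold_def)
      obtain r' where "applies ?w t r'" using applies_exists by blast
      from applies_step(2)[OF this lt(2)] c h r(2) have "hold 2 (Suc t) j i s" by (simp add: hold_def)
      then show ?thesis using 10 num lW by (intro result[of 2 "Suc t" j i s]) (simp_all add: concl_def)
    next
      case 11
      have "hold 2 ?T (k - 1) ?T 1" by (rule known) (use 11 num lW in \<open>simp_all add: premise_def\<close>)
      then have "cont ?w ?T (k - 1) 0 = 1" by (simp add: hold_def)
      moreover have "length ?w \<le> bound x" using u(1) by (simp add: encode_pair_def length_delimit bound_def)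
      then have "poly q (length ?w) \<le> ?T" using poly_nat_mono[of "length ?w" "bound x" q] T_bounds(4)[of x] by linarith
      from halted[OF comp this] u(2) have "cont ?w ?T (k - 1) 0 = 2" by (simp add: string_contents_def)
      ultimately show ?thesis by simp
    qed
  qed
  then show ?thesis unfolding sat_def by blast
qed

lemma pf_T [pf_intros]: "pf (\<lambda>x (e :: 'e::env). T x)"
  unfolding T_def bound_def len_def by (intro pf_intros)

lemma pf_len [pf_intros]: "pf (\<lambda>x (e :: 'e::env). len x)"
  unfolding len_def by (intro pf_intros)

lemma pf_bound [pf_intros]: "pf (\<lambda>x (e :: 'e::env). bound x)"
  unfolding bound_def by (intro pf_intros)

lemma pf_W [pf_intros]: "pf (\<lambda>x (e :: 'e::env). W x)"
  unfolding W_def by (intro pf_intros)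

lemma pf_nv [pf_intros]: "pf (\<lambda>x (e :: 'e::env). nv x)"
  unfolding nv_def by (intro pf_intros)

theorem reduction:
  "\<exists>f. polytime_computable f \<and> (\<forall>x. f x \<in> DiTGR_restricted_instances \<and> (x \<in> B \<longleftrightarrow> f x \<in> DiTGR))"
proof (rule hypergraph_reduction)
  let ?mem = "\<lambda>x. clause_edges (nv x) (clause_of valid x) (clause_of premise x) (clause_of concl x)"
  have nv: "0 < nv x" for x using W_bounds(6)[of x] by (simp add: nv_def)
  show "pf (\<lambda>x (e :: unit). 2 * nv x + 1)" "pf (\<lambda>x (e :: unit). nv x + W x * nv x)" by (intro pf_intros)+
  show "pf (\<lambda>x (e :: nat \<times> nat). of_bool (?mem x (fst e) (snd e)))"
    unfolding clause_edges_def clause_of_def valid_def premise_def concl_def initial_def code_def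
    by (intro pf_intros pf_list_bit_sym)
  show "\<exists>l<2 * nv x + 1. ?mem x e l" for x e using clause_edges_nonempty[OF nv] .
  show "x \<in> B \<longleftrightarrow> hypergraph.colourable (2 * nv x + 1) (nv x + W x * nv x) (?mem x)" for x
    unfolding clause_edges_colourable[OF nv] sat_iff[symmetric] using sat_imp imp_sat by blast
qed

end

theorem NP_hard_restricted: "NP_hard_on DiTGR_restricted_instances DiTGR"
  unfolding NP_hard_on_def
proof (intro allI impI)
  fix B :: "bool list set"
  assume "in_NP B"
  then obtain V p where V: "polytime_decidable V"
    and B: "\<And>x. x \<in> B \<longleftrightarrow> (\<exists>u. length u \<le> poly p (length x) \<and> encode_pair x u \<in> V)"
    unfolding NP_on_def by blast
  from V obtain M q where "wf_tm M" "computes_in_time M (\<lambda>w. [w \<in> V]) (poly q)"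
    unfolding polytime_decidable_def polytime_computable_def by blast
  then interpret tableau M p q V B by unfold_locales (use B in auto)
  show "\<exists>f. polytime_computable f \<and> (\<forall>x. f x \<in> DiTGR_restricted_instances \<and> (x \<in> B \<longleftrightarrow> f x \<in> DiTGR))"
    by (rule reduction)
qed

section \<open>Comparing binary numbers digit by digit\<close>

definition bits_val :: "(nat \<Rightarrow> bool) \<Rightarrow> nat \<Rightarrow> nat" where
  "bits_val b L = (\<Sum>i<L. of_bool (b i) * 2 ^ i)"

lemma bits_val_Suc: "bits_val b (Suc L) = of_bool (b 0) + 2 * bits_val (\<lambda>i. b (Suc i)) L"
  unfolding bits_val_def sum.lessThan_Suc_shift sum_distrib_left
  by (simp add: mult.left_commute del: sum_of_bool_mult_eq sum_mult_of_bool_eq)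

lemma bits_val_cong: "(\<And>i. i < L \<Longrightarrow> b i = b' i) \<Longrightarrow> bits_val b L = bits_val b' L"
  unfolding bits_val_def by (intro sum.cong) auto

lemma bits_val_bit: "m < 2 ^ L \<Longrightarrow> bits_val (\<lambda>i. odd (m div 2 ^ i)) L = m"
proof (induct L arbitrary: m)
  case 0
  then show ?case by (simp add: bits_val_def)
next
  case (Suc L)
  then have "bits_val (\<lambda>i. odd (m div 2 div 2 ^ i)) L = m div 2" by (intro Suc.hyps) auto
  then show ?case by (cases "odd m") (simp_all add: bits_val_Suc div_mult2_eq)
qed

lemma bits_val_pos: "0 < bits_val b L \<longleftrightarrow> (\<exists>i<L. b i)"
  by (induct L) (auto simp: bits_val_def less_Suc_eq)

text \<open>One more than the position of the highest set bit, or 0 if there is none: the number of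
  digits without leading zeros.\<close>

definition bits_width :: "(nat \<Rightarrow> bool) \<Rightarrow> nat \<Rightarrow> nat" where
  "bits_width b L = bounded_least L (\<lambda>k. \<forall>i<L. k \<le> i \<longrightarrow> \<not> b i)"

lemma bits_width_0: "bits_width b 0 = 0"
  by (simp add: bits_width_def bounded_least_def)

lemma bits_width_eq:
  assumes "w \<le> L" "\<And>i. i < L \<Longrightarrow> w \<le> i \<Longrightarrow> \<not> b i" "w = 0 \<or> b (w - 1)"
  shows "bits_width b L = w"
  unfolding bits_width_def
proof (rule bounded_least_eq)
  fix i assume i: "i < w"
  then have "b (w - 1)" "w - 1 < L" "i \<le> w - 1" using assms by auto
  then show "\<not> (\<forall>j<L. i \<le> j \<longrightarrow> \<not> b j)" by blast
qed (use assms in auto)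

lemma binary_bits_val: "binary (bits_val b L) = map b [0..<bits_width b L]"
proof (induct L arbitrary: b)
  case 0
  then show ?case by (simp add: bits_val_def bits_width_0 binary.simps)
next
  case (Suc L)
  let ?b = "\<lambda>i. b (Suc i)"
  let ?w = "bits_width ?b L"
  have w: "?w \<le> L" "\<And>i. i < L \<Longrightarrow> ?w \<le> i \<Longrightarrow> \<not> ?b i" "?w = 0 \<or> ?b (?w - 1)"
  proof -
    let ?P = "\<lambda>k. \<forall>i<L. k \<le> i \<longrightarrow> \<not> ?b i"
    define m where "m = (LEAST k. ?P k)"
    have P: "?P m" unfolding m_def by (rule LeastI[of ?P L]) simp
    have le: "m \<le> L" unfolding m_def by (rule Least_le) simp
    have last: "m = 0 \<or> ?b (m - 1)"
    proof (rule ccontr)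
      assume m: "\<not> (m = 0 \<or> ?b (m - 1))"
      have "?P (m - 1)"
      proof (intro allI impI)
        fix i assume "i < L" "m - 1 \<le> i"
        then show "\<not> ?b i" using P m by (cases "i = m - 1") auto
      qed
      then have "m \<le> m - 1" unfolding m_def by (rule Least_le)
      then show False using m by linarith
    qed
    have "?w = m" by (rule bits_width_eq) (use P le last in auto)
    then show "?w \<le> L" "\<And>i. i < L \<Longrightarrow> ?w \<le> i \<Longrightarrow> \<not> ?b i" "?w = 0 \<or> ?b (?w - 1)" using P le last by auto
  qed
  have IH: "binary (bits_val ?b L) = map ?b [0..<?w]" by (rule Suc.hyps)
  show ?case
  proof (cases "bits_val b (Suc L) = 0")
    case True
    then have "\<not> b i" if "i < Suc L" for i using bits_val_pos[of b "Suc L"] that by auto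
    then have "bits_width b (Suc L) = 0" by (intro bits_width_eq) auto
    then show ?thesis using True by (simp add: binary.simps)
  next
    case False
    have eq: "bits_width b (Suc L) = Suc ?w"
    proof (rule bits_width_eq)
      show "\<not> b i" if "i < Suc L" "Suc ?w \<le> i" for i using that w(2)[of "i - 1"] by (cases i) auto
      have "?w = 0 \<Longrightarrow> b 0"
      proof (rule ccontr)
        assume "?w = 0" "\<not> b 0"
        then have "\<not> b i" if "i < Suc L" for i using w(2)[of "i - 1"] that by (cases i) auto
        then show False using False bits_val_pos[of b "Suc L"] by auto
      qed
      then show "Suc ?w = 0 \<or> b (Suc ?w - 1)" using w(3) by (cases ?w) auto
    qed (use w in simp)
    have "binary (bits_val b (Suc L)) = b 0 # binary (bits_val ?b L)"
      using False by (subst binary.simps) (auto simp: bits_val_Suc)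
    then show ?thesis unfolding eq IH by (simp add: upt_conv_Cons map_Suc_upt[symmetric] del: upt_Suc)
  qed
qed

lemma less_exp_length_binary: "m < 2 ^ length (binary m)"
proof (induct m rule: binary.induct)
  case (1 m)
  show ?case
  proof (cases "m = 0")
    case False
    then have "m div 2 < 2 ^ length (binary (m div 2))" using 1 by simp
    then show ?thesis using False by (subst binary.simps) auto
  qed simp
qed

text \<open>
  Compares \<open>\<Sum>i<L. Q i * 2 ^ i\<close> with \<open>\<Sum>i<L. P i * 2 ^ i\<close> from the least significant position upwards.
  The accumulator is the carry, shifted by \<open>B\<close> in order to remain a natural number.
\<close>

definition digits_step :: "nat \<Rightarrow> nat \<Rightarrow> (nat \<Rightarrow> nat) \<Rightarrow> (nat \<Rightarrow> nat) \<Rightarrow> nat \<Rightarrow> nat \<Rightarrow> nat" where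
  "digits_step L B P Q i a = (a + B + P (L - 1 - i) - Q (L - 1 - i)) div 2"

definition digits_less :: "nat \<Rightarrow> nat \<Rightarrow> (nat \<Rightarrow> nat) \<Rightarrow> (nat \<Rightarrow> nat) \<Rightarrow> bool" where
  "digits_less L B Q P \<longleftrightarrow> B \<le> foldr (digits_step L B P Q) [0..<L] (B - 1)"

text \<open>After \<open>j\<close> positions the accumulator is \<open>B\<close> plus the floor of
  the partial difference minus 1, divided by \<open>2 ^ j\<close>; successive halvings compose. The
  initial value \<open>B - 1\<close> turns the final comparison with \<open>B\<close> into a strict
  inequality, and since no digit of \<open>Q\<close> exceeds \<open>B\<close>, no subtraction is
  truncated.\<close>

lemma digits_less_iff:
  assumes B: "\<And>i. i < L \<Longrightarrow> Q i \<le> B" "0 < B"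
  shows "digits_less L B Q P \<longleftrightarrow> (\<Sum>i<L. Q i * 2 ^ i) < (\<Sum>i<L. P i * 2 ^ i)"
proof -
  define A where "A j = foldr (digits_step L B P Q) [L - j..<L] (B - 1)" for j
  define D where "D j = (\<Sum>i<j. (int (P i) - int (Q i)) * 2 ^ i) - 1" for j
  have "int (A j) = D j div 2 ^ j + int B" if "j \<le> L" for j
    using that
  proof (induct j)
    case 0
    then show ?case using B(2) by (simp add: A_def D_def)
  next
    case (Suc j)
    then have "[L - Suc j..<L] = (L - Suc j) # [L - j..<L]"
      by (simp add: upt_conv_Cons Suc_diff_Suc)
    moreover have "L - 1 - (L - Suc j) = j" using Suc.prems by simp
    ultimately have A: "A (Suc j) = (A j + B + P j - Q j) div 2" by (simp add: A_def digits_step_def)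
    have D: "D (Suc j) = D j + (int (P j) - int (Q j)) * 2 ^ j" by (simp add: D_def)
    have "Q j \<le> B" using B(1) Suc.prems by simp
    then have "int (A (Suc j)) = (int (A j) + int B + int (P j) - int (Q j)) div 2"
      unfolding A by (simp add: zdiv_int of_nat_diff)
    also have "\<dots> = (D j div 2 ^ j + (int (P j) - int (Q j)) + int B * 2) div 2" using Suc by (simp add: algebra_simps)
    also have "\<dots> = (D j div 2 ^ j + (int (P j) - int (Q j))) div 2 + int B" by simp
    also have "D j div 2 ^ j + (int (P j) - int (Q j)) = D (Suc j) div 2 ^ j" unfolding D by simp
    also have "D (Suc j) div 2 ^ j div 2 = D (Suc j) div 2 ^ Suc j" by (simp add: zdiv_zmult2_eq[symmetric] mult.commute)
    finally show ?case .
  qed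
  from this[of L] have "B \<le> A L \<longleftrightarrow> 0 \<le> D L div 2 ^ L" by linarith
  also have "\<dots> \<longleftrightarrow> 0 \<le> D L" by (simp add: pos_imp_zdiv_nonneg_iff)
  also have "\<dots> \<longleftrightarrow> int (\<Sum>i<L. Q i * 2 ^ i) < int (\<Sum>i<L. P i * 2 ^ i)"
    by (simp add: D_def left_diff_distrib sum_subtractf)
  also have "\<dots> \<longleftrightarrow> (\<Sum>i<L. Q i * 2 ^ i) < (\<Sum>i<L. P i * 2 ^ i)" by (rule of_nat_less_iff)
  finally show ?thesis by (simp add: digits_less_def A_def)
qed

lemma pf_digits_less:
  assumes L: "pf L" and B: "pf B" and Q: "pf (\<lambda>x p. Q x (fst p) (snd p))" and P: "pf (\<lambda>x p. P x (fst p) (snd p))"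
  shows "pf (\<lambda>x (e :: 'e::env). of_bool (digits_less (L x e) (B x e) (Q x e) (P x e)))"
proof -
  from pf_bounded[OF P] obtain b where b: "P x (fst e) (snd e) \<le> poly b (input_size x e)" for x e
    unfolding poly_bounded_def by blast
  have at: "pf (\<lambda>x (p :: ('e \<times> nat) \<times> nat). H x (fst (fst p)) (L x (fst (fst p)) - 1 - snd (fst p)))"
    if H: "pf (\<lambda>x p. H x (fst p) (snd p))" for H :: "bool list \<Rightarrow> 'e \<Rightarrow> nat \<Rightarrow> nat"
  proof -
    have "pf (\<lambda>x (q :: (('e \<times> nat) \<times> nat) \<times> nat). H x (fst (fst (fst (fst q)), snd q)) (snd (fst (fst (fst q)), snd q)))"
      by (rule pf_weaken[OF H]) (intro pf_intros)
    then have "pf (\<lambda>x (q :: (('e \<times> nat) \<times> nat) \<times> nat). H x (fst (fst (fst q))) (snd q))" by simp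
    then show ?thesis
      by (rule pf_let[of "\<lambda>x p i. H x (fst (fst p)) i"]) (intro pf_intros pf_weaken[OF L])
  qed
  \<comment> \<open>An invariant bound: a step adds at most \<open>B\<close> and one digit of
    \<open>P\<close>, that is at most \<open>?b\<close>, and then halves.\<close>
  let ?b = "\<lambda>x e. B x e + poly b (input_size x e + L x e)"
  have "pf (\<lambda>x e. foldr (digits_step (L x e) (B x e) (P x e) (Q x e)) [0..<L x e] (B x e - 1))"
  proof (rule pf_foldr[OF L, of _ _ ?b])
    show "pf (\<lambda>x e. B x e - 1)" by (intro pf_intros B)
    show "pf (\<lambda>x p. digits_step (L x (fst (fst p))) (B x (fst (fst p))) (P x (fst (fst p))) (Q x (fst (fst p))) (snd (fst p)) (snd p))"
      unfolding digits_step_def by (intro pf_intros at[OF P] at[OF Q] pf_weaken[OF B])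
    show "poly_bounded ?b"
      by (intro poly_bounded_add poly_bounded_poly poly_bounded_size pf_bounded L B)
    fix x e j assume "j \<le> L x e"
    then show "foldr (digits_step (L x e) (B x e) (P x e) (Q x e)) [j..<L x e] (B x e - 1) \<le> ?b x e"
    proof (induct j rule: inc_induct)
      case base
      then show ?case by simp
    next
      case (step j)
      let ?i = "L x e - 1 - j"
      have "P x e ?i \<le> poly b (input_size x (e, ?i))" using b[of x "(e, ?i)"] by simp
      also have "\<dots> \<le> poly b (input_size x e + L x e)" by (rule poly_nat_mono) (simp add: input_size_def)
      finally have "P x e ?i \<le> poly b (input_size x e + L x e)" .
      then show ?case using step(2,3) unfolding upt_conv_Cons[OF step(2)] by (simp add: digits_step_def)
    qed
  qed
  then show ?thesis unfolding digits_less_def by (intro pf_intros B)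
qed

section \<open>Membership in NP\<close>

definition path_arc :: "(nat \<Rightarrow> 'a) \<Rightarrow> nat \<Rightarrow> 'a \<times> 'a" where
  "path_arc P i = (P i, P (Suc i))"

definition descents :: "('a \<times> 'a \<Rightarrow> nat) \<Rightarrow> (nat \<Rightarrow> 'a) \<Rightarrow> nat \<Rightarrow> nat" where
  "descents lab P m = (\<Sum>j<m. of_bool (lab (path_arc P (Suc j)) \<le> lab (path_arc P j)))"

lemma pcas_path_arcs: "pcas (P 0) (map (path_arc P) [0..<l]) (P l)"
  by (induct l) (auto simp: pcas_append path_arc_def)

lemma verts_path_arcs: "P 0 # map snd (map (path_arc P) [0..<l]) = map P [0..<Suc l]"
  by (induct l) (simp_all add: path_arc_def)

lemma apath_path_arcs:
  assumes "P 0 \<in> pverts G" "\<And>i. i < l \<Longrightarrow> path_arc P i \<in> parcs G" "inj_on P {..<Suc l}"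
  shows "pre_digraph.apath (with_proj G) (P 0) (map (path_arc P) [0..<l]) (P l)"
  unfolding apath_pair verts_path_arcs
  using assms pcas_path_arcs[of P l] by (auto simp: distinct_map atLeast0LessThan simp del: upt_Suc)

lemma apath_obtain_vertices:
  assumes "pre_digraph.apath (with_proj G) u es v"
  obtains P where "es = map (path_arc P) [0..<length es]" "P 0 = u" "P (length es) = v" "inj_on P {..<Suc (length es)}"
    "\<And>i. i < length es \<Longrightarrow> path_arc P i \<in> parcs G"
proof -
  let ?P = "\<lambda>i. (u # map snd es) ! i"
  have *: "es = map (path_arc (\<lambda>i. (u # map snd es) ! i)) [0..<length es] \<and> (u # map snd es) ! length es = v"
    if "pcas u es v" for u
    using that
  proof (induct es arbitrary: u)
    case (Cons e es)
    then have IH: "es = map (path_arc (\<lambda>i. (snd e # map snd es) ! i)) [0..<length es]"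
      "(snd e # map snd es) ! length es = v" "u = fst e" by auto
    have "map (path_arc (\<lambda>i. (u # map snd (e # es)) ! i)) [0..<length (e # es)]
      = (u, snd e) # map (path_arc (\<lambda>i. (snd e # map snd es) ! i)) [0..<length es]"
      by (simp add: upt_conv_Cons map_Suc_upt[symmetric] path_arc_def del: upt_Suc)
    then show ?case using IH by simp
  qed (simp add: path_arc_def)
  from assms have a: "pcas u es v" "set es \<subseteq> parcs G" "distinct (u # map snd es)" by (auto simp: apath_pair)
  show ?thesis
  proof (rule that[of ?P])
    show es: "es = map (path_arc ?P) [0..<length es]" and "?P (length es) = v" using *[OF a(1)] by auto
    show "?P 0 = u" by simp
    show "inj_on ?P {..<Suc (length es)}" using a(3) by (intro inj_on_nth) auto
    show "path_arc ?P i \<in> parcs G" if "i < length es" for i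
    proof -
      have "es ! i = path_arc ?P i" using arg_cong[OF es, of "\<lambda>xs. xs ! i"] that by simp
      then show ?thesis using a(2) nth_mem[OF that] by auto
    qed
  qed
qed

text \<open>At a descent the next arc is used one period later, elsewhere in the same
  period.\<close>

lemma greedy_temporal_path:
  assumes apath: "P 0 \<in> pverts G" "\<And>i. i < l \<Longrightarrow> path_arc P i \<in> parcs G" "inj_on P {..<Suc l}"
    and l: "0 < l" and lab: "\<And>i. i < l \<Longrightarrow> lab (path_arc P i) < \<Delta>"
  obtains p where "temporal_path G \<Delta> lab (P 0) p (P l)"
    "duration p = lab (path_arc P (l - 1)) + descents lab P (l - 1) * \<Delta> + 1 - lab (path_arc P 0)"
proof -
  define t where "t i = lab (path_arc P i) + descents lab P i * \<Delta>" for i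
  let ?p = "map (\<lambda>i. (path_arc P i, t i)) [0..<l]"
  have step: "t i < t (Suc i)" if "Suc i < l" for i
    using lab[of i] that by (auto simp: t_def descents_def)
  have "sorted_wrt (<) (map t [0..<l])"
    by (subst sorted_wrt_iff_nth_Suc_transp) (auto simp: step)
  moreover have "map fst ?p = map (path_arc P) [0..<l]" "map snd ?p = map t [0..<l]" by simp_all
  moreover have "active \<Delta> lab (path_arc P i) (t i)" for i by (auto simp: active_def t_def)
  ultimately have "temporal_path G \<Delta> lab (P 0) ?p (P l)"
    using apath_path_arcs[OF apath] l unfolding temporal_path_def by (simp only:) auto
  moreover have "duration ?p = t (l - 1) + 1 - t 0"
    using l by (simp add: duration_def hd_map last_map)
  ultimately show ?thesis using that[of ?p] by (simp add: t_def descents_def)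
qed

text \<open>Let \<open>k i\<close> be the number of the period in which arc \<open>i\<close> is
  used. Since labels lie below the period, \<open>k\<close> never decreases, and increasing times
  force it to grow at each descent.\<close>

lemma greedy_optimal:
  assumes p: "temporal_path G \<Delta> lab u p v" and P: "map fst p = map (path_arc P) [0..<length p]"
    and lab: "\<And>i. i < length p \<Longrightarrow> lab (path_arc P i) < \<Delta>"
  shows "lab (path_arc P (length p - 1)) + descents lab P (length p - 1) * \<Delta> < duration p + lab (path_arc P 0)"
proof -
  let ?l = "length p"
  have l: "0 < ?l" using p by (auto simp: temporal_path_def)
  define t where "t i = snd (p ! i)" for i
  have e: "fst (p ! i) = path_arc P i" if "i < ?l" for i
    using arg_cong[OF P, of "\<lambda>xs. xs ! i"] that by simp
  have "\<forall>i<?l. \<exists>k. t i = lab (path_arc P i) + k * \<Delta>"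
  proof (intro allI impI)
    fix i assume i: "i < ?l"
    then have "active \<Delta> lab (fst (p ! i)) (snd (p ! i))"
      using p nth_mem[OF i] unfolding temporal_path_def by (cases "p ! i") auto
    then show "\<exists>k. t i = lab (path_arc P i) + k * \<Delta>" using e[OF i] by (simp add: active_def t_def)
  qed
  then obtain k where k: "\<And>i. i < ?l \<Longrightarrow> t i = lab (path_arc P i) + k i * \<Delta>" by metis
  have inc: "t i < t (Suc i)" if "Suc i < ?l" for i
    using p that by (auto simp: temporal_path_def t_def sorted_wrt_iff_nth_less)
  have mono: "k 0 + descents lab P i \<le> k i" if "i < ?l" for i
    using that
  proof (induct i)
    case (Suc i)
    have "k i + of_bool (lab (path_arc P (Suc i)) \<le> lab (path_arc P i)) \<le> k (Suc i)"
    proof (cases "lab (path_arc P (Suc i)) \<le> lab (path_arc P i)")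
      case True
      then have "k i * \<Delta> < k (Suc i) * \<Delta>" using inc[OF Suc.prems] k[of i] k[of "Suc i"] Suc.prems by linarith
      then show ?thesis using True by simp
    next
      case False
      show ?thesis
      proof (rule ccontr)
        assume "\<not> ?thesis"
        then have "Suc (k (Suc i)) \<le> k i" using False by simp
        then have "k (Suc i) * \<Delta> + \<Delta> \<le> k i * \<Delta>" using mult_le_mono1[of "Suc (k (Suc i))" "k i" \<Delta>] by simp
        then show False
          using inc[OF Suc.prems] k[of i] k[of "Suc i"] lab[of "Suc i"] Suc.prems by linarith
      qed
    qed
    then show ?case using Suc by (simp add: descents_def)
  qed (simp add: descents_def)
  have "(k 0 + descents lab P (?l - 1)) * \<Delta> \<le> k (?l - 1) * \<Delta>" using mono[of "?l - 1"] l by (intro mult_le_mono1) simp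
  moreover have "duration p = t (?l - 1) + 1 - t 0"
    using l by (simp add: duration_def t_def hd_conv_nth last_conv_nth)
  ultimately show ?thesis using k[of 0] k[of "?l - 1"] l by (simp add: algebra_simps) linarith
qed

text \<open>
  The certificate is a bit string \<open>c\<close> with mixed-radix addresses. It contains the period, the matrix,
  the labels, and for each pair of vertices the vertices of a path, in unary.
\<close>

definition "side_length x = length x + 8" for x :: "bool list"

text \<open>Vertices and bit positions are below the radix \<open>side_length x\<close>; its summand
  8 makes room for the field numbers 0 to 5 also when \<open>x\<close> is short.\<close>

definition address :: "bool list \<Rightarrow> nat \<Rightarrow> nat \<Rightarrow> nat \<Rightarrow> nat \<Rightarrow> nat \<Rightarrow> nat" where
  "address x a u v i s = a + side_length x * (u + side_length x * (v + side_length x * (i + side_length x * s)))"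

text \<open>The code of an instance begins with its number of vertices in unary, and the symbol 2
  stands for \<open>True\<close>.\<close>

definition order_of :: "bool list \<Rightarrow> nat" where
  "order_of x = bounded_least (length x) (\<lambda>i. bit_sym x i \<noteq> 2)"

type_synonym cert = "nat \<Rightarrow> bool"

definition period_bit :: "bool list \<Rightarrow> cert \<Rightarrow> nat \<Rightarrow> bool" where
  "period_bit x c i = c (address x 0 0 0 i 0)"
definition unbounded :: "bool list \<Rightarrow> cert \<Rightarrow> nat \<Rightarrow> nat \<Rightarrow> bool" where
  "unbounded x c u v = c (address x 1 u v 0 0)"
definition matrix_bit :: "bool list \<Rightarrow> cert \<Rightarrow> nat \<Rightarrow> nat \<Rightarrow> nat \<Rightarrow> bool" where
  "matrix_bit x c u v i = c (address x 2 u v i 0)"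
definition label_bit :: "bool list \<Rightarrow> cert \<Rightarrow> nat \<Rightarrow> nat \<Rightarrow> nat \<Rightarrow> bool" where
  "label_bit x c u v i = c (address x 3 u v i 0)"
definition arc_bit :: "bool list \<Rightarrow> cert \<Rightarrow> nat \<Rightarrow> nat \<Rightarrow> bool" where
  "arc_bit x c u v = c (address x 4 u v 0 0)"
text \<open>Without any mark the value is \<open>order_of x\<close>, which is not a vertex.\<close>

definition path_vertex :: "bool list \<Rightarrow> cert \<Rightarrow> nat \<Rightarrow> nat \<Rightarrow> nat \<Rightarrow> nat" where
  "path_vertex x c u v i = bounded_least (order_of x) (\<lambda>s. c (address x 5 u v i s))"
definition path_length :: "bool list \<Rightarrow> cert \<Rightarrow> nat \<Rightarrow> nat \<Rightarrow> nat" where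
  "path_length x c u v = bounded_least (order_of x) (\<lambda>i. path_vertex x c u v i = v)"

definition path_label_bit :: "bool list \<Rightarrow> cert \<Rightarrow> nat \<Rightarrow> nat \<Rightarrow> nat \<Rightarrow> nat \<Rightarrow> bool" where
  "path_label_bit x c u v j i = label_bit x c (path_vertex x c u v j) (path_vertex x c u v (Suc j)) i"

definition path_descents :: "bool list \<Rightarrow> cert \<Rightarrow> nat \<Rightarrow> nat \<Rightarrow> nat" where
  "path_descents x c u v = (\<Sum>j<path_length x c u v - 1. of_bool (\<not> digits_less (length x) 1
     (\<lambda>i. of_bool (path_label_bit x c u v j i)) (\<lambda>i. of_bool (path_label_bit x c u v (Suc j) i))))"

text \<open>This says that the greedy duration is at most the matrix entry, rearranged so that
  nothing is subtracted. Labels, period and entry may be exponentially large, but the number of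
  descents is not; so its product with the period is formed digit by digit, with digits up to
  \<open>path_descents x c u v + 1\<close> after the label is added.\<close>

definition path_fast :: "bool list \<Rightarrow> cert \<Rightarrow> nat \<Rightarrow> nat \<Rightarrow> bool" where
  "path_fast x c u v \<longleftrightarrow> digits_less (length x) (path_descents x c u v + 1)
     (\<lambda>i. of_bool (path_label_bit x c u v (path_length x c u v - 1) i) + path_descents x c u v * of_bool (period_bit x c i))
     (\<lambda>i. of_bool (matrix_bit x c u v i) + of_bool (path_label_bit x c u v 0 i))"

definition path_valid :: "bool list \<Rightarrow> cert \<Rightarrow> nat \<Rightarrow> nat \<Rightarrow> bool" where
  "path_valid x c u v \<longleftrightarrow> path_vertex x c u v 0 = u \<and>
     path_vertex x c u v (path_length x c u v) = v \<and>
     (\<forall>i<path_length x c u v. path_vertex x c u v i < order_of x \<and> path_vertex x c u v (Suc i) < order_of x \<and>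
        arc_bit x c (path_vertex x c u v i) (path_vertex x c u v (Suc i))) \<and>
     (\<forall>i<Suc (path_length x c u v). \<forall>j<i. path_vertex x c u v i \<noteq> path_vertex x c u v j)"

definition code_bits :: "(nat \<Rightarrow> bool) \<Rightarrow> nat \<Rightarrow> bool list" where
  "code_bits b L = concat (map (\<lambda>i. [True, b i]) [0..<bits_width b L]) @ [False]"

text \<open>The input is not parsed: the instance contained in the certificate is encoded again and
  compared with \<open>x\<close>.\<close>

definition instance_code :: "bool list \<Rightarrow> cert \<Rightarrow> bool list" where
  "instance_code x c = map (\<lambda>i. True) [0..<order_of x] @ [False] @
    concat (map (\<lambda>u. map (\<lambda>v. arc_bit x c u v) [0..<order_of x]) [0..<order_of x]) @
    concat (map (\<lambda>u. concat (map (\<lambda>v. if unbounded x c u v then [False]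
        else True # code_bits (matrix_bit x c u v) (length x)) [0..<order_of x])) [0..<order_of x]) @
    code_bits (period_bit x c) (length x)"

text \<open>A valid path is demanded for pairs with infinite bound as well, since the paths certify
  strong connectivity.\<close>

definition check :: "bool list \<Rightarrow> cert \<Rightarrow> bool" where
  "check x c \<longleftrightarrow> 0 < order_of x \<and> x = instance_code x c \<and> (\<forall>u<order_of x. \<not> arc_bit x c u u) \<and>
    (\<exists>i<length x. period_bit x c i) \<and>
    (\<forall>u<order_of x. \<forall>v<order_of x. arc_bit x c u v \<longrightarrow>
       digits_less (length x) 1 (\<lambda>i. of_bool (label_bit x c u v i)) (\<lambda>i. of_bool (period_bit x c i))) \<and>
    (\<forall>u<order_of x. \<forall>v<order_of x. u = v \<or> path_valid x c u v \<and> (unbounded x c u v \<or> path_fast x c u v))"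

section \<open>Meaning and correctness of the verifier\<close>

lemma code_bits_eq: "code_bits b L = encode_nat (bits_val b L)"
  by (simp add: code_bits_def encode_nat_def binary_bits_val delimit_def comp_def)

definition cert_graph :: "bool list \<Rightarrow> cert \<Rightarrow> nat pair_pre_digraph" where
  "cert_graph x c = \<lparr>pverts = {..<order_of x}, parcs = {(u, v). u < order_of x \<and> v < order_of x \<and> arc_bit x c u v}\<rparr>"

definition cert_matrix :: "bool list \<Rightarrow> cert \<Rightarrow> nat \<Rightarrow> nat \<Rightarrow> enat" where
  "cert_matrix x c u v = (if unbounded x c u v then \<infinity> else enat (bits_val (matrix_bit x c u v) (length x)))"

definition cert_period :: "bool list \<Rightarrow> cert \<Rightarrow> nat" where
  "cert_period x c = bits_val (period_bit x c) (length x)"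

definition cert_label :: "bool list \<Rightarrow> cert \<Rightarrow> nat \<times> nat \<Rightarrow> nat" where
  "cert_label x c = (\<lambda>(u, v). bits_val (label_bit x c u v) (length x))"

lemma instance_code_eq:
  "instance_code x c = encode (cert_graph x c, cert_matrix x c, cert_period x c)"
proof -
  have "(if unbounded x c u v then [False] else True # code_bits (matrix_bit x c u v) (length x)) =
    encode_enat (cert_matrix x c u v)" for u v
    by (simp add: cert_matrix_def encode_enat_def code_bits_eq)
  moreover have "concat (map (\<lambda>u. map (\<lambda>v. (u, v) \<in> parcs (cert_graph x c)) [0..<order_of x]) [0..<order_of x]) =
    concat (map (\<lambda>u. map (\<lambda>v. arc_bit x c u v) [0..<order_of x]) [0..<order_of x])"
    by (intro arg_cong[of _ _ concat] map_cong) (auto simp: cert_graph_def)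
  moreover have "pverts (cert_graph x c) = {..<order_of x}" by (simp add: cert_graph_def)
  ultimately show ?thesis unfolding encode_conv[OF \<open>pverts _ = _\<close>] instance_code_def
    by (simp only: code_bits_eq cert_period_def)
qed

lemma digits_less_bits:
  "digits_less L 1 (\<lambda>i. of_bool (a i)) (\<lambda>i. of_bool (b i)) \<longleftrightarrow> bits_val a L < bits_val b L"
  by (subst digits_less_iff) (simp_all add: bits_val_def)

lemma path_label: "bits_val (path_label_bit x c u v j) (length x) = cert_label x c (path_arc (path_vertex x c u v) j)"
  by (simp add: path_label_bit_def[abs_def] cert_label_def path_arc_def)

lemma path_descents_eq:
  "path_descents x c u v = descents (cert_label x c) (path_vertex x c u v) (path_length x c u v - 1)"
  by (simp add: path_descents_def descents_def digits_less_bits[unfolded One_nat_def] path_label not_less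
     del: sum_of_bool_eq)

lemma path_fast_iff:
  "path_fast x c u v \<longleftrightarrow>
    cert_label x c (path_arc (path_vertex x c u v) (path_length x c u v - 1)) +
      descents (cert_label x c) (path_vertex x c u v) (path_length x c u v - 1) * cert_period x c
    < bits_val (matrix_bit x c u v) (length x) + cert_label x c (path_arc (path_vertex x c u v) 0)"
proof -
  let ?d = "path_descents x c u v"
  have "path_fast x c u v \<longleftrightarrow> (\<Sum>i<length x. (of_bool (path_label_bit x c u v (path_length x c u v - 1) i) +
        ?d * of_bool (period_bit x c i)) * 2 ^ i)
     < (\<Sum>i<length x. (of_bool (matrix_bit x c u v i) + of_bool (path_label_bit x c u v 0 i)) * 2 ^ i)"
    unfolding path_fast_def by (rule digits_less_iff) auto
  also have "(\<Sum>i<length x. (of_bool (path_label_bit x c u v (path_length x c u v - 1) i) +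
        ?d * of_bool (period_bit x c i)) * 2 ^ i) =
      bits_val (path_label_bit x c u v (path_length x c u v - 1)) (length x) + ?d * bits_val (period_bit x c) (length x)"
    unfolding bits_val_def distrib_right sum.distrib sum_distrib_left mult.assoc ..
  also have "(\<Sum>i<length x. (of_bool (matrix_bit x c u v i) + of_bool (path_label_bit x c u v 0 i)) * 2 ^ i) =
      bits_val (matrix_bit x c u v) (length x) + bits_val (path_label_bit x c u v 0) (length x)"
    unfolding bits_val_def distrib_right sum.distrib ..
  finally show ?thesis by (simp add: path_label path_descents_eq cert_period_def)
qed

lemma check_sound:
  assumes "check x c"
  shows "x \<in> DiTGR"
proof -
  let ?n = "order_of x" let ?G = "cert_graph x c" let ?D = "cert_matrix x c" let ?\<Delta> = "cert_period x c"
  let ?lab = "cert_label x c"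
  have n: "0 < ?n" and x: "x = encode (?G, ?D, ?\<Delta>)" and loop: "\<And>u. u < ?n \<Longrightarrow> \<not> arc_bit x c u u"
    and period: "0 < ?\<Delta>"
    and lab: "\<And>u v. u < ?n \<Longrightarrow> v < ?n \<Longrightarrow> arc_bit x c u v \<Longrightarrow> ?lab (u, v) < ?\<Delta>"
    and path: "\<And>u v. u < ?n \<Longrightarrow> v < ?n \<Longrightarrow> u \<noteq> v \<Longrightarrow> path_valid x c u v"
    and fast: "\<And>u v. u < ?n \<Longrightarrow> v < ?n \<Longrightarrow> u \<noteq> v \<Longrightarrow> \<not> unbounded x c u v \<Longrightarrow> path_fast x c u v"
    using assms unfolding check_def instance_code_eq digits_less_bits
    by (auto simp: cert_period_def bits_val_pos cert_label_def)
  have verts: "pverts ?G = {..<?n}" by (simp add: cert_graph_def)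
  have wf: "pair_digraph ?G"
    using loop by unfold_locales (auto simp: cert_graph_def intro: finite_subset[of _ "{..<?n} \<times> {..<?n}"])
  have pathD: "\<exists>P l. 0 < l \<and> P 0 = u \<and> P l = v \<and> inj_on P {..<Suc l} \<and>
      (\<forall>i<l. path_arc P i \<in> parcs ?G \<and> ?lab (path_arc P i) < ?\<Delta>) \<and>
      (\<not> unbounded x c u v \<longrightarrow> ?lab (path_arc P (l - 1)) + descents ?lab P (l - 1) * ?\<Delta>
        < bits_val (matrix_bit x c u v) (length x) + ?lab (path_arc P 0))"
    if uv: "u < ?n" "v < ?n" "u \<noteq> v" for u v
  proof (intro exI conjI allI impI)
    let ?P = "path_vertex x c u v" let ?l = "path_length x c u v"
    note p = path[OF uv, unfolded path_valid_def]
    show "?P 0 = u" "?P ?l = v" using p by auto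
    then show "0 < ?l" using uv(3) by (cases ?l) auto
    show "inj_on ?P {..<Suc ?l}"
    proof (rule inj_onI)
      fix i j assume "i \<in> {..<Suc ?l}" "j \<in> {..<Suc ?l}" "?P i = ?P j"
      then show "i = j" using p by (cases i j rule: linorder_cases) (auto, metis)
    qed
    show "path_arc ?P i \<in> parcs ?G" if "i < ?l" for i using p that by (simp add: cert_graph_def path_arc_def)
    show "?lab (path_arc ?P i) < ?\<Delta>" if "i < ?l" for i using p that lab by (simp add: path_arc_def)
    show "?lab (path_arc ?P (?l - 1)) + descents ?lab ?P (?l - 1) * ?\<Delta>
        < bits_val (matrix_bit x c u v) (length x) + ?lab (path_arc ?P 0)" if "\<not> unbounded x c u v"
      using fast[OF uv that] by (simp add: path_fast_iff)
  qed
  have walk: "\<exists>p. pre_digraph.awalk (with_proj ?G) u p v" if "u < ?n" "v < ?n" for u v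
  proof (cases "u = v")
    case True
    then show ?thesis using that by (intro exI[of _ "[]"]) (simp add: awalk_pair verts)
  next
    case False
    from pathD[OF that False] obtain P l where P: "P 0 = u" "P l = v" "\<And>i. i < l \<Longrightarrow> path_arc P i \<in> parcs ?G" by blast
    then show ?thesis using that pcas_path_arcs[of P l]
      by (intro exI[of _ "map (path_arc P) [0..<l]"]) (auto simp: awalk_pair verts)
  qed
  have temporal: "\<exists>p. temporal_path ?G ?\<Delta> ?lab u p v \<and> duration p \<le> d"
    if uv: "u < ?n" "v < ?n" "u \<noteq> v" and d: "?D u v = enat d" for u v d
  proof -
    from pathD[OF uv] obtain P l where P: "0 < l" "P 0 = u" "P l = v" "inj_on P {..<Suc l}"
      "\<And>i. i < l \<Longrightarrow> path_arc P i \<in> parcs ?G" "\<And>i. i < l \<Longrightarrow> ?lab (path_arc P i) < ?\<Delta>"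
      and bound: "\<not> unbounded x c u v \<Longrightarrow> ?lab (path_arc P (l - 1)) + descents ?lab P (l - 1) * ?\<Delta>
        < bits_val (matrix_bit x c u v) (length x) + ?lab (path_arc P 0)"
      by blast
    have "P 0 \<in> pverts ?G" using P(2) uv verts by simp
    from greedy_temporal_path[of P ?G l ?lab ?\<Delta>, OF this P(5,4,1,6)] obtain p where
      p: "temporal_path ?G ?\<Delta> ?lab (P 0) p (P l)"
        "duration p = ?lab (path_arc P (l - 1)) + descents ?lab P (l - 1) * ?\<Delta> + 1 - ?lab (path_arc P 0)" .
    have "\<not> unbounded x c u v" "d = bits_val (matrix_bit x c u v) (length x)"
      using d by (auto simp: cert_matrix_def split: if_splits)
    then have "duration p \<le> d" using p(2) bound by linarith
    then show ?thesis using p(1) P(2,3) by blast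
  qed
  \<comment> \<open>The temporal path itself shows that a finite entry is admissible: it has at
    least one arc and at most as many arcs as its duration.\<close>
  have entry: "0 < ?D u v \<and> static_dist ?G u v \<le> ereal_of_enat (?D u v) \<and> fastest_duration ?G ?\<Delta> ?lab u v \<le> ?D u v"
    if uv: "u < ?n" "v < ?n" "u \<noteq> v" for u v
  proof (cases "?D u v")
    case (enat d)
    from temporal[OF uv enat] obtain p where p: "temporal_path ?G ?\<Delta> ?lab u p v" "duration p \<le> d" by blast
    then have len: "length p \<le> d" "0 < length p" using temporal_path_duration[OF p(1)] by (auto simp: temporal_path_def)
    have "pre_digraph.awalk (with_proj ?G) u (map fst p) v"
      using p(1) by (simp add: temporal_path_def apath_pair awalk_pair)
    from static_dist_le[OF wf this] have "static_dist ?G u v \<le> ereal (real (length p))" by simp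
    also have "\<dots> \<le> ereal (real d)" using len by simp
    finally have "static_dist ?G u v \<le> ereal (real d)" .
    moreover have "fastest_duration ?G ?\<Delta> ?lab u v \<le> enat d" unfolding fastest_duration_le_iff using p by blast
    moreover have "0 < d" using len by linarith
    ultimately show ?thesis by (simp add: enat zero_enat_def)
  qed (simp add: zero_enat_def)
  have "strongly_connected (with_proj ?G)"
    by (rule strongly_connected_pairI[OF wf]) (use n verts walk in auto)
  then have "encodable (?G, ?D, ?\<Delta>)" using wf period verts entry by (auto simp: encodable_def)
  moreover have "periodic_labeling ?G ?\<Delta> ?lab"
    using lab by (auto simp: periodic_labeling_def cert_graph_def)
  then have "ditgr_yes (?G, ?D, ?\<Delta>)" using entry verts by auto
  ultimately show ?thesis unfolding DiTGR_def using x by blast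
qed

lemma length_le_concat: "a \<in> set xs \<Longrightarrow> length (f a) \<le> length (concat (map f xs))"
  by (induct xs) auto

lemma length_encode_nat: "length (binary m) \<le> length (encode_nat m)"
proof -
  have "length (delimit y) = 2 * length y + 1" for y by (induct y) auto
  then show ?thesis by (simp add: encode_nat_def)
qed

lemma less_exp_encode_nat: "length (encode_nat m) \<le> L \<Longrightarrow> m < 2 ^ L"
  using less_exp_length_binary[of m] length_encode_nat[of m]
  by (meson less_le_trans order_trans one_le_numeral power_increasing)

lemma check_complete:
  assumes I: "encodable (G, D, \<Delta>)" and yes: "ditgr_yes (G, D, \<Delta>)" and x: "x = encode (G, D, \<Delta>)"
  shows "\<exists>w. length w = side_length x ^ 5 \<and> check x (\<lambda>j. j < length w \<and> w ! j)"
proof -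
  from I obtain n where verts: "pverts G = {..<n}" by (auto simp: encodable_def)
  have wf: "pair_digraph G" and sc: "strongly_connected (with_proj G)" and \<Delta>: "0 < \<Delta>"
    using I by (auto simp: encodable_def)
  interpret pair_digraph G by (rule wf)
  from yes obtain lab where lab: "periodic_labeling G \<Delta> lab"
    and dur: "\<And>u v. u < n \<Longrightarrow> v < n \<Longrightarrow> u \<noteq> v \<Longrightarrow> fastest_duration G \<Delta> lab u v \<le> D u v"
    using verts by auto
  have lab: "lab e < \<Delta>" if "e \<in> parcs G" for e using lab that by (auto simp: periodic_labeling_def)
  have arc_n: "u < n" "v < n" if "(u, v) \<in> parcs G" for u v using wellformed'[OF that] verts by auto
  have n0: "0 < n" using sc verts by (auto simp: strongly_connected_def)
  note conv = encode_conv[OF verts, of D \<Delta>]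
  have len_x: "n < length x" "length (encode_nat \<Delta>) \<le> length x" unfolding x conv by simp_all
  have len_D: "length (encode_enat (D u v)) \<le> length x" if "u < n" "v < n" for u v
  proof -
    have "length (encode_enat (D u v)) \<le> length (concat (map (\<lambda>v. encode_enat (D u v)) [0..<n]))"
      by (rule length_le_concat) (use that in simp)
    also have "\<dots> \<le> length (concat (map (\<lambda>u. concat (map (\<lambda>v. encode_enat (D u v)) [0..<n])) [0..<n]))"
      by (rule length_le_concat[of u _ "\<lambda>u. concat (map (\<lambda>v. encode_enat (D u v)) [0..<n])"]) (use that in simp)
    finally show ?thesis unfolding x conv by simp
  qed
  have order: "order_of x = n"
    unfolding order_of_def
  proof (rule bounded_least_eq)
    show "\<not> bit_sym x i \<noteq> 2" if "i < n" for i using that unfolding x conv by (simp add: bit_sym_def nth_append)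
    show "bit_sym x n \<noteq> 2" unfolding x conv by (simp add: bit_sym_def nth_append)
  qed (use len_x in simp)
  \<comment> \<open>The codes of the period and of the entries are parts of \<open>x\<close>, so
    \<open>length x\<close> digits suffice for them, and for the labels, which lie below the
    period.\<close>
  have period_less: "\<Delta> < 2 ^ length x" using less_exp_encode_nat len_x(2) .
  have D_less: "d < 2 ^ length x" if "u < n" "v < n" "D u v = enat d" for u v d
    using len_D[OF that(1,2)] that(3) by (intro less_exp_encode_nat) (simp add: encode_enat_def)
  define good where "good u v P l \<longleftrightarrow> 0 < l \<and> P 0 = u \<and> P l = v \<and> inj_on P {..<Suc l} \<and>
      (\<forall>i<l. path_arc P i \<in> parcs G) \<and>
      (\<forall>d. D u v = enat d \<longrightarrow> lab (path_arc P (l - 1)) + descents lab P (l - 1) * \<Delta> < d + lab (path_arc P 0))"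
    for u v l :: nat and P
  have "\<exists>P l. good u v P l" if uv: "u < n" "v < n" "u \<noteq> v" for u v
  proof (cases "D u v")
    case (enat d)
    then have "fastest_duration G \<Delta> lab u v \<le> enat d" using dur[OF uv] by simp
    then obtain p where p: "temporal_path G \<Delta> lab u p v" "duration p \<le> d"
      unfolding fastest_duration_le_iff by blast
    then have "pre_digraph.apath (with_proj G) u (map fst p) v" by (simp add: temporal_path_def)
    from apath_obtain_vertices[OF this] obtain P where P: "map fst p = map (path_arc P) [0..<length p]"
      "P 0 = u" "P (length p) = v" "inj_on P {..<Suc (length p)}" "\<And>i. i < length p \<Longrightarrow> path_arc P i \<in> parcs G"
      by (metis length_map)
    have "0 < length p" using p(1) by (simp add: temporal_path_def)
    moreover have "lab (path_arc P (length p - 1)) + descents lab P (length p - 1) * \<Delta> < duration p + lab (path_arc P 0)"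
      by (rule greedy_optimal[OF p(1) P(1)]) (use lab P(5) in blast)
    ultimately have "good u v P (length p)" unfolding good_def using P p(2) enat by auto
    then show ?thesis by blast
  next
    \<comment> \<open>Here any path of the graph will do, and strong connectivity provides
      one.\<close>
    case infinity
    have "u \<rightarrow>\<^sup>*\<^bsub>with_proj G\<^esub> v" using sc uv verts by (auto simp: strongly_connected_def)
    then obtain p where "pre_digraph.awalk (with_proj G) u p v" unfolding reachable_awalk by blast
    then have "pre_digraph.apath (with_proj G) u (awalk_to_apath p) v" by (rule apath_awalk_to_apath)
    from apath_obtain_vertices[OF this] obtain P where P: 
      "P 0 = u" "P (length (awalk_to_apath p)) = v" "inj_on P {..<Suc (length (awalk_to_apath p))}"
      "\<And>i. i < length (awalk_to_apath p) \<Longrightarrow> path_arc P i \<in> parcs G"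
      by metis
    moreover have "0 < length (awalk_to_apath p)" using P(1,2) uv(3) by (cases "length (awalk_to_apath p)") auto
    ultimately have "good u v P (length (awalk_to_apath p))" unfolding good_def using infinity by auto
    then show ?thesis by blast
  qed
  then obtain PP LL where good: "\<And>u v. u < n \<Longrightarrow> v < n \<Longrightarrow> u \<noteq> v \<Longrightarrow> good u v (PP u v) (LL u v)"
    by metis
  let ?K = "side_length x"
  define F where "F a u v i s \<longleftrightarrow> (if a = 0 then odd (\<Delta> div 2 ^ i) else if a = 1 then D u v = \<infinity>
    else if a = 2 then odd (the_enat (D u v) div 2 ^ i) else if a = 3 then odd (lab (u, v) div 2 ^ i)
    else if a = 4 then (u, v) \<in> parcs G else PP u v i = s)" for a u v i s :: nat
  define w where "w = map (\<lambda>j. F (j mod ?K) (j div ?K mod ?K) (j div ?K div ?K mod ?K)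
    (j div ?K div ?K div ?K mod ?K) (j div ?K div ?K div ?K div ?K)) [0..<?K * (?K * (?K * (?K * ?K)))]"
  define c where "c j \<longleftrightarrow> j < length w \<and> w ! j" for j
  have c: "c (address x a u v i s) = F a u v i s" if "a < 8" "u < ?K" "v < ?K" "i < ?K" "s < ?K" for a u v i s
  proof -
    have a: "a < ?K" using that(1) by (simp add: side_length_def)
    then have "address x a u v i s < ?K * (?K * (?K * (?K * ?K)))"
      unfolding address_def using that by (intro radix_less)
    then show ?thesis unfolding c_def w_def using a that
      by (simp only: length_map length_upt diff_zero nth_map_upt add_0 simp_thms) 
         (simp only: address_def radix_mod_div)
  qed
  have K: "n < ?K" "length x < ?K" "0 < ?K" using len_x by (simp_all add: side_length_def)
  have period: "cert_period x c = \<Delta>"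
  proof -
    have "cert_period x c = bits_val (\<lambda>i. odd (\<Delta> div 2 ^ i)) (length x)"
      unfolding cert_period_def using K by (intro bits_val_cong) (simp add: period_bit_def c F_def)
    then show ?thesis using bits_val_bit[OF period_less] by simp
  qed
  have matrix: "cert_matrix x c u v = D u v" "unbounded x c u v \<longleftrightarrow> D u v = \<infinity>" if uv: "u < n" "v < n" for u v
  proof -
    show unb: "unbounded x c u v \<longleftrightarrow> D u v = \<infinity>" using uv K by (simp add: unbounded_def c F_def)
    have "bits_val (matrix_bit x c u v) (length x) = bits_val (\<lambda>i. odd (the_enat (D u v) div 2 ^ i)) (length x)"
      using K uv by (intro bits_val_cong) (simp add: matrix_bit_def c F_def)
    then show "cert_matrix x c u v = D u v"
      using bits_val_bit D_less[OF uv] unb by (cases "D u v") (auto simp: cert_matrix_def)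
  qed
  have label: "cert_label x c e = lab e" if e: "e \<in> parcs G" for e
  proof -
    obtain u v where uv: "e = (u, v)" by (cases e)
    have "bits_val (label_bit x c u v) (length x) = bits_val (\<lambda>i. odd (lab (u, v) div 2 ^ i)) (length x)"
      using K arc_n[of u v] e uv by (intro bits_val_cong) (simp add: label_bit_def c F_def)
    moreover have "lab (u, v) < 2 ^ length x" using lab[OF e] period_less uv by simp
    ultimately show ?thesis using bits_val_bit uv by (simp add: cert_label_def)
  qed
  have arc: "arc_bit x c u v \<longleftrightarrow> (u, v) \<in> parcs G" if "u < n" "v < n" for u v
    using that K by (simp add: arc_bit_def c F_def)
  have graph: "cert_graph x c = G"
    using arc arc_n verts unfolding cert_graph_def order by (intro pair_pre_digraph.equality) auto
  have code: "x = instance_code x c"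
  proof -
    have "instance_code x c = encode (G, cert_matrix x c, \<Delta>)" unfolding instance_code_eq graph period ..
    also have "\<dots> = x"
    proof -
      have "concat (map (\<lambda>u. concat (map (\<lambda>v. encode_enat (cert_matrix x c u v)) [0..<n])) [0..<n]) =
        concat (map (\<lambda>u. concat (map (\<lambda>v. encode_enat (D u v)) [0..<n])) [0..<n])"
        using matrix by (intro arg_cong[of _ _ concat] map_cong) auto
      then show ?thesis by (simp only: x conv encode_conv[OF verts])
    qed
    finally show ?thesis ..
  qed
  have path: "path_valid x c u v \<and> (unbounded x c u v \<or> path_fast x c u v)" if uv: "u < n" "v < n" "u \<noteq> v" for u v
  proof -
    let ?P = "PP u v" let ?l = "LL u v" let ?Q = "path_vertex x c u v"
    have g: "0 < ?l" "?P 0 = u" "?P ?l = v" "inj_on ?P {..<Suc ?l}" "\<And>i. i < ?l \<Longrightarrow> path_arc ?P i \<in> parcs G"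
      "\<And>d. D u v = enat d \<Longrightarrow> lab (path_arc ?P (?l - 1)) + descents lab ?P (?l - 1) * \<Delta> < d + lab (path_arc ?P 0)"
      using good[OF uv] unfolding good_def by auto
    have Pn: "?P i < n" if "i < Suc ?l" for i
    proof (cases "i = ?l")
      case False
      then show ?thesis using g(5)[of i] that arc_n by (auto simp: path_arc_def)
    qed (use g uv in simp)
    \<comment> \<open>The vertices of the path are distinct, so all of its positions fit below the
      radix.\<close>
    have "card (?P ` {..<Suc ?l}) \<le> card {..<n}" using Pn by (intro card_mono) auto
    then have ln: "?l < n" using card_image[OF g(4)] by simp
    have Q: "?Q i = ?P i" if "i < Suc ?l" for i
      unfolding path_vertex_def
    proof (rule bounded_least_eq)
      have i: "i < ?K" "?P i < n" using that ln K Pn by auto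
      then show "?P i \<le> order_of x" using order by simp
      show "\<not> c (address x 5 u v i s)" if "s < ?P i" for s using that i uv K by (simp add: c F_def)
      show "c (address x 5 u v i (?P i))" using i uv K by (simp add: c F_def)
    qed
    have len: "path_length x c u v = ?l"
      unfolding path_length_def
    proof (rule bounded_least_eq)
      show "?l \<le> order_of x" using ln order by simp
      show "?Q i \<noteq> v" if "i < ?l" for i using Q[of i] g(3) inj_onD[OF g(4), of i ?l] that by auto
      show "?Q ?l = v" using Q[of ?l] g(3) by simp
    qed
    have arcs: "path_arc ?Q i = path_arc ?P i" if "i < ?l" for i using Q that by (simp add: path_arc_def)
    have labs: "cert_label x c (path_arc ?Q i) = lab (path_arc ?P i)" if "i < ?l" for i
      using label[OF g(5)[OF that]] arcs[OF that] by simp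
    have "path_valid x c u v"
      unfolding path_valid_def len order
    proof (intro conjI allI impI)
      show "?Q 0 = u" "?Q ?l = v" using Q[of 0] Q[of ?l] g by simp_all
      fix i assume i: "i < ?l"
      show "?Q i < n" "?Q (Suc i) < n" using Q[of i] Q[of "Suc i"] Pn[of i] Pn[of "Suc i"] i by simp_all
      then show "arc_bit x c (?Q i) (?Q (Suc i))" using arc arcs[OF i] g(5)[OF i] by (simp add: path_arc_def)
    next
      fix i j assume "i < Suc ?l" "j < i"
      then show "?Q i \<noteq> ?Q j" using Q[of i] Q[of j] inj_onD[OF g(4), of i j] by auto
    qed
    moreover have "path_fast x c u v" if bounded: "\<not> unbounded x c u v"
    proof -
      obtain d where d: "D u v = enat d" using bounded matrix(2)[OF uv(1,2)] by auto
      then have "bits_val (matrix_bit x c u v) (length x) = d"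
        using matrix(1)[OF uv(1,2)] bounded by (simp add: cert_matrix_def)
      moreover have "descents (cert_label x c) ?Q (?l - 1) = descents lab ?P (?l - 1)"
        unfolding descents_def using labs by (intro sum.cong) auto
      ultimately show ?thesis
        unfolding path_fast_iff len period using labs[of 0] labs[of "?l - 1"] g(1) g(6)[OF d] by simp
    qed
    ultimately show ?thesis by blast
  qed
  have "check x c" unfolding check_def order digits_less_bits
  proof (intro conjI allI impI)
    show "0 < n" by (rule n0)
    show "x = instance_code x c" by (rule code)
    show "\<not> arc_bit x c u u" if "u < n" for u using arc[OF that that] pair_no_loops by force
    show "\<exists>i<length x. period_bit x c i"
      using \<Delta> period bits_val_pos[of "period_bit x c" "length x"] by (simp add: cert_period_def)
    show "bits_val (label_bit x c u v) (length x) < bits_val (period_bit x c) (length x)"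
      if "u < n" "v < n" "arc_bit x c u v" for u v
      using lab[of "(u, v)"] label[of "(u, v)"] arc[OF that(1,2)] that(3) period
      by (simp add: cert_label_def cert_period_def)
    show "u = v \<or> path_valid x c u v \<and> (unbounded x c u v \<or> path_fast x c u v)" if "u < n" "v < n" for u v
      using path[OF that] by blast
  qed
  moreover have "length w = ?K ^ 5" by (simp add: w_def eval_nat_numeral)
  ultimately show ?thesis unfolding c_def[abs_def] by blast
qed

section \<open>The verifier as a polynomial-time machine\<close>

text \<open>In \<open>encode_pair x u\<close> the even positions hold the continuation marks of
  \<open>delimit x\<close>, so the first one without \<open>True\<close> gives the length of
  \<open>x\<close>. The certificate begins right behind it.\<close>

definition "pairs w = bounded_least (Suc (length w)) (\<lambda>i. bit_sym w (2 * i) \<noteq> 2)"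
definition "payload w = map (\<lambda>i. bit_sym w (2 * i + 1) = 2) [0..<pairs w]"
definition cert_of :: "bool list \<Rightarrow> cert" where
  "cert_of w j \<longleftrightarrow> bit_sym w (2 * pairs w + 1 + j) = 2"

lemma delimit_nth:
  "i < length x \<Longrightarrow> delimit x ! (2 * i)"
  "i < length x \<Longrightarrow> delimit x ! Suc (2 * i) = x ! i"
  "\<not> delimit x ! (2 * length x)" "length (delimit x) = 2 * length x + 1"
proof -
  have "i < length x \<Longrightarrow> delimit x ! (2 * i) \<and> delimit x ! Suc (2 * i) = x ! i"
  proof (induct x arbitrary: i)
    case (Cons b x)
    then show ?case by (cases i) auto
  qed simp
  then show "i < length x \<Longrightarrow> delimit x ! (2 * i)" "i < length x \<Longrightarrow> delimit x ! Suc (2 * i) = x ! i" by auto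
  show "\<not> delimit x ! (2 * length x)" "length (delimit x) = 2 * length x + 1" by (induct x) auto
qed

lemma encode_pair_decode:
  "payload (encode_pair x u) = x" "cert_of (encode_pair x u) j \<longleftrightarrow> j < length u \<and> u ! j"
proof -
  let ?w = "encode_pair x u"
  note [simp] = encode_pair_def bit_sym_def nth_append delimit_nth
  have p: "pairs ?w = length x" unfolding pairs_def
    by (rule bounded_least_eq) auto
  show "payload ?w = x" unfolding payload_def p by (rule nth_equalityI) (auto simp del: upt_Suc)
  show "cert_of ?w j \<longleftrightarrow> j < length u \<and> u ! j" unfolding cert_of_def p by auto
qed

lemma pf_pairs [pf_intros]: "pf (\<lambda>w (e :: 'e::env). pairs w)"
  unfolding pairs_def by (intro pf_intros)

lemma pf_payload [pf_intros]: "pf_list (\<lambda>w (e :: 'e::env). payload w)"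
  unfolding payload_def by (intro pf_intros)

lemma pf_length_payload [pf_intros]: "pf (\<lambda>w (e :: 'e::env). length (payload w))"
  by (rule pf_list_length[OF pf_payload])

lemma pf_bit_payload [pf_intros]: "pf F \<Longrightarrow> pf (\<lambda>w e. bit_sym (payload w) (F w e))"
  by (rule pf_list_bit_sym[OF pf_payload])

lemma pf_cert [pf_intros]: "pf F \<Longrightarrow> pf (\<lambda>w e. of_bool (cert_of w (F w e)))"
  unfolding cert_of_def by (intro pf_intros)

lemma pf_order [pf_intros]: "pf (\<lambda>w (e :: 'e::env). order_of (payload w))"
  unfolding order_of_def by (intro pf_intros)

lemma pf_address [pf_intros]:
  "pf A \<Longrightarrow> pf U \<Longrightarrow> pf V \<Longrightarrow> pf I \<Longrightarrow> pf S \<Longrightarrow>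
    pf (\<lambda>w e. address (payload w) (A w e) (U w e) (V w e) (I w e) (S w e))"
  unfolding address_def side_length_def by (intro pf_intros)

lemma pf_fields [pf_intros]:
  "pf I \<Longrightarrow> pf (\<lambda>w e. of_bool (period_bit (payload w) (cert_of w) (I w e)))"
  "pf U \<Longrightarrow> pf V \<Longrightarrow> pf (\<lambda>w e. of_bool (unbounded (payload w) (cert_of w) (U w e) (V w e)))"
  "pf U \<Longrightarrow> pf V \<Longrightarrow> pf I \<Longrightarrow> pf (\<lambda>w e. of_bool (matrix_bit (payload w) (cert_of w) (U w e) (V w e) (I w e)))"
  "pf U \<Longrightarrow> pf V \<Longrightarrow> pf I \<Longrightarrow> pf (\<lambda>w e. of_bool (label_bit (payload w) (cert_of w) (U w e) (V w e) (I w e)))"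
  "pf U \<Longrightarrow> pf V \<Longrightarrow> pf (\<lambda>w e. of_bool (arc_bit (payload w) (cert_of w) (U w e) (V w e)))"
  unfolding period_bit_def unbounded_def matrix_bit_def label_bit_def arc_bit_def by (intro pf_intros; assumption)+

lemma pf_path_vertex [pf_intros]:
  assumes "pf U" "pf V" "pf I"
  shows "pf (\<lambda>w e. path_vertex (payload w) (cert_of w) (U w e) (V w e) (I w e))"
  unfolding path_vertex_def by (intro pf_intros assms[THEN pf_weaken])

lemma pf_path_length [pf_intros]:
  assumes "pf U" "pf V"
  shows "pf (\<lambda>w e. path_length (payload w) (cert_of w) (U w e) (V w e))"
  unfolding path_length_def by (intro pf_intros assms[THEN pf_weaken])

lemma pf_path_label_bit [pf_intros]:
  assumes "pf U" "pf V" "pf J" "pf I"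
  shows "pf (\<lambda>w e. of_bool (path_label_bit (payload w) (cert_of w) (U w e) (V w e) (J w e) (I w e)))"
  unfolding path_label_bit_def by (intro pf_intros assms)

lemma pf_path_descents [pf_intros]:
  assumes "pf U" "pf V"
  shows "pf (\<lambda>w e. path_descents (payload w) (cert_of w) (U w e) (V w e))"
  unfolding path_descents_def by (intro pf_intros pf_digits_less assms[THEN pf_weaken] assms)

lemma pf_code_bits:
  assumes "pf L" "pf (\<lambda>x p. of_bool (b x (fst p) (snd p)))"
  shows "pf_list (\<lambda>x (e :: 'e::env). code_bits (b x e) (L x e))"
proof -
  have "pf (\<lambda>x (p :: ('e \<times> nat) \<times> nat). of_bool (b x (fst (fst (fst p), snd p)) (snd (fst (fst p), snd p))))"
    by (rule pf_weaken[OF assms(2)]) (intro pf_intros)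
  then have b: "pf (\<lambda>x (p :: ('e \<times> nat) \<times> nat). of_bool (b x (fst (fst p)) (snd p)))" by simp
  show ?thesis unfolding code_bits_def bits_width_def
    by (intro pf_intros assms b assms(1)[THEN pf_weaken])
qed

lemma pf_check: "pf (\<lambda>w (e :: unit). of_bool (check (payload w) (cert_of w)))"
  unfolding check_def instance_code_def path_valid_def path_fast_def
  by (intro pf_intros pf_digits_less pf_list_eq pf_code_bits)

theorem DiTGR_in_NP: "in_NP DiTGR"
  unfolding NP_on_def
proof (intro exI conjI ballI)
  let ?V = "{w. check (payload w) (cert_of w)}"
  \<comment> \<open>At \<open>length x\<close> this is \<open>side_length x ^ 5\<close>, the number
    of addresses.\<close>
  let ?p = "[:8, 1 :: nat:] ^ 5"
  have "pf_list (\<lambda>w (e :: unit). [w \<in> ?V])"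
    unfolding mem_Collect_eq by (intro pf_list_single pf_check)
  then show "polytime_decidable ?V" unfolding polytime_decidable_def by (rule pf_list_polytime)
  fix x
  show "x \<in> DiTGR \<longleftrightarrow> (\<exists>u. length u \<le> poly ?p (length x) \<and> encode_pair x u \<in> ?V)"
  proof
    assume "x \<in> DiTGR"
    then obtain I where I: "x = encode I" "encodable I" "ditgr_yes I" unfolding DiTGR_def by blast
    obtain G D \<Delta> where "I = (G, D, \<Delta>)" by (rule prod_cases3)
    note I = I[unfolded this]
    obtain u where u: "length u = side_length x ^ 5" "check x (\<lambda>j. j < length u \<and> u ! j)"
      using check_complete[OF I(2,3,1)] by blast
    have "cert_of (encode_pair x u) = (\<lambda>j. j < length u \<and> u ! j)"
      by (rule ext) (rule encode_pair_decode(2))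
    then have "encode_pair x u \<in> ?V" using u(2) by (simp only: encode_pair_decode(1) mem_Collect_eq)
    moreover have "length u \<le> poly ?p (length x)" using u(1) by (simp add: side_length_def poly_power add.commute)
    ultimately show "\<exists>u. length u \<le> poly ?p (length x) \<and> encode_pair x u \<in> ?V" by blast
  next
    assume "\<exists>u. length u \<le> poly ?p (length x) \<and> encode_pair x u \<in> ?V"
    then obtain u where "check (payload (encode_pair x u)) (cert_of (encode_pair x u))" by blast
    then have "check x (cert_of (encode_pair x u))" by (simp only: encode_pair_decode)
    then show "x \<in> DiTGR" by (rule check_sound)
  qed
qed

theorem theorem11:
  shows "NP_complete DiTGR \<and> NP_complete_on DiTGR_restricted_instances DiTGR"
proof -
  \<comment> \<open>Membership passes from all strings to a set of admissible inputs, and hardness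
    passes the other way.\<close>
  have "NP_on DiTGR_restricted_instances DiTGR" using DiTGR_in_NP unfolding NP_on_def by blast
  moreover have "NP_hard_on UNIV DiTGR" using NP_hard_restricted unfolding NP_hard_on_def by blast
  ultimately show ?thesis using DiTGR_in_NP NP_hard_restricted by (simp add: NP_complete_on_def)
qed

end
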